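(* Let $\ell\in\mathbb{N}$, let $(X,\mathcal{B},\mu,T_1,\ldots,T_\ell)$ be a weakly mixing system (i.e. the $T_i$ commute and each $T_i$ is weakly mixing), let $f_1,\ldots,f_\ell\in L^\infty(\mu)$, and let $g_1,\ldots,g_\ell\in\mathcal{T}$ satisfy $g_\ell\prec\cdots\prec g_1$. Then $$\lim_{N\to\infty}\left\|\frac{1}{N}\sum_{n=1}^N T_1^{[g_1(n)]}f_1\cdots T_\ell^{[g_\ell(n)]}f_\ell-\prod_{i=1}^\ell\int f_i\,d\mu\right\|_{L^2(\mu)}=0.$$
   Context: $\omega=\{0,1,2,\ldots\}$, $\mathbb{N}=\{1,2,\ldots\}$. A system $(X,\mathcal{B},\mu,T_1,\ldots,T_\ell)$ is a probability space $(X,\mathcal{B},\mu)$ with invertible measure preserving transformations $T_i:X\to X$ that commute: $T_iT_j=T_jT_i$ for all $i,j$. $T$ is weakly mixing if $T\times T$ is ergodic for $\mu\times\mu$. $Tf:=f\circ T$. $[x]$ is the largest integer $\le x$. $\mathbb{R}^+$ denotes some half-line $[x_0,\infty)$, $x_0\ge0$ (allowed to depend on the function); all statements about functions concern sufficiently large $x$ (values of $g(n)$ for finitely many $n$ are irrelevant). $g_2\prec g_1$ means $|g_1(x)|/|g_2(x)|\to\infty$ as $x\to\infty$. $\mathcal{R}:=\{g\in C^\infty(\mathbb{R}^+):\ \lim_{x\to\infty}\frac{xg^{(j+1)}(x)}{g^{(j)}(x)}\in\mathbb{R}\text{ for all }j\in\omega\}$ (real-valued functions; the limits are required to exist and be finite).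 For $i\in\omega$, $\mathcal{T}_i:=\{g\in\mathcal{R}:\ \text{there is }\alpha\text{ with } i<\alpha\le i+1,\ \lim_{x\to\infty}\frac{xg'(x)}{g(x)}=\alpha,\ \text{and}\ \lim_{x\to\infty}g^{(i+1)}(x)=0\}$, and $\mathcal{T}:=\bigcup_{i=0}^\infty\mathcal{T}_i$. *)

theory Defs
  imports "HOL-Probability.Probability"
begin

definition invertible_measure_preserving :: "'a measure \<Rightarrow> ('a \<Rightarrow> 'a) \<Rightarrow> bool"
  where "invertible_measure_preserving M T \<longleftrightarrow>
    bij_betw T (space M) (space M) \<and>
    T \<in> measurable M M \<and>
    inv_into (space M) T \<in> measurable M M \<and>
    (\<forall>A\<in>sets M. emeasure M (T -` A \<inter> space M) = emeasure M A)"

definition ergodic :: "'a measure \<Rightarrow> ('a \<Rightarrow> 'a) \<Rightarrow> bool"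
  where "ergodic M T \<longleftrightarrow>
    (\<forall>A\<in>sets M. T -` A \<inter> space M = A \<longrightarrow> measure M A = 0 \<or> measure M A = 1)"

definition weakly_mixing :: "'a measure \<Rightarrow> ('a \<Rightarrow> 'a) \<Rightarrow> bool"
  where "weakly_mixing M T \<longleftrightarrow> ergodic (M \<Otimes>\<^sub>M M) (map_prod T T)"

definition measure_preserving_system :: "'a measure \<Rightarrow> nat \<Rightarrow> (nat \<Rightarrow> 'a \<Rightarrow> 'a) \<Rightarrow> bool"
  where "measure_preserving_system M l T \<longleftrightarrow>
    prob_space M \<and>
    (\<forall>i\<in>{1..l}. invertible_measure_preserving M (T i)) \<and>
    (\<forall>i\<in>{1..l}. \<forall>j\<in>{1..l}. \<forall>x\<in>space M. T i (T j x) = T j (T i x))"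

definition weakly_mixing_system :: "'a measure \<Rightarrow> nat \<Rightarrow> (nat \<Rightarrow> 'a \<Rightarrow> 'a) \<Rightarrow> bool"
  where "weakly_mixing_system M l T \<longleftrightarrow>
    measure_preserving_system M l T \<and> (\<forall>i\<in>{1..l}. weakly_mixing M (T i))"

text \<open>Integer powers; the inverse is taken on the underlying space only, since
  nothing is assumed about \<open>T\<close> outside of it.\<close>

definition int_iterate :: "'a measure \<Rightarrow> ('a \<Rightarrow> 'a) \<Rightarrow> int \<Rightarrow> 'a \<Rightarrow> 'a"
  where "int_iterate M T k =
    (if k \<ge> 0 then T ^^ nat k else inv_into (space M) T ^^ nat (- k))"

definition koopman :: "'a measure \<Rightarrow> ('a \<Rightarrow> 'a) \<Rightarrow> int \<Rightarrow> ('a \<Rightarrow> complex) \<Rightarrow> 'a \<Rightarrow> complex"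
  where "koopman M T k f = f \<circ> int_iterate M T k"

definition L_infinity :: "'a measure \<Rightarrow> ('a \<Rightarrow> complex) set"
  where "L_infinity M = {f \<in> borel_measurable M. \<exists>C. AE x in M. norm (f x) \<le> C}"

definition L2_norm :: "'a measure \<Rightarrow> ('a \<Rightarrow> complex) \<Rightarrow> real"
  where "L2_norm M f = sqrt (\<integral>x. (norm (f x))\<^sup>2 \<partial>M)"

text \<open>Functions on a half-line are represented by total functions whose values to the
  left of the half-line are unconstrained.\<close>

definition smooth_on_half_line :: "(real \<Rightarrow> real) \<Rightarrow> bool"
  where "smooth_on_half_line g \<longleftrightarrow>
    (\<exists>x0\<ge>0. \<forall>j. \<forall>x\<ge>x0. (deriv ^^ j) g field_differentiable at x)"

text \<open>The existence of the limits of the quotients includes that the quotients are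
  defined for all large arguments. As division by zero is total here, the nonvanishing of the
  denominators has to be required explicitly.\<close>

definition class_R :: "(real \<Rightarrow> real) set"
  where "class_R = {g. smooth_on_half_line g \<and>
    (\<forall>j. (\<forall>\<^sub>F x in at_top. (deriv ^^ j) g x \<noteq> 0) \<and>
         (\<exists>L. ((\<lambda>x. x * (deriv ^^ Suc j) g x / (deriv ^^ j) g x) \<longlongrightarrow> L) at_top))}"

definition tempered_of_order :: "nat \<Rightarrow> (real \<Rightarrow> real) set"
  where "tempered_of_order i = {g \<in> class_R.
    (\<exists>\<alpha>. real i < \<alpha> \<and> \<alpha> \<le> real i + 1 \<and> ((\<lambda>x. x * deriv g x / g x) \<longlongrightarrow> \<alpha>) at_top) \<and>
    ((deriv ^^ (i + 1)) g \<longlongrightarrow> 0) at_top}"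

definition tempered :: "(real \<Rightarrow> real) set"
  where "tempered = (\<Union>i. tempered_of_order i)"

definition grows_slower :: "(real \<Rightarrow> real) \<Rightarrow> (real \<Rightarrow> real) \<Rightarrow> bool"  (infix \<open>\<prec>\<^sub>g\<close> 50)
  where "g2 \<prec>\<^sub>g g1 \<longleftrightarrow> filterlim (\<lambda>x. \<bar>g1 x\<bar> / \<bar>g2 x\<bar>) at_top at_top"

end

theory Submission
  imports Defs "HOL-Real_Asymp.Real_Asymp"
begin

text \<open>The factors are replaced by their integrals one at a time, starting with the fastest. So let \<open>f\<^sub>1\<close> have
  integral \<open>0\<close>, and let \<open>d\<close> be the order of \<open>g\<^sub>1\<close>, so that \<open>\<Phi> = g\<^sub>1\<^sup>(\<^sup>d\<^sup>+\<^sup>1\<^sup>)\<close> tends to \<open>0\<close>. One shows that the averages with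
  arbitrary bounded weights \<open>c\<^sub>n\<close> tend to \<open>0\<close>. With these weights, bounded errors in the exponents are harmless, so that
  integer parts are additive for all purposes. The van der Corput inequality with shifts \<open>n + h\<close> reduces the
  family of exponents as in Bergelson's PET induction, where the degree of a function \<open>p\<close> is the least \<open>r\<close> such that
  \<open>p\<^sup>(\<^sup>r\<^sup>)\<close> is of the order of \<open>\<Phi>\<close> and the higher derivatives are negligible. In the end all exponents have degree at most \<open>1\<close>. Then
  \<open>\<phi> = g\<^sub>1\<^sup>(\<^sup>d\<^sup>)\<close> is taken as a new time, in which the exponents are linear with distinct slopes in the direction of \<open>T\<^sub>1\<close>
  and constant in the other directions up to bounded errors, and Furstenberg's induction on the number of
  factors applies. Only the weak mixing of \<open>T\<^sub>1\<close> is used in treating \<open>f\<^sub>1\<close>.\<close>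

section \<open>Weighted means and the van der Corput inequality\<close>

text \<open>Differencing has to stop at degree 1. If \<open>d = 0\<close>, for instance, \<theta> =
  \<open>\<bar>g_1'\<bar>\<close> tends to 0, so a shift of \<open>n\<close> by \<open>h\<close>
  hardly moves the exponent and the shifted factor carries no new information. In the time
  \<open>k = \<phi> n\<close> the same shift moves the exponent by about \<open>b * h\<close>, which
  weak mixing can use. The price is that about \<open>W k = \<psi> (k + 1) - \<psi> k\<close>
  indices \<open>n\<close> share one value of \<open>k\<close>; hence weighted means. The van der
  Corput inequality survives because \<open>W\<close> is increasing and its last value is negligible
  against its sum; the first holds because \<theta> decreases, the second because
  \<open>x * \<theta> x\<close> tends to infinity. This is where \<alpha> > d enters:
  \<open>x * \<theta> x / \<phi> x\<close> tends to \<alpha> - d > 0. The slower functions have a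
  derivative of order \<open>d + 1\<close> that is negligible against \<theta>, so they enter with
  leading coefficient 0, and every leading coefficient that occurs later comes from
  \<open>g_1\<close>.\<close>

definition wmean :: "(nat \<Rightarrow> real) \<Rightarrow> (nat \<Rightarrow> 'b::real_vector) \<Rightarrow> nat \<Rightarrow> 'b"
  where "wmean W a N = (\<Sum>n<N. W n *\<^sub>R a n) /\<^sub>R (\<Sum>n<N. W n)"

text \<open>Monotonicity and a last weight that is negligible against the total are what Abel
  summation needs to make weighted means asymptotically shift-invariant.\<close>

definition admissible_weight :: "(nat \<Rightarrow> real) \<Rightarrow> bool"
  where "admissible_weight W \<longleftrightarrow> (\<forall>n. 0 < W n) \<and> mono W \<and>
    (\<lambda>N. W N / (\<Sum>n<Suc N. W n)) \<longlonglongrightarrow> 0"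

lemma wmean_add: "wmean W (\<lambda>n. a n + b n) N = wmean W a N + wmean W b N"
  by (simp add: wmean_def scaleR_add_right sum.distrib)

lemma wmean_diff: "wmean W (\<lambda>n. a n - b n) N = wmean W a N - wmean W b N"
  by (simp add: wmean_def scaleR_diff_right sum_subtractf)

lemma wmean_cmult:
  fixes a :: "nat \<Rightarrow> 'b::real_algebra"
  shows "wmean W (\<lambda>n. r * a n) N = r * wmean W a N"
  by (simp add: wmean_def sum_distrib_left)

lemma wmean_sum: "wmean W (\<lambda>n. \<Sum>i\<in>I. a i n) N = (\<Sum>i\<in>I. wmean W (a i) N)"
proof (induction I rule: infinite_finite_induct)
  case (insert i I)
  then show ?case by (simp add: wmean_add)
qed (simp_all add: wmean_def)

lemma wmean_cong: "(\<And>n. n < N \<Longrightarrow> a n = b n) \<Longrightarrow> wmean W a N = wmean W b N"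
  by (simp add: wmean_def)

context
  fixes W :: "nat \<Rightarrow> real"
  assumes pos: "\<And>n. 0 < W n"
begin

lemma sum_weight_nonneg: "0 \<le> (\<Sum>n<N. W n)"
  by (intro sum_nonneg less_imp_le pos)

lemma sum_weight_pos: "0 < N \<Longrightarrow> 0 < (\<Sum>n<N. W n)"
  by (intro sum_pos pos) auto

lemma wmean_mono:
  fixes a :: "nat \<Rightarrow> real"
  assumes "\<And>n. n < N \<Longrightarrow> a n \<le> b n"
  shows "wmean W a N \<le> wmean W b N"
  unfolding wmean_def using assms
  by (auto intro!: mult_left_mono sum_mono simp: sum_weight_nonneg less_imp_le[OF pos])

lemma wmean_nonneg:
  fixes a :: "nat \<Rightarrow> real"
  assumes "\<And>n. n < N \<Longrightarrow> 0 \<le> a n"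
  shows "0 \<le> wmean W a N"
  using wmean_mono[of N "\<lambda>_. 0" a] assms by (simp add: wmean_def)

lemma wmean_const: "0 < N \<Longrightarrow> wmean W (\<lambda>_. r) N = r"
  using sum_weight_pos[of N] by (simp add: wmean_def flip: scaleR_sum_left)

lemma norm_wmean_le:
  fixes a :: "nat \<Rightarrow> 'b::real_normed_vector"
  shows "norm (wmean W a N) \<le> wmean W (\<lambda>n. norm (a n)) N"
proof -
  have "norm (\<Sum>n<N. W n *\<^sub>R a n) \<le> (\<Sum>n<N. W n *\<^sub>R norm (a n))"
    by (rule order_trans[OF norm_sum]) (auto intro!: sum_mono simp: less_imp_le[OF pos])
  then show ?thesis
    by (auto simp: wmean_def sum_weight_nonneg intro!: mult_left_mono)
qed

lemma norm_wmean_bound: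
  fixes a :: "nat \<Rightarrow> 'b::real_normed_vector"
  assumes "\<And>n. n < N \<Longrightarrow> norm (a n) \<le> B" "0 \<le> B"
  shows "norm (wmean W a N) \<le> B"
proof (cases "N = 0")
  case True then show ?thesis using assms by (simp add: wmean_def)
next
  case False
  then show ?thesis
    using order_trans[OF norm_wmean_le[of a N] wmean_mono[of N "\<lambda>n. norm (a n)" "\<lambda>_. B"]] assms
    by (simp add: wmean_const)
qed

text \<open>The weighted variance is nonnegative.\<close>

lemma wmean_jensen:
  fixes a :: "nat \<Rightarrow> real"
  shows "(wmean W a N)\<^sup>2 \<le> wmean W (\<lambda>n. (a n)\<^sup>2) N"
proof (cases "N = 0")
  case False
  define m where "m = wmean W a N"
  have "0 \<le> wmean W (\<lambda>n. (a n - m)\<^sup>2) N"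
    by (rule wmean_nonneg) simp
  also have "(\<lambda>n. (a n - m)\<^sup>2) = (\<lambda>n. (a n)\<^sup>2 - (2 * m) * a n + m\<^sup>2)"
    by (simp add: power2_eq_square algebra_simps)
  also have "wmean W \<dots> N = wmean W (\<lambda>n. (a n)\<^sup>2) N - 2 * m * m + m\<^sup>2"
    using False by (simp only: wmean_add wmean_diff wmean_cmult wmean_const flip: m_def)
  finally show ?thesis
    by (simp add: m_def power2_eq_square)
qed (simp add: wmean_def)

text \<open>Abel summation: for monotone weights both the boundary term and the sum of the
  increments are of the size of the last weight \<open>W (N - 1)\<close>.\<close>

lemma norm_wmean_shift_Suc:
  fixes a :: "nat \<Rightarrow> 'b::real_normed_vector"
  assumes "mono W" and B: "\<And>n. norm (a n) \<le> B" and "0 < N"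
  shows "norm (wmean W (\<lambda>n. a (Suc n)) N - wmean W a N) \<le> 2 * B * (W (N - 1) / (\<Sum>n<N. W n))"
proof -
  have B0: "0 \<le> B" using B[of 0] norm_ge_zero order_trans by blast
  obtain K where K: "N = Suc K" using \<open>0 < N\<close> gr0_implies_Suc by blast
  have inc: "W n \<le> W (Suc n)" for n using \<open>mono W\<close> by (simp add: mono_iff_le_Suc)
  \<comment> \<open>Once the boundary term is taken away, there remain the term \<open>a 0\<close>
    with weight \<open>W 0\<close> and later terms with the increments of \<open>W\<close> as
    weights; all these weights add up to \<open>W k\<close>.\<close>
  have "norm ((\<Sum>n<Suc k. W n *\<^sub>R a (Suc n)) - (\<Sum>n<Suc k. W n *\<^sub>R a n) - W k *\<^sub>R a (Suc k)) \<le> B * W k" for k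
  proof (induction k)
    case 0
    then show ?case using B[of 0] pos[of 0] mult.commute[of B] by (simp add: mult_left_mono)
  next
    case (Suc k)
    have "(\<Sum>n<Suc (Suc k). W n *\<^sub>R a (Suc n)) - (\<Sum>n<Suc (Suc k). W n *\<^sub>R a n) - W (Suc k) *\<^sub>R a (Suc (Suc k))
       = ((\<Sum>n<Suc k. W n *\<^sub>R a (Suc n)) - (\<Sum>n<Suc k. W n *\<^sub>R a n) - W k *\<^sub>R a (Suc k)) - (W (Suc k) - W k) *\<^sub>R a (Suc k)"
      by (simp add: algebra_simps)
    also have "norm \<dots> \<le> B * W k + (W (Suc k) - W k) * B"
    proof (rule order_trans[OF norm_triangle_ineq4 add_mono[OF Suc]])
      show "norm ((W (Suc k) - W k) *\<^sub>R a (Suc k)) \<le> (W (Suc k) - W k) * B"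
        using B[of "Suc k"] inc[of k] by (simp add: mult_left_mono)
    qed
    finally show ?case by (simp add: algebra_simps)
  qed
  from this[of K] have X: "norm ((\<Sum>n<N. W n *\<^sub>R a (Suc n)) - (\<Sum>n<N. W n *\<^sub>R a n) - W K *\<^sub>R a (Suc K)) \<le> B * W K"
    by (simp only: K)
  have Y: "norm (W K *\<^sub>R a (Suc K)) \<le> W K * B"
    using mult_left_mono[OF B[of "Suc K"] less_imp_le[OF pos[of K]]] pos[of K] by simp
  have "norm ((\<Sum>n<N. W n *\<^sub>R a (Suc n)) - (\<Sum>n<N. W n *\<^sub>R a n)) \<le> B * W K + W K * B"
    using X Y norm_triangle_ineq2[of "(\<Sum>n<N. W n *\<^sub>R a (Suc n)) - (\<Sum>n<N. W n *\<^sub>R a n)" "W K *\<^sub>R a (Suc K)"]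
    by linarith
  then have "norm ((\<Sum>n<N. W n *\<^sub>R a (Suc n)) - (\<Sum>n<N. W n *\<^sub>R a n)) / (\<Sum>n<N. W n) \<le> (2 * B * W K) / (\<Sum>n<N. W n)"
    by (intro divide_right_mono) (auto simp: sum_weight_nonneg)
  moreover have "wmean W (\<lambda>n. a (Suc n)) N - wmean W a N
     = ((\<Sum>n<N. W n *\<^sub>R a (Suc n)) - (\<Sum>n<N. W n *\<^sub>R a n)) /\<^sub>R (\<Sum>n<N. W n)"
    by (simp add: wmean_def scaleR_diff_right)
  ultimately show ?thesis
    using sum_weight_nonneg[of N] by (simp add: K divide_inverse mult_ac)
qed

lemma norm_wmean_shift:
  fixes a :: "nat \<Rightarrow> 'b::real_normed_vector"
  assumes "mono W" and B: "\<And>n. norm (a n) \<le> B" and "0 < N"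
  shows "norm (wmean W (\<lambda>n. a (n + h)) N - wmean W a N) \<le> real h * (2 * B * (W (N - 1) / (\<Sum>n<N. W n)))"
proof (induction h)
  case (Suc h)
  have "norm (wmean W (\<lambda>n. a (Suc n + h)) N - wmean W (\<lambda>n. a (n + h)) N) \<le> 2 * B * (W (N - 1) / (\<Sum>n<N. W n))"
    using norm_wmean_shift_Suc[of "\<lambda>n. a (n + h)" B N] assms by simp
  then have "norm (wmean W (\<lambda>n. a (Suc n + h)) N - wmean W a N)
      \<le> 2 * B * (W (N - 1) / (\<Sum>n<N. W n)) + real h * (2 * B * (W (N - 1) / (\<Sum>n<N. W n)))"
    using Suc norm_triangle_ineq[of "wmean W (\<lambda>n. a (Suc n + h)) N - wmean W (\<lambda>n. a (n + h)) N" "wmean W (\<lambda>n. a (n + h)) N - wmean W a N"]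
    by simp
  then show ?case
    by (simp add: distrib_right add_divide_distrib)
qed simp

end

lemma admissible_weightD:
  assumes "admissible_weight W"
  shows "\<And>n. 0 < W n" "mono W" "(\<lambda>N. W (N - 1) / (\<Sum>n<N. W n)) \<longlonglongrightarrow> 0"
proof -
  show "\<And>n. 0 < W n" "mono W" using assms by (auto simp: admissible_weight_def)
  have "(\<lambda>N. W (Suc N - 1) / (\<Sum>n<Suc N. W n)) \<longlonglongrightarrow> 0"
    using assms by (simp add: admissible_weight_def)
  then show "(\<lambda>N. W (N - 1) / (\<Sum>n<N. W n)) \<longlonglongrightarrow> 0"
    by (rule LIMSEQ_imp_Suc)
qed

lemma admissible_weight_const: "admissible_weight (\<lambda>_. 1)"
  unfolding admissible_weight_def
  by (auto simp: mono_def) real_asymp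

text \<open>The bound holds at every point, even outside \<open>space M\<close>, so that composition
  with any map keeps it without a discussion of null sets. Elements of \<open>L_infinity\<close> are
  truncated to this form at the very end.\<close>

definition bounded_measurable :: "'a measure \<Rightarrow> ('a \<Rightarrow> complex) \<Rightarrow> bool"
  where "bounded_measurable M f \<longleftrightarrow> f \<in> borel_measurable M \<and> (\<exists>B. \<forall>x. cmod (f x) \<le> B)"

lemma bounded_measurableI: "f \<in> borel_measurable M \<Longrightarrow> (\<And>x. cmod (f x) \<le> B) \<Longrightarrow> bounded_measurable M f"
  by (auto simp: bounded_measurable_def)

lemma bounded_measurable_measurable: "bounded_measurable M f \<Longrightarrow> f \<in> borel_measurable M"
  by (simp add: bounded_measurable_def)

lemma bounded_measurable_bound:
  assumes "bounded_measurable M f"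
  obtains B where "0 < B" "\<And>x. cmod (f x) \<le> B"
proof -
  obtain B where "\<forall>x. cmod (f x) \<le> B" using assms by (auto simp: bounded_measurable_def)
  then show ?thesis by (intro that[of "max B 1"]) (auto simp: le_max_iff_disj)
qed

lemma bounded_measurable_const [simp]: "bounded_measurable M (\<lambda>_. c)"
  by (rule bounded_measurableI) auto

lemma bounded_measurable_add:
  assumes "bounded_measurable M f" "bounded_measurable M g"
  shows "bounded_measurable M (\<lambda>x. f x + g x)"
proof -
  obtain B C where "\<And>x. cmod (f x) \<le> B" "\<And>x. cmod (g x) \<le> C"
    using assms by (meson bounded_measurable_bound)
  then show ?thesis
    using assms by (intro bounded_measurableI[of _ _ "B + C"])
      (auto simp: bounded_measurable_def intro: norm_triangle_le add_mono)
qed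

lemma bounded_measurable_mult:
  assumes "bounded_measurable M f" "bounded_measurable M g"
  shows "bounded_measurable M (\<lambda>x. f x * g x)"
proof -
  obtain B C where "0 < B" "\<And>x. cmod (f x) \<le> B" "\<And>x. cmod (g x) \<le> C"
    using assms by (meson bounded_measurable_bound)
  then have "cmod (f x * g x) \<le> B * C" for x
    unfolding norm_mult by (intro mult_mono) auto
  then show ?thesis
    using assms by (intro bounded_measurableI[of _ _ "B * C"]) (auto simp: bounded_measurable_def)
qed

lemma bounded_measurable_cnj:
  "bounded_measurable M f \<Longrightarrow> bounded_measurable M (\<lambda>x. cnj (f x))"
  unfolding bounded_measurable_def
  by (auto intro: measurable_compose[OF _ borel_measurable_continuous_onI] continuous_intros)

lemma bounded_measurable_diff:
  assumes "bounded_measurable M f" "bounded_measurable M g"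
  shows "bounded_measurable M (\<lambda>x. f x - g x)"
  using bounded_measurable_add[OF assms(1) bounded_measurable_mult[OF bounded_measurable_const[of M "-1"] assms(2)]]
  by simp

lemma bounded_measurable_sum:
  assumes "\<And>i. i \<in> I \<Longrightarrow> bounded_measurable M (f i)"
  shows "bounded_measurable M (\<lambda>x. \<Sum>i\<in>I. f i x)"
  using assms by (induction I rule: infinite_finite_induct) (auto intro: bounded_measurable_add)

lemma bounded_measurable_prod:
  assumes "\<And>i. i \<in> I \<Longrightarrow> bounded_measurable M (f i)"
  shows "bounded_measurable M (\<lambda>x. \<Prod>i\<in>I. f i x)"
  using assms by (induction I rule: infinite_finite_induct) (auto intro: bounded_measurable_mult)

lemma bounded_measurable_wmean:
  assumes "\<And>n. bounded_measurable M (u n)"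
  shows "bounded_measurable M (\<lambda>x. wmean W (\<lambda>n. u n x) N)"
  unfolding wmean_def scaleR_conv_of_real
  by (intro bounded_measurable_mult bounded_measurable_sum bounded_measurable_const assms)

context prob_space
begin

lemma integrable_bounded_measurable:
  assumes "bounded_measurable M f"
  shows "integrable M f"
  using assms unfolding bounded_measurable_def by (auto intro: integrable_const_bound)

lemma integrable_cmod_power2:
  assumes "bounded_measurable M f"
  shows "integrable M (\<lambda>x. (cmod (f x))\<^sup>2)"
proof -
  have "integrable M (\<lambda>x. Re (f x * cnj (f x)))"
    by (intro integrable_Re integrable_bounded_measurable bounded_measurable_mult bounded_measurable_cnj assms)
  then show ?thesis by (simp add: complex_mult_cnj cmod_power2)
qed

lemma integral_wmean:
  fixes u :: "nat \<Rightarrow> 'a \<Rightarrow> 'b::{banach, second_countable_topology}"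
  assumes "\<And>n. integrable M (u n)"
  shows "integrable M (\<lambda>x. wmean W (\<lambda>n. u n x) N)"
    and "(\<integral>x. wmean W (\<lambda>n. u n x) N \<partial>M) = wmean W (\<lambda>n. \<integral>x. u n x \<partial>M) N"
  unfolding wmean_def using assms by (auto simp: Bochner_Integration.integral_sum)

text \<open>Taking the supremum over the bounded coefficients \<open>c\<close> is what later makes bounded errors in
  integer exponents harmless: they split the range of summation into finitely many subsets, whose
  indicator functions can be absorbed into \<open>c\<close>.\<close>

definition mean_null :: "(nat \<Rightarrow> real) \<Rightarrow> (nat \<Rightarrow> 'a \<Rightarrow> complex) \<Rightarrow> bool"
  where "mean_null W u \<longleftrightarrow> (\<forall>\<epsilon>>0. \<forall>\<^sub>F N in sequentially. \<forall>c. (\<forall>n. cmod (c n) \<le> 1) \<longrightarrow>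
    (\<integral>x. (cmod (wmean W (\<lambda>n. c n * u n x) N))\<^sup>2 \<partial>M) \<le> \<epsilon>)"

lemma integral_power2_sum:
  assumes "finite I" and "\<And>i. i \<in> I \<Longrightarrow> bounded_measurable M (v i)"
  shows "(\<integral>x. (cmod (\<Sum>i\<in>I. v i x))\<^sup>2 \<partial>M) \<le> (\<Sum>i\<in>I. \<Sum>j\<in>I. cmod (\<integral>x. v i x * cnj (v j x) \<partial>M))"
proof -
  have int: "integrable M (\<lambda>x. v i x * cnj (v j x))" if "i \<in> I" "j \<in> I" for i j
    using that by (intro integrable_bounded_measurable bounded_measurable_mult bounded_measurable_cnj assms)
  have "complex_of_real (\<integral>x. (cmod (\<Sum>i\<in>I. v i x))\<^sup>2 \<partial>M) = (\<integral>x. complex_of_real ((cmod (\<Sum>i\<in>I. v i x))\<^sup>2) \<partial>M)"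
    by (rule integral_complex_of_real[symmetric])
  also have "\<dots> = (\<integral>x. (\<Sum>i\<in>I. \<Sum>j\<in>I. v i x * cnj (v j x)) \<partial>M)"
    by (simp only: complex_norm_square cnj_sum sum_product)
  also have "\<dots> = (\<Sum>i\<in>I. \<Sum>j\<in>I. (\<integral>x. v i x * cnj (v j x) \<partial>M))"
    using int by (simp add: Bochner_Integration.integral_sum)
  finally have "cmod (complex_of_real (\<integral>x. (cmod (\<Sum>i\<in>I. v i x))\<^sup>2 \<partial>M)) \<le> (\<Sum>i\<in>I. \<Sum>j\<in>I. cmod (\<integral>x. v i x * cnj (v j x) \<partial>M))"
    by (auto intro!: order_trans[OF norm_sum] sum_mono)
  then show ?thesis by (simp only: norm_of_real)
qed

end

text \<open>For fixed \<open>i\<close>, a given distance to \<open>i\<close> is attained by at most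
  one \<open>j\<close> on either side.\<close>

lemma sum_pairs_difference_le:
  fixes \<delta> :: "nat \<Rightarrow> real"
  assumes "\<And>h. 0 \<le> \<delta> h"
  shows "(\<Sum>i<H. \<Sum>j<H. \<delta> (if j \<le> i then i - j else j - i)) \<le> real H * (2 * (\<Sum>h<Suc H. \<delta> h))"
proof -
  have "(\<Sum>j<H. \<delta> (if j \<le> i then i - j else j - i)) \<le> 2 * (\<Sum>h<Suc H. \<delta> h)" if "i < H" for i
  proof -
    have "(\<Sum>j<H. \<delta> (if j \<le> i then i - j else j - i))
        = (\<Sum>j\<in>{..i}. \<delta> (i - j)) + (\<Sum>j\<in>{Suc i..<H}. \<delta> (j - i))"
    proof -
      have "{..<H} = {..i} \<union> {Suc i..<H}" using that by auto
      then have "(\<Sum>j<H. \<delta> (if j \<le> i then i - j else j - i)) =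
         (\<Sum>j\<in>{..i}. \<delta> (if j \<le> i then i - j else j - i)) + (\<Sum>j\<in>{Suc i..<H}. \<delta> (if j \<le> i then i - j else j - i))"
        by (simp add: sum.union_disjoint disjoint_iff)
      then show ?thesis by simp
    qed
    also have "(\<Sum>j\<in>{..i}. \<delta> (i - j)) \<le> (\<Sum>h<Suc H. \<delta> h)"
    proof -
      have "(\<Sum>j\<in>{..i}. \<delta> (i - j)) = sum \<delta> ((\<lambda>j. i - j) ` {..i})"
        by (rule sum.reindex_cong[symmetric]) (auto simp: inj_on_def)
      also have "\<dots> \<le> (\<Sum>h<Suc H. \<delta> h)"
        using that assms by (intro sum_mono2) auto
      finally show ?thesis .
    qed
    also have "(\<Sum>j\<in>{Suc i..<H}. \<delta> (j - i)) \<le> (\<Sum>h<Suc H. \<delta> h)"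
    proof -
      have "(\<Sum>j\<in>{Suc i..<H}. \<delta> (j - i)) = sum \<delta> ((\<lambda>j. j - i) ` {Suc i..<H})"
        by (rule sum.reindex_cong[symmetric]) (auto simp: inj_on_def)
      also have "\<dots> \<le> (\<Sum>h<Suc H. \<delta> h)"
        using that assms by (intro sum_mono2) auto
      finally show ?thesis .
    qed
    finally show ?thesis by simp
  qed
  then have "(\<Sum>i<H. \<Sum>j<H. \<delta> (if j \<le> i then i - j else j - i)) \<le> (\<Sum>i<H. 2 * (\<Sum>h<Suc H. \<delta> h))"
    by (intro sum_mono) auto
  then show ?thesis by simp
qed


text \<open>Averaging over \<open>H\<close> shifts changes a weighted mean negligibly. Jensen's
  inequality and expansion of the square then leave correlations of pairs of shifts, which depend
  only on the difference, again up to a negligible shift. Only moduli of correlations matter, so the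
  coefficients in \<open>mean_null\<close> cost nothing. The bounds \<delta> need to vanish only in
  Cesaro mean, the form in which weak mixing supplies them.\<close>

lemma (in prob_space) van_der_corput:
  fixes u :: "nat \<Rightarrow> 'a \<Rightarrow> complex"
  assumes W: "admissible_weight W"
    and u: "\<And>n. u n \<in> borel_measurable M" and B: "\<And>n x. cmod (u n x) \<le> B"
    and \<delta>: "\<And>h. 0 \<le> \<delta> h"
    and corr: "\<And>h \<epsilon>. 0 < h \<Longrightarrow> 0 < \<epsilon> \<Longrightarrow>
      \<forall>\<^sub>F N in sequentially. wmean W (\<lambda>n. cmod (\<integral>x. u (n + h) x * cnj (u n x) \<partial>M)) N \<le> \<delta> h + \<epsilon>"
    and \<delta>_mean: "(\<lambda>H. (\<Sum>h<H. \<delta> h) / real H) \<longlonglongrightarrow> 0"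
  shows "mean_null W u"
  unfolding mean_null_def
proof (intro allI impI)
  fix \<epsilon> :: real assume "0 < \<epsilon>"
  note pos = admissible_weightD(1)[OF W] and mono = admissible_weightD(2)[OF W]
  define \<omega> where "\<omega> N = W (N - 1) / (\<Sum>n<N. W n)" for N
  have \<omega>: "\<omega> \<longlonglongrightarrow> 0" using admissible_weightD(3)[OF W] unfolding \<omega>_def .
  have B0: "0 \<le> B" using B[of 0 undefined] norm_ge_zero order_trans by blast
  have bu: "bounded_measurable M (u n)" for n by (rule bounded_measurableI[OF u B])
  \<comment> \<open>Pairs of equal shifts get the trivial bound; there are only \<open>H\<close> of
    them among \<open>H\<^sup>2\<close>, so a large \<open>H\<close> makes them harmless.\<close>
  define \<delta>' where "\<delta>' h = (if h = 0 then B\<^sup>2 else \<delta> h)" for h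
  have \<delta>'0: "0 \<le> \<delta>' h" for h by (simp add: \<delta>'_def \<delta>)
  have "(\<lambda>H. (B\<^sup>2 + (\<delta> H + (\<Sum>h<H. \<delta> h))) / real H) \<longlonglongrightarrow> 0"
  proof -
    have 1: "(\<lambda>H. (\<Sum>h<Suc H. \<delta> h) / real (Suc H) * (real (Suc H) / real H)) \<longlonglongrightarrow> 0 * 1"
      by (intro tendsto_mult LIMSEQ_Suc[OF \<delta>_mean]) real_asymp
    have 2: "(\<lambda>H. B\<^sup>2 / real H) \<longlonglongrightarrow> 0" by real_asymp
    have "(\<lambda>H. B\<^sup>2 / real H + (\<Sum>h<Suc H. \<delta> h) / real (Suc H) * (real (Suc H) / real H)) \<longlonglongrightarrow> 0"
      using tendsto_add[OF 2 1] by simp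
    moreover have "(\<Sum>h<Suc H. \<delta> h) / real (Suc H) * (real (Suc H) / real H) = (\<Sum>h<Suc H. \<delta> h) / real H" for H
      by (simp del: of_nat_Suc sum.lessThan_Suc)
    ultimately have "(\<lambda>H. B\<^sup>2 / real H + (\<Sum>h<Suc H. \<delta> h) / real H) \<longlonglongrightarrow> 0"
      by (simp only:)
    then show ?thesis
      by (simp add: add_divide_distrib add.commute)
  qed
  then have "\<forall>\<^sub>F H in sequentially. (B\<^sup>2 + (\<delta> H + (\<Sum>h<H. \<delta> h))) / real H < \<epsilon> / 16"
    using \<open>0 < \<epsilon>\<close> by (intro order_tendstoD) auto
  then have "\<forall>\<^sub>F H in sequentially. 0 < H \<and> (B\<^sup>2 + (\<delta> H + (\<Sum>h<H. \<delta> h))) / real H < \<epsilon> / 16"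
    using eventually_gt_at_top[of 0] by eventually_elim auto
  \<comment> \<open>\<open>H\<close> is fixed before \<open>N\<close>. In the end the pairs
    contribute at most \<open>4 * Q + \<epsilon> / 8\<close>, which is below 3/8 of \<epsilon>, and
    the shift error at most \<epsilon> / 2.\<close>
  then obtain H where H: "0 < H" "(B\<^sup>2 + (\<delta> H + (\<Sum>h<H. \<delta> h))) / real H < \<epsilon> / 16"
    by (auto simp: eventually_sequentially)
  define \<Gamma> where "\<Gamma> i j n = cmod (\<integral>x. u (n + i) x * cnj (u (n + j) x) \<partial>M)" for i j n
  have \<Gamma>_bound: "\<Gamma> i j n \<le> B\<^sup>2" for i j n
    unfolding \<Gamma>_def
  proof (rule order_trans[OF integral_norm_bound integral_le_const])
    show "integrable M (\<lambda>x. cmod (u (n + i) x * cnj (u (n + j) x)))"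
      by (intro integrable_norm integrable_bounded_measurable bounded_measurable_mult bounded_measurable_cnj bu)
    show "AE x in M. cmod (u (n + i) x * cnj (u (n + j) x)) \<le> B\<^sup>2"
      unfolding power2_eq_square by (auto simp: norm_mult intro!: mult_mono B B0)
  qed
  have \<Gamma>0: "0 \<le> \<Gamma> i j n" for i j n by (simp add: \<Gamma>_def)
  have \<Gamma>_sym: "\<Gamma> i j n = \<Gamma> j i n" for i j n
  proof -
    have "cnj (\<integral>x. u (n + j) x * cnj (u (n + i) x) \<partial>M) = (\<integral>x. cnj (u (n + j) x * cnj (u (n + i) x)) \<partial>M)"
      by (rule Bochner_Integration.integral_cnj[symmetric])
    also have "\<dots> = (\<integral>x. u (n + i) x * cnj (u (n + j) x) \<partial>M)"
      by (simp add: mult.commute del: Bochner_Integration.integral_cnj)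
    finally have "cmod (cnj (\<integral>x. u (n + j) x * cnj (u (n + i) x) \<partial>M)) = cmod (\<integral>x. u (n + i) x * cnj (u (n + j) x) \<partial>M)"
      by (rule arg_cong)
    then show ?thesis by (simp add: \<Gamma>_def)
  qed
  have ev1: "\<forall>\<^sub>F N in sequentially. wmean W (\<Gamma> i j) N \<le> \<delta>' (i - j) + \<epsilon> / 16" if "j \<le> i" for i j
  proof (cases "i = j")
    case True
    have "wmean W (\<Gamma> i j) N \<le> B\<^sup>2" for N
      using norm_wmean_bound[where a = "\<Gamma> i j" and B = "B\<^sup>2", OF pos] \<Gamma>_bound \<Gamma>0 by (simp add: abs_le_iff)
    then show ?thesis
      using \<open>0 < \<epsilon>\<close> True by (intro always_eventually allI) (simp add: \<delta>'_def add_increasing2)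
  next
    case False
    with that have h: "0 < i - j" by simp
    define \<gamma> where "\<gamma> n = cmod (\<integral>x. u (n + (i - j)) x * cnj (u n x) \<partial>M)" for n
    have \<gamma>: "\<Gamma> i j = (\<lambda>n. \<gamma> (n + j))" using that by (simp add: \<Gamma>_def \<gamma>_def fun_eq_iff)
    have \<gamma>': "\<gamma> n = \<Gamma> (i - j) 0 n" for n by (simp add: \<gamma>_def \<Gamma>_def)
    have "(\<lambda>N. real j * (2 * B\<^sup>2 * \<omega> N)) \<longlonglongrightarrow> 0" by (intro tendsto_mult_right_zero \<omega>)
    then have "\<forall>\<^sub>F N in sequentially. real j * (2 * B\<^sup>2 * \<omega> N) < \<epsilon> / 32"
      using \<open>0 < \<epsilon>\<close> by (intro order_tendstoD) auto
    moreover have "\<forall>\<^sub>F N in sequentially. wmean W \<gamma> N \<le> \<delta> (i - j) + \<epsilon> / 32"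
      unfolding \<gamma>_def using \<open>0 < \<epsilon>\<close> by (intro corr h) simp
    ultimately show ?thesis
      using eventually_gt_at_top[of 0]
    proof eventually_elim
      case (elim N)
      have "norm (wmean W (\<lambda>n. \<gamma> (n + j)) N - wmean W \<gamma> N) \<le> real j * (2 * B\<^sup>2 * \<omega> N)"
        unfolding \<omega>_def by (rule norm_wmean_shift[OF pos mono _ elim(3)]) (simp add: \<gamma>' \<Gamma>0 \<Gamma>_bound)
      then have "wmean W (\<lambda>n. \<gamma> (n + j)) N \<le> wmean W \<gamma> N + real j * (2 * B\<^sup>2 * \<omega> N)"
        by (simp add: abs_le_iff)
      with elim show ?case using h by (simp only: \<gamma> \<delta>'_def) simp
    qed
  qed
  have ev2: "\<forall>\<^sub>F N in sequentially. wmean W (\<Gamma> i j) N \<le> \<delta>' (if j \<le> i then i - j else j - i) + \<epsilon> / 16" for i j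
    using ev1[of j i] ev1[of i j] \<Gamma>_sym[of i j] by (cases "j \<le> i") (auto cong: wmean_cong)
  have ev3: "\<forall>\<^sub>F N in sequentially. \<forall>i\<in>{..<H}. \<forall>j\<in>{..<H}. wmean W (\<Gamma> i j) N \<le> \<delta>' (if j \<le> i then i - j else j - i) + \<epsilon> / 16"
    by (intro eventually_ball_finite ballI ev2) auto
  have "(\<lambda>N. 2 * (2 * B * real H * \<omega> N)\<^sup>2) \<longlonglongrightarrow> 2 * (2 * B * real H * 0)\<^sup>2"
    by (intro tendsto_intros \<omega>)
  then have ev4: "\<forall>\<^sub>F N in sequentially. 2 * (2 * B * real H * \<omega> N)\<^sup>2 < \<epsilon> / 2"
    by (rule order_tendstoD) (use \<open>0 < \<epsilon>\<close> in simp)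
  show "\<forall>\<^sub>F N in sequentially. \<forall>c. (\<forall>n. cmod (c n) \<le> 1) \<longrightarrow>
      (\<integral>x. (cmod (wmean W (\<lambda>n. c n * u n x) N))\<^sup>2 \<partial>M) \<le> \<epsilon>"
    using ev3 ev4 eventually_gt_at_top[of 0]
  proof (eventually_elim, intro allI impI)
    fix N and c :: "nat \<Rightarrow> complex"
    assume pairs: "\<forall>i\<in>{..<H}. \<forall>j\<in>{..<H}. wmean W (\<Gamma> i j) N \<le> \<delta>' (if j \<le> i then i - j else j - i) + \<epsilon> / 16"
      and \<omega>N: "2 * (2 * B * real H * \<omega> N)\<^sup>2 < \<epsilon> / 2" and N: "0 < N"
      and c: "\<forall>n. cmod (c n) \<le> 1"
    define v where "v n x = c n * u n x" for n x
    define R where "R = (2 * B * real H * \<omega> N)\<^sup>2"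
    define Q where "Q = (B\<^sup>2 + (\<delta> H + (\<Sum>h<H. \<delta> h))) / real H"
    have bv: "bounded_measurable M (v n)" for n
      unfolding v_def by (intro bounded_measurable_mult bu bounded_measurable_const)
    have v_bound: "cmod (v n x) \<le> B" for n x
      using mult_mono[OF c[rule_format, of n] B[of n x]] by (simp add: v_def norm_mult)
    \<comment> \<open>Since \<open>v\<close> contains the coefficients, they are shifted along with
      \<open>u\<close>, and their bound 1 removes them once the square is expanded.\<close>
    define U where "U n x = (\<Sum>i<H. v (n + i) x / of_nat H)" for n x
    have bU: "bounded_measurable M (U n)" for n
      unfolding U_def divide_inverse by (intro bounded_measurable_sum bounded_measurable_mult bv bounded_measurable_const)
    have shift: "cmod (wmean W (\<lambda>n. U n x) N - wmean W (\<lambda>n. v n x) N) \<le> 2 * B * real H * \<omega> N" for x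
    proof -
      have \<omega>0: "0 \<le> \<omega> N" using less_imp_le[OF pos] sum_weight_nonneg[of W, OF pos] by (simp add: \<omega>_def)
      have "wmean W (\<lambda>n. U n x) N - wmean W (\<lambda>n. v n x) N
          = (\<Sum>i<H. (1 / of_nat H) * (wmean W (\<lambda>n. v (n + i) x) N - wmean W (\<lambda>n. v n x) N))"
      proof -
        have "wmean W (\<lambda>n. U n x) N = (\<Sum>i<H. wmean W (\<lambda>n. (1 / of_nat H) * v (n + i) x) N)"
          unfolding U_def wmean_sum by simp
        also have "\<dots> = (\<Sum>i<H. (1 / of_nat H) * wmean W (\<lambda>n. v (n + i) x) N)"
          by (simp only: wmean_cmult)
        finally show ?thesis using H(1)
          by (simp add: right_diff_distrib sum_subtractf del: of_nat_0_less_iff)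
      qed
      also have "cmod \<dots> \<le> (\<Sum>i<H. (1 / real H) * (real H * (2 * B * \<omega> N)))"
      proof (intro order_trans[OF norm_sum sum_mono])
        fix i assume "i \<in> {..<H}"
        have "cmod (wmean W (\<lambda>n. v (n + i) x) N - wmean W (\<lambda>n. v n x) N) \<le> real i * (2 * B * \<omega> N)"
          unfolding \<omega>_def by (rule norm_wmean_shift[OF pos mono v_bound N])
        also have "\<dots> \<le> real H * (2 * B * \<omega> N)"
          using \<open>i \<in> _\<close> B0 \<omega>0 by (intro mult_right_mono) auto
        finally show "cmod ((1 / of_nat H) * (wmean W (\<lambda>n. v (n + i) x) N - wmean W (\<lambda>n. v n x) N))
            \<le> (1 / real H) * (real H * (2 * B * \<omega> N))"
          unfolding norm_mult by (intro mult_mono) (simp_all add: norm_divide)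
      qed
      also have "\<dots> = 2 * B * real H * \<omega> N" using H(1) by simp
      finally show ?thesis .
    qed
    have intU: "integrable M (\<lambda>x. wmean W (\<lambda>n. (cmod (U n x))\<^sup>2) N)"
      by (intro integral_wmean integrable_cmod_power2 bU)
    have "(cmod (wmean W (\<lambda>n. v n x) N))\<^sup>2 \<le> 2 * wmean W (\<lambda>n. (cmod (U n x))\<^sup>2) N + 2 * (2 * B * real H * \<omega> N)\<^sup>2" for x
    proof -
      define p where "p = cmod (wmean W (\<lambda>n. U n x) N)"
      define q where "q = 2 * B * real H * \<omega> N"
      have "cmod (wmean W (\<lambda>n. v n x) N) \<le> p + q"
        using norm_triangle_ineq2[of "wmean W (\<lambda>n. v n x) N" "wmean W (\<lambda>n. U n x) N"] shift[of x]
        by (simp add: p_def q_def norm_minus_commute)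
      then have "(cmod (wmean W (\<lambda>n. v n x) N))\<^sup>2 \<le> (p + q)\<^sup>2" by (intro power_mono) auto
      also have "\<dots> \<le> 2 * p\<^sup>2 + 2 * q\<^sup>2" using sum_squares_bound[of p q] by (simp add: power2_sum)
      also have "p\<^sup>2 \<le> (wmean W (\<lambda>n. cmod (U n x)) N)\<^sup>2"
        unfolding p_def by (intro power_mono norm_wmean_le pos) auto
      also have "\<dots> \<le> wmean W (\<lambda>n. (cmod (U n x))\<^sup>2) N" by (rule wmean_jensen[OF pos])
      finally show ?thesis by (simp add: q_def)
    qed
    then have "(\<integral>x. (cmod (wmean W (\<lambda>n. v n x) N))\<^sup>2 \<partial>M)
        \<le> (\<integral>x. 2 * wmean W (\<lambda>n. (cmod (U n x))\<^sup>2) N + 2 * (2 * B * real H * \<omega> N)\<^sup>2 \<partial>M)"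
      by (intro integral_mono) (auto intro!: integrable_cmod_power2 bounded_measurable_wmean bv intU)
    also have "\<dots> = 2 * (\<integral>x. wmean W (\<lambda>n. (cmod (U n x))\<^sup>2) N \<partial>M) + 2 * (2 * B * real H * \<omega> N)\<^sup>2"
      using intU by (simp add: prob_space)
    also have "(\<integral>x. wmean W (\<lambda>n. (cmod (U n x))\<^sup>2) N \<partial>M) = wmean W (\<lambda>n. \<integral>x. (cmod (U n x))\<^sup>2 \<partial>M) N"
      by (intro integral_wmean integrable_cmod_power2 bU)
    also have "\<dots> \<le> wmean W (\<lambda>n. \<Sum>i<H. \<Sum>j<H. (1 / (real H)\<^sup>2) * \<Gamma> i j n) N"
    proof (intro wmean_mono pos)
      fix n
      have "(\<integral>x. (cmod (U n x))\<^sup>2 \<partial>M) \<le> (\<Sum>i<H. \<Sum>j<H. cmod (\<integral>x. (v (n + i) x / of_nat H) * cnj (v (n + j) x / of_nat H) \<partial>M))"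
        unfolding U_def by (intro integral_power2_sum) (auto simp: divide_inverse intro!: bounded_measurable_mult bv)
      also have "\<dots> \<le> (\<Sum>i<H. \<Sum>j<H. (1 / (real H)\<^sup>2) * \<Gamma> i j n)"
      proof (intro sum_mono)
        fix i j
        have "(\<lambda>x. (v (n + i) x / of_nat H) * cnj (v (n + j) x / of_nat H))
            = (\<lambda>x. (c (n + i) * cnj (c (n + j)) / (of_nat H)\<^sup>2) * (u (n + i) x * cnj (u (n + j) x)))"
          by (auto simp: v_def power2_eq_square)
        then have "cmod (\<integral>x. (v (n + i) x / of_nat H) * cnj (v (n + j) x / of_nat H) \<partial>M)
            = cmod (c (n + i)) * cmod (c (n + j)) / (real H)\<^sup>2 * \<Gamma> i j n"
          by (simp only: integral_mult_right_zero norm_mult \<Gamma>_def norm_divide norm_power norm_of_nat complex_mod_cnj)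
        also have "\<dots> \<le> 1 * 1 / (real H)\<^sup>2 * \<Gamma> i j n"
          using c by (intro mult_right_mono divide_right_mono mult_mono \<Gamma>0) auto
        finally show "cmod (\<integral>x. (v (n + i) x / of_nat H) * cnj (v (n + j) x / of_nat H) \<partial>M) \<le> (1 / (real H)\<^sup>2) * \<Gamma> i j n"
          by simp
      qed
      finally show "(\<integral>x. (cmod (U n x))\<^sup>2 \<partial>M) \<le> (\<Sum>i<H. \<Sum>j<H. (1 / (real H)\<^sup>2) * \<Gamma> i j n)" .
    qed
    also have "\<dots> = (\<Sum>i<H. \<Sum>j<H. (1 / (real H)\<^sup>2) * wmean W (\<Gamma> i j) N)"
      by (simp only: wmean_sum wmean_cmult)
    also have "\<dots> \<le> (\<Sum>i<H. \<Sum>j<H. (1 / (real H)\<^sup>2) * (\<delta>' (if j \<le> i then i - j else j - i) + \<epsilon> / 16))"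
      using pairs by (intro sum_mono mult_left_mono) auto
    also have "\<dots> = (1 / (real H)\<^sup>2) * (\<Sum>i<H. \<Sum>j<H. \<delta>' (if j \<le> i then i - j else j - i)) + \<epsilon> / 16"
      using H(1) by (simp add: distrib_left sum.distrib sum_distrib_left power2_eq_square)
    also have "\<dots> \<le> (1 / (real H)\<^sup>2) * (real H * (2 * (\<Sum>h<Suc H. \<delta>' h))) + \<epsilon> / 16"
      by (intro add_mono mult_left_mono sum_pairs_difference_le \<delta>'0) auto
    also have "\<dots> = 2 * ((\<Sum>h<Suc H. \<delta>' h) / real H) + \<epsilon> / 16"
      using H(1) by (simp add: power2_eq_square)
    also have "(\<Sum>h<Suc H. \<delta>' h) / real H \<le> (B\<^sup>2 + (\<delta> H + (\<Sum>h<H. \<delta> h))) / real H"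
    proof (intro divide_right_mono)
      have "(\<Sum>h<Suc H. \<delta>' h) = B\<^sup>2 + (\<Sum>h<H. \<delta> (Suc h))"
        by (simp add: sum.lessThan_Suc_shift \<delta>'_def del: sum.lessThan_Suc)
      also have "(\<Sum>h<H. \<delta> (Suc h)) \<le> (\<Sum>h<Suc H. \<delta> h)"
        by (simp add: sum.lessThan_Suc_shift \<delta> del: sum.lessThan_Suc)
      finally show "(\<Sum>h<Suc H. \<delta>' h) \<le> B\<^sup>2 + (\<delta> H + (\<Sum>h<H. \<delta> h))" by simp
    qed simp
    finally have "(\<integral>x. (cmod (wmean W (\<lambda>n. v n x) N))\<^sup>2 \<partial>M)
        \<le> 2 * (2 * Q + \<epsilon> / 16) + 2 * (2 * B * real H * \<omega> N)\<^sup>2"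
      unfolding Q_def by simp
    then have "(\<integral>x. (cmod (wmean W (\<lambda>n. v n x) N))\<^sup>2 \<partial>M) \<le> \<epsilon>"
    proof (rule order_trans)
      show "2 * (2 * Q + \<epsilon> / 16) + 2 * (2 * B * real H * \<omega> N)\<^sup>2 \<le> \<epsilon>"
        using H(2)[folded Q_def] \<omega>N[folded R_def] \<open>0 < \<epsilon>\<close> unfolding R_def[symmetric] by argo
    qed
    then show "(\<integral>x. (cmod (wmean W (\<lambda>n. c n * u n x) N))\<^sup>2 \<partial>M) \<le> \<epsilon>"
      by (simp only: v_def)
  qed
qed

text \<open>With the conjugate sign of the correlation as coefficient \<open>c n\<close>, the mean
  of the moduli becomes the integral of one weighted mean against \<open>g\<close>.\<close>

lemma (in prob_space) mean_null_imp_correlations: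
  assumes pos: "\<And>n. 0 < W n" and null: "mean_null W u"
    and u: "\<And>n. bounded_measurable M (u n)" and g: "bounded_measurable M g"
  shows "wmean W (\<lambda>n. cmod (\<integral>x. u n x * g x \<partial>M)) \<longlonglongrightarrow> 0"
proof (rule tendstoI)
  fix \<epsilon> :: real assume "0 < \<epsilon>"
  obtain G where G: "0 < G" "\<And>x. cmod (g x) \<le> G" using bounded_measurable_bound[OF g] by blast
  define \<eta> where "\<eta> = \<epsilon> / (2 * G)"
  have \<eta>: "0 < \<eta>" using \<open>0 < \<epsilon>\<close> G(1) by (simp add: \<eta>_def)
  define c where "c n = cnj (sgn (\<integral>x. u n x * g x \<partial>M))" for n
  have c: "cmod (c n) \<le> 1" for n by (simp add: c_def norm_sgn)
  have cu: "bounded_measurable M (\<lambda>x. wmean W (\<lambda>n. c n * u n x) N)" for N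
    by (intro bounded_measurable_wmean bounded_measurable_mult bounded_measurable_const u)
  have "\<forall>\<^sub>F N in sequentially. (\<integral>x. (cmod (wmean W (\<lambda>n. c n * u n x) N))\<^sup>2 \<partial>M) \<le> \<eta>\<^sup>2"
    using null[unfolded mean_null_def, rule_format, of "\<eta>\<^sup>2"] \<eta> c by (auto elim!: eventually_mono)
  then show "\<forall>\<^sub>F N in sequentially. dist (wmean W (\<lambda>n. cmod (\<integral>x. u n x * g x \<partial>M)) N) 0 < \<epsilon>"
  proof eventually_elim
    case (elim N)
    have int: "integrable M (\<lambda>x. c n * u n x * g x)" for n
      by (intro integrable_bounded_measurable bounded_measurable_mult bounded_measurable_const u g)
    have "c n * (\<integral>x. u n x * g x \<partial>M) = complex_of_real (cmod (\<integral>x. u n x * g x \<partial>M))" for n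
      by (simp add: c_def sgn_eq complex_norm_square[symmetric] mult.commute divide_simps power2_eq_square)
    then have "complex_of_real (wmean W (\<lambda>n. cmod (\<integral>x. u n x * g x \<partial>M)) N) = wmean W (\<lambda>n. \<integral>x. c n * u n x * g x \<partial>M) N"
      by (simp add: wmean_def scaleR_conv_of_real mult.assoc)
    also have "\<dots> = (\<integral>x. wmean W (\<lambda>n. c n * u n x * g x) N \<partial>M)"
      by (rule integral_wmean(2)[OF int, symmetric])
    also have "\<dots> = (\<integral>x. wmean W (\<lambda>n. c n * u n x) N * g x \<partial>M)"
    proof -
      have "wmean W (\<lambda>n. c n * u n x * g x) N = wmean W (\<lambda>n. c n * u n x) N * g x" for x
        using wmean_cmult[of W "g x" "\<lambda>n. c n * u n x" N] by (simp add: mult_ac)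
      then show ?thesis by simp
    qed
    finally have "cmod (complex_of_real (wmean W (\<lambda>n. cmod (\<integral>x. u n x * g x \<partial>M)) N))
        = cmod (\<integral>x. wmean W (\<lambda>n. c n * u n x) N * g x \<partial>M)"
      by (rule arg_cong)
    then have "\<bar>wmean W (\<lambda>n. cmod (\<integral>x. u n x * g x \<partial>M)) N\<bar> = cmod (\<integral>x. wmean W (\<lambda>n. c n * u n x) N * g x \<partial>M)"
      by (simp only: norm_of_real)
    also have "\<dots> \<le> (\<integral>x. cmod (wmean W (\<lambda>n. c n * u n x) N * g x) \<partial>M)"
      by (rule integral_norm_bound)
    also have "\<dots> \<le> (\<integral>x. G * (\<eta> / 2) + (G / (2 * \<eta>)) * (cmod (wmean W (\<lambda>n. c n * u n x) N))\<^sup>2 \<partial>M)"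
    proof (intro integral_mono)
      show "integrable M (\<lambda>x. cmod (wmean W (\<lambda>n. c n * u n x) N * g x))"
        by (intro integrable_norm integrable_bounded_measurable bounded_measurable_mult cu g)
      show "integrable M (\<lambda>x. G * (\<eta> / 2) + (G / (2 * \<eta>)) * (cmod (wmean W (\<lambda>n. c n * u n x) N))\<^sup>2)"
        by (intro Bochner_Integration.integrable_add integrable_const integrable_mult_right integrable_cmod_power2 cu)
      fix x
      define p where "p = cmod (wmean W (\<lambda>n. c n * u n x) N)"
      \<comment> \<open>Young's inequality takes the place of Cauchy-Schwarz; the choice of \<eta>
        makes the resulting bound \<open>G * \<eta>\<close> equal to \<epsilon> / 2.\<close>
      have "0 \<le> (p - \<eta>)\<^sup>2" by simp
      then have "p \<le> \<eta> / 2 + p\<^sup>2 / (2 * \<eta>)" using \<eta> by (simp add: field_simps power2_eq_square)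
      then have "p * cmod (g x) \<le> (\<eta> / 2 + p\<^sup>2 / (2 * \<eta>)) * G"
        using G(2)[of x] by (intro mult_mono) (auto simp: p_def less_imp_le[OF \<eta>])
      then show "cmod (wmean W (\<lambda>n. c n * u n x) N * g x) \<le> G * (\<eta> / 2) + (G / (2 * \<eta>)) * (cmod (wmean W (\<lambda>n. c n * u n x) N))\<^sup>2"
        by (simp add: norm_mult p_def algebra_simps)
    qed
    also have "\<dots> = G * (\<eta> / 2) + (G / (2 * \<eta>)) * (\<integral>x. (cmod (wmean W (\<lambda>n. c n * u n x) N))\<^sup>2 \<partial>M)"
      by (simp add: integrable_cmod_power2[OF cu] prob_space)
    also have "\<dots> \<le> G * (\<eta> / 2) + (G / (2 * \<eta>)) * \<eta>\<^sup>2"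
      using elim G \<eta> by (intro add_left_mono mult_left_mono) auto
    also have "\<dots> = \<epsilon> / 2" using G(1) \<eta> by (simp add: \<eta>_def power2_eq_square)
    finally show ?case using \<open>0 < \<epsilon>\<close> by simp
  qed
qed

lemma (in prob_space) mean_null_finite_choice:
  assumes "finite E" and null: "\<And>e. e \<in> E \<Longrightarrow> mean_null W (y e)"
    and y: "\<And>e n. e \<in> E \<Longrightarrow> bounded_measurable M (y e n)"
    and s: "\<And>n. s n \<in> E" and u: "\<And>n x. u n x = y (s n) n x"
  shows "mean_null W u"
  unfolding mean_null_def
proof (intro allI impI)
  fix \<epsilon> :: real assume "0 < \<epsilon>"
  define k where "k = real (card E)"
  have k: "0 < k" using assms(1) s[of 0] by (auto simp: k_def card_gt_0_iff)
  \<comment> \<open>The divisor \<open>k\<^sup>2\<close> pays for Cauchy-Schwarz over the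
    \<open>k\<close> classes and for adding \<open>k\<close> integrals.\<close>
  have "\<forall>\<^sub>F N in sequentially. \<forall>e\<in>E. \<forall>c. (\<forall>n. cmod (c n) \<le> 1) \<longrightarrow>
      (\<integral>x. (cmod (wmean W (\<lambda>n. c n * y e n x) N))\<^sup>2 \<partial>M) \<le> \<epsilon> / k\<^sup>2"
    using null k \<open>0 < \<epsilon>\<close> unfolding mean_null_def by (intro eventually_ball_finite assms(1)) auto
  then show "\<forall>\<^sub>F N in sequentially. \<forall>c. (\<forall>n. cmod (c n) \<le> 1) \<longrightarrow>
      (\<integral>x. (cmod (wmean W (\<lambda>n. c n * u n x) N))\<^sup>2 \<partial>M) \<le> \<epsilon>"
  proof (eventually_elim, intro allI impI)
    fix N and c :: "nat \<Rightarrow> complex"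
    assume *: "\<forall>e\<in>E. \<forall>c. (\<forall>n. cmod (c n) \<le> 1) \<longrightarrow>
      (\<integral>x. (cmod (wmean W (\<lambda>n. c n * y e n x) N))\<^sup>2 \<partial>M) \<le> \<epsilon> / k\<^sup>2"
    and c: "\<forall>n. cmod (c n) \<le> 1"
    define c' where "c' e n = (if s n = e then c n else 0)" for e n
    have "c n * u n x = (\<Sum>e\<in>E. c' e n * y e n x)" for n x
    proof -
      have "(\<Sum>e\<in>E. c' e n * y e n x) = (\<Sum>e\<in>{s n}. c' e n * y e n x)"
        using assms(1) s by (intro sum.mono_neutral_right) (auto simp: c'_def)
      then show ?thesis by (simp add: c'_def u)
    qed
    then have split: "wmean W (\<lambda>n. c n * u n x) N = (\<Sum>e\<in>E. wmean W (\<lambda>n. c' e n * y e n x) N)" for x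
      by (simp add: wmean_sum)
    have int: "integrable M (\<lambda>x. (cmod (wmean W (\<lambda>n. c' e n * y e n x) N))\<^sup>2)" if "e \<in> E" for e
      using that by (intro integrable_cmod_power2 bounded_measurable_wmean bounded_measurable_mult bounded_measurable_const y)
    have "(\<integral>x. (cmod (wmean W (\<lambda>n. c n * u n x) N))\<^sup>2 \<partial>M)
        \<le> (\<integral>x. k * (\<Sum>e\<in>E. (cmod (wmean W (\<lambda>n. c' e n * y e n x) N))\<^sup>2) \<partial>M)"
    proof (intro integral_mono)
      show "integrable M (\<lambda>x. (cmod (wmean W (\<lambda>n. c n * u n x) N))\<^sup>2)"
        unfolding u using s by (intro integrable_cmod_power2 bounded_measurable_wmean bounded_measurable_mult bounded_measurable_const y)
      show "integrable M (\<lambda>x. k * (\<Sum>e\<in>E. (cmod (wmean W (\<lambda>n. c' e n * y e n x) N))\<^sup>2))"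
        using int by (intro integrable_mult_right Bochner_Integration.integrable_sum) auto
      fix x
      have "(cmod (wmean W (\<lambda>n. c n * u n x) N))\<^sup>2 \<le> (\<Sum>e\<in>E. cmod (wmean W (\<lambda>n. c' e n * y e n x) N))\<^sup>2"
        unfolding split by (intro power_mono norm_sum) auto
      also have "\<dots> \<le> (\<Sum>e\<in>E. (cmod (wmean W (\<lambda>n. c' e n * y e n x) N))\<^sup>2) * k"
        using Cauchy_Schwarz_ineq_sum[of "\<lambda>e. cmod (wmean W (\<lambda>n. c' e n * y e n x) N)" "\<lambda>_. 1" E] by (simp add: k_def)
      finally show "(cmod (wmean W (\<lambda>n. c n * u n x) N))\<^sup>2 \<le> k * (\<Sum>e\<in>E. (cmod (wmean W (\<lambda>n. c' e n * y e n x) N))\<^sup>2)"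
        by (simp add: mult.commute)
    qed
    also have "\<dots> = k * (\<Sum>e\<in>E. (\<integral>x. (cmod (wmean W (\<lambda>n. c' e n * y e n x) N))\<^sup>2 \<partial>M))"
      using int by (simp add: Bochner_Integration.integral_sum)
    also have "\<dots> \<le> k * (\<Sum>e\<in>E. \<epsilon> / k\<^sup>2)"
      using * c k by (intro mult_left_mono sum_mono) (auto simp: c'_def)
    also have "\<dots> = \<epsilon>" using k by (simp add: k_def[symmetric] power2_eq_square)
    finally show "(\<integral>x. (cmod (wmean W (\<lambda>n. c n * u n x) N))\<^sup>2 \<partial>M) \<le> \<epsilon>" .
  qed
qed

lemma (in prob_space) mean_null_mult:
  assumes null: "mean_null W u" and u: "\<And>n. bounded_measurable M (u n)" and g: "bounded_measurable M g"
  shows "mean_null W (\<lambda>n x. g x * u n x)"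
  unfolding mean_null_def
proof (intro allI impI)
  fix \<epsilon> :: real assume "0 < \<epsilon>"
  obtain G where G: "0 < G" "\<And>x. cmod (g x) \<le> G" using bounded_measurable_bound[OF g] by blast
  have "\<forall>\<^sub>F N in sequentially. \<forall>c. (\<forall>n. cmod (c n) \<le> 1) \<longrightarrow>
      (\<integral>x. (cmod (wmean W (\<lambda>n. c n * u n x) N))\<^sup>2 \<partial>M) \<le> \<epsilon> / G\<^sup>2"
    using null G \<open>0 < \<epsilon>\<close> unfolding mean_null_def by auto
  then show "\<forall>\<^sub>F N in sequentially. \<forall>c. (\<forall>n. cmod (c n) \<le> 1) \<longrightarrow>
      (\<integral>x. (cmod (wmean W (\<lambda>n. c n * (g x * u n x)) N))\<^sup>2 \<partial>M) \<le> \<epsilon>"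
  proof (eventually_elim, intro allI impI)
    fix N and c :: "nat \<Rightarrow> complex"
    assume *: "\<forall>c. (\<forall>n. cmod (c n) \<le> 1) \<longrightarrow>
      (\<integral>x. (cmod (wmean W (\<lambda>n. c n * u n x) N))\<^sup>2 \<partial>M) \<le> \<epsilon> / G\<^sup>2"
    and c: "\<forall>n. cmod (c n) \<le> 1"
    have bu: "bounded_measurable M (\<lambda>x. wmean W (\<lambda>n. c n * u n x) N)"
      by (intro bounded_measurable_wmean bounded_measurable_mult bounded_measurable_const u)
    have eq: "wmean W (\<lambda>n. c n * (g x * u n x)) N = g x * wmean W (\<lambda>n. c n * u n x) N" for x
      using wmean_cmult[of W "g x" "\<lambda>n. c n * u n x" N] by (simp add: mult_ac)
    have "(\<integral>x. (cmod (wmean W (\<lambda>n. c n * (g x * u n x)) N))\<^sup>2 \<partial>M)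
        \<le> (\<integral>x. G\<^sup>2 * (cmod (wmean W (\<lambda>n. c n * u n x) N))\<^sup>2 \<partial>M)"
      unfolding eq
    proof (intro integral_mono)
      show "integrable M (\<lambda>x. (cmod (g x * wmean W (\<lambda>n. c n * u n x) N))\<^sup>2)"
        by (intro integrable_cmod_power2 bounded_measurable_mult g bu)
      show "integrable M (\<lambda>x. G\<^sup>2 * (cmod (wmean W (\<lambda>n. c n * u n x) N))\<^sup>2)"
        by (intro integrable_mult_right integrable_cmod_power2 bu)
      show "(cmod (g x * wmean W (\<lambda>n. c n * u n x) N))\<^sup>2 \<le> G\<^sup>2 * (cmod (wmean W (\<lambda>n. c n * u n x) N))\<^sup>2" for x
        unfolding norm_mult power_mult_distrib by (intro mult_right_mono power_mono G) auto
    qed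
    also have "\<dots> \<le> G\<^sup>2 * (\<epsilon> / G\<^sup>2)"
      unfolding integral_mult_right_zero using * c by (intro mult_left_mono) auto
    also have "\<dots> = \<epsilon>" using G by simp
    finally show "(\<integral>x. (cmod (wmean W (\<lambda>n. c n * (g x * u n x)) N))\<^sup>2 \<partial>M) \<le> \<epsilon>" .
  qed
qed

text \<open>The majorant may change with \<open>n\<close>, so all of them are added up; the terms
  before \<open>n0\<close> are negligible because the total weight diverges.\<close>

lemma wmean_tendsto_0_finite_choice:
  fixes a :: "'e \<Rightarrow> nat \<Rightarrow> real"
  assumes pos: "\<And>n. 0 < W n" and "finite E"
    and null: "\<And>e. e \<in> E \<Longrightarrow> wmean W (a e) \<longlonglongrightarrow> 0"
    and a: "\<And>e n. e \<in> E \<Longrightarrow> 0 \<le> a e n"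
    and b: "\<And>n. n \<ge> n0 \<Longrightarrow> 0 \<le> b n \<and> (\<exists>e\<in>E. b n \<le> a e n)"
    and S: "filterlim (\<lambda>N. \<Sum>n<N. W n) at_top sequentially"
  shows "wmean W b \<longlonglongrightarrow> 0"
proof -
  define b' where "b' n = (if n < n0 then b n else 0)" for n
  have b'_lim: "wmean W (\<lambda>n. \<bar>b' n\<bar>) \<longlonglongrightarrow> 0"
  proof -
    have "(\<lambda>N. (\<Sum>n<n0. W n * \<bar>b' n\<bar>) / (\<Sum>n<N. W n)) \<longlonglongrightarrow> 0"
      by (rule real_tendsto_divide_at_top[OF tendsto_const S])
    moreover have "\<forall>\<^sub>F N in sequentially. (\<Sum>n<n0. W n * \<bar>b' n\<bar>) / (\<Sum>n<N. W n) = wmean W (\<lambda>n. \<bar>b' n\<bar>) N"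
      using eventually_ge_at_top[of n0]
    proof eventually_elim
      case (elim N)
      have "(\<Sum>n<n0. W n * \<bar>b' n\<bar>) = (\<Sum>n<N. W n * \<bar>b' n\<bar>)"
        using elim by (intro sum.mono_neutral_left) (auto simp: b'_def)
      then show ?case by (simp add: wmean_def divide_inverse_commute)
    qed
    ultimately show ?thesis by (rule Lim_transform_eventually)
  qed
  have sum_lim: "(\<lambda>N. (\<Sum>e\<in>E. wmean W (a e) N) + wmean W (\<lambda>n. \<bar>b' n\<bar>) N) \<longlonglongrightarrow> (\<Sum>e\<in>E. 0) + 0"
    by (intro tendsto_add tendsto_sum null b'_lim)
  have "\<bar>b n\<bar> \<le> (\<Sum>e\<in>E. a e n) + \<bar>b' n\<bar>" for n
  proof (cases "n < n0")
    case True
    then show ?thesis by (simp add: b'_def sum_nonneg a)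
  next
    case False
    then obtain e where e: "0 \<le> b n" "e \<in> E" "b n \<le> a e n" using b[of n] by auto
    have "a e n \<le> (\<Sum>e\<in>E. a e n)" using e assms(2) a by (intro member_le_sum) auto
    with e show ?thesis by (simp add: add_increasing2)
  qed
  then have "wmean W (\<lambda>n. norm (b n)) N \<le> wmean W (\<lambda>n. (\<Sum>e\<in>E. a e n) + \<bar>b' n\<bar>) N" for N
    by (intro wmean_mono pos) simp
  then have "norm (wmean W b N) \<le> wmean W (\<lambda>n. (\<Sum>e\<in>E. a e n) + \<bar>b' n\<bar>) N" for N
    by (rule order_trans[OF norm_wmean_le[OF pos]])
  then have "norm (wmean W b N) \<le> (\<Sum>e\<in>E. wmean W (a e) N) + wmean W (\<lambda>n. \<bar>b' n\<bar>) N" for N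
    by (simp only: wmean_add wmean_sum)
  note bound = this
  show ?thesis
  proof (rule Lim_null_comparison)
    show "\<forall>\<^sub>F N in sequentially. norm (wmean W b N) \<le> (\<Sum>e\<in>E. wmean W (a e) N) + wmean W (\<lambda>n. \<bar>b' n\<bar>) N"
      by (intro always_eventually allI bound)
    show "(\<lambda>N. (\<Sum>e\<in>E. wmean W (a e) N) + wmean W (\<lambda>n. \<bar>b' n\<bar>) N) \<longlonglongrightarrow> 0"
      using sum_lim by simp
  qed
qed

lemma sum_weight_at_top:
  assumes "admissible_weight W"
  shows "filterlim (\<lambda>N. \<Sum>n<N. W n) at_top sequentially"
proof (rule filterlim_at_top_mono)
  show "filterlim (\<lambda>N. real N * W 0) at_top sequentially"
    using admissible_weightD(1)[OF assms, of 0]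
    by (intro filterlim_at_top_mult_tendsto_pos[OF tendsto_const] filterlim_real_sequentially)
  show "\<forall>\<^sub>F N in sequentially. real N * W 0 \<le> (\<Sum>n<N. W n)"
  proof (intro always_eventually allI)
    fix N
    have "(\<Sum>n<N. W 0) \<le> (\<Sum>n<N. W n)"
      using admissible_weightD(2)[OF assms] by (intro sum_mono) (auto simp: mono_def)
    then show "real N * W 0 \<le> (\<Sum>n<N. W n)" by simp
  qed
qed

section \<open>Cesaro means along integer parts\<close>

lemma card_floor_fibre_le:
  fixes b :: real
  assumes "b \<noteq> 0"
  shows "card {h. h < H \<and> \<lfloor>b * real h\<rfloor> = k} \<le> Suc (nat \<lfloor>1 / \<bar>b\<bar>\<rfloor>)"
proof -
  define S where "S = {h. h < H \<and> \<lfloor>b * real h\<rfloor> = k}"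
  have "finite S" by (auto simp: S_def)
  show ?thesis
  proof (cases "S = {}")
    case True
    then show ?thesis unfolding S_def[symmetric] by simp
  next
    case False
    \<comment> \<open>Equal integer parts force
      \<open>\<bar>b\<bar> * (h - Min S) < 1\<close>.\<close>
    have "S \<subseteq> {Min S..Min S + nat \<lfloor>1 / \<bar>b\<bar>\<rfloor>}"
    proof
      fix h assume h: "h \<in> S"
      have m: "Min S \<in> S" "Min S \<le> h" using False \<open>finite S\<close> h by auto
      have "\<bar>b * real h - b * real (Min S)\<bar> < 1"
        using h m(1) unfolding S_def by (simp add: abs_less_iff) linarith
      then have "\<bar>b\<bar> * (real h - real (Min S)) < 1"
        using m(2) by (simp add: abs_mult flip: right_diff_distrib)
      then have "real (h - Min S) \<le> 1 / \<bar>b\<bar>"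
        using assms m(2) by (simp add: field_simps of_nat_diff)
      then have "h - Min S \<le> nat \<lfloor>1 / \<bar>b\<bar>\<rfloor>" by (simp add: le_nat_floor)
      then show "h \<in> {Min S..Min S + nat \<lfloor>1 / \<bar>b\<bar>\<rfloor>}" using m(2) by auto
    qed
    then have "card S \<le> card {Min S..Min S + nat \<lfloor>1 / \<bar>b\<bar>\<rfloor>}" by (rule card_mono[rotated]) simp
    then show ?thesis unfolding S_def[symmetric] by simp
  qed
qed

text \<open>For h < H the integer parts stay within a distance of order \<open>H\<close> from 0 and
  each value is taken boundedly often; as \<rho> is nonnegative, the two-sided Cesaro mean
  dominates.\<close>

lemma cesaro_floor:
  fixes \<rho> :: "int \<Rightarrow> real"
  assumes \<rho>: "\<And>k. 0 \<le> \<rho> k" and b: "b \<noteq> 0"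
    and plus: "(\<lambda>N. (\<Sum>n<N. \<rho> (int n)) / real N) \<longlonglongrightarrow> 0"
    and minus: "(\<lambda>N. (\<Sum>n<N. \<rho> (- int n)) / real N) \<longlonglongrightarrow> 0"
  shows "(\<lambda>H. (\<Sum>h<H. \<rho> \<lfloor>b * real h\<rfloor>) / real H) \<longlonglongrightarrow> 0"
proof -
  define C where "C = real (Suc (nat \<lfloor>1 / \<bar>b\<bar>\<rfloor>))"
  \<comment> \<open>Rounding down can increase the modulus of \<open>b * real h\<close> by 1; the
    two successors make room for this with a strict inequality.\<close>
  define L where "L H = Suc (Suc (nat \<lceil>\<bar>b\<bar> * real H\<rceil>))" for H
  have L_lower: "\<bar>b\<bar> * real H + 1 < real (L H)" for H unfolding L_def by linarith
  have L_upper: "real (L H) \<le> \<bar>b\<bar> * real H + 3" for H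
  proof -
    have "0 \<le> \<bar>b\<bar> * real H" by simp
    then show ?thesis unfolding L_def by linarith
  qed
  have bound: "(\<Sum>h<H. \<rho> \<lfloor>b * real h\<rfloor>) \<le> C * ((\<Sum>n<L H. \<rho> (int n)) + (\<Sum>n<L H. \<rho> (- int n)))" for H
  proof -
    have "(\<Sum>h<H. \<rho> \<lfloor>b * real h\<rfloor>) = (\<Sum>k\<in>(\<lambda>h. \<lfloor>b * real h\<rfloor>) ` {..<H}. of_nat (card {h \<in> {..<H}. \<lfloor>b * real h\<rfloor> = k}) * \<rho> k)"
      by (rule sum_fun_comp) auto
    also have "\<dots> \<le> (\<Sum>k\<in>(\<lambda>h. \<lfloor>b * real h\<rfloor>) ` {..<H}. C * \<rho> k)"
      using card_floor_fibre_le[OF b, of H] unfolding C_def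
      by (intro sum_mono mult_right_mono \<rho>) (simp only: lessThan_iff of_nat_le_iff)
    also have "\<dots> \<le> (\<Sum>k\<in>int ` {..<L H} \<union> (\<lambda>n. - int n) ` {..<L H}. C * \<rho> k)"
    proof (intro sum_mono2 subsetI)
      fix k assume "k \<in> (\<lambda>h. \<lfloor>b * real h\<rfloor>) ` {..<H}"
      then obtain h where h: "h < H" "k = \<lfloor>b * real h\<rfloor>" by auto
      have "\<bar>b * real h\<bar> \<le> \<bar>b\<bar> * real H" using h by (simp add: abs_mult mult_left_mono)
      then have "\<bar>real_of_int k\<bar> \<le> \<bar>b\<bar> * real H + 1" using h(2) by linarith
      then have "\<bar>real_of_int k\<bar> < real (L H)" using L_lower[of H] by linarith
      then have "nat \<bar>k\<bar> < L H" by linarith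
      then show "k \<in> int ` {..<L H} \<union> (\<lambda>n. - int n) ` {..<L H}"
        by (cases "0 \<le> k") (auto simp: image_iff intro!: bexI[of _ "nat \<bar>k\<bar>"])
    qed (auto simp: C_def \<rho>)
    also have "\<dots> \<le> (\<Sum>k\<in>int ` {..<L H}. C * \<rho> k) + (\<Sum>k\<in>(\<lambda>n. - int n) ` {..<L H}. C * \<rho> k)"
    proof -
      have "0 \<le> (\<Sum>k\<in>int ` {..<L H} \<inter> (\<lambda>n. - int n) ` {..<L H}. C * \<rho> k)"
        by (intro sum_nonneg mult_nonneg_nonneg \<rho>) (simp add: C_def)
      then show ?thesis
        using sum.union_inter[of "int ` {..<L H}" "(\<lambda>n. - int n) ` {..<L H}" "\<lambda>k. C * \<rho> k"] by simp
    qed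
    also have "\<dots> = C * ((\<Sum>n<L H. \<rho> (int n)) + (\<Sum>n<L H. \<rho> (- int n)))"
      by (simp add: sum.reindex inj_on_def sum_distrib_left distrib_left)
    finally show ?thesis .
  qed
  have L_top: "filterlim L at_top sequentially"
    unfolding filterlim_at_top
  proof
    fix Z
    show "\<forall>\<^sub>F H in sequentially. Z \<le> L H"
    proof (rule eventually_sequentiallyI)
      fix H assume "nat \<lceil>real Z / \<bar>b\<bar>\<rceil> \<le> H"
      then have "real Z / \<bar>b\<bar> \<le> real H" by linarith
      then have "real Z \<le> \<bar>b\<bar> * real H" using b by (simp add: field_simps)
      then show "Z \<le> L H" using L_lower[of H] by linarith
    qed
  qed
  have lim: "(\<lambda>H. C * (\<bar>b\<bar> + 3) * ((\<Sum>n<L H. \<rho> (int n)) / real (L H) + (\<Sum>n<L H. \<rho> (- int n)) / real (L H))) \<longlonglongrightarrow> C * (\<bar>b\<bar> + 3) * (0 + 0)"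
    by (intro tendsto_intros filterlim_compose[OF plus L_top] filterlim_compose[OF minus L_top])
  show ?thesis
  proof (rule Lim_null_comparison)
    show "(\<lambda>H. C * (\<bar>b\<bar> + 3) * ((\<Sum>n<L H. \<rho> (int n)) / real (L H) + (\<Sum>n<L H. \<rho> (- int n)) / real (L H))) \<longlonglongrightarrow> 0"
      using lim by simp
    show "\<forall>\<^sub>F H in sequentially. norm ((\<Sum>h<H. \<rho> \<lfloor>b * real h\<rfloor>) / real H)
       \<le> C * (\<bar>b\<bar> + 3) * ((\<Sum>n<L H. \<rho> (int n)) / real (L H) + (\<Sum>n<L H. \<rho> (- int n)) / real (L H))"
      using eventually_ge_at_top[of 1]
    proof eventually_elim
      case (elim H)
      define P where "P = (\<Sum>n<L H. \<rho> (int n)) + (\<Sum>n<L H. \<rho> (- int n))"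
      have P: "0 \<le> P" by (auto simp: P_def intro!: add_nonneg_nonneg sum_nonneg \<rho>)
      have Lp: "0 < real (L H)" by (simp add: L_def del: of_nat_Suc)
      have "norm ((\<Sum>h<H. \<rho> \<lfloor>b * real h\<rfloor>) / real H) \<le> C * P / real H"
        using bound[of H] by (simp add: P_def sum_nonneg \<rho> divide_right_mono)
      also have "\<dots> \<le> C * (\<bar>b\<bar> + 3) * P / real (L H)"
      proof -
        have "real (L H) \<le> (\<bar>b\<bar> + 3) * real H"
          using L_upper[of H] elim by (simp add: distrib_right)
        then have "C * P * real (L H) \<le> C * P * ((\<bar>b\<bar> + 3) * real H)"
          using P by (intro mult_left_mono) (auto simp: C_def)
        then show ?thesis using elim Lp by (simp add: field_simps)
      qed
      finally show ?case by (simp only: P_def add_divide_distrib[symmetric] times_divide_eq_right)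
    qed
  qed
qed

section \<open>Actions of commuting weakly mixing transformations\<close>

definition unit_multiple :: "nat \<Rightarrow> int \<Rightarrow> nat \<Rightarrow> int"
  where "unit_multiple i k = (\<lambda>j. if j = i then k else 0)"

text \<open>After a van der Corput step a single factor carries powers of several transformations.
  Treating the commuting maps as one action of integer vectors lets exponents be subtracted and
  translated as vectors; \<open>A_cong\<close> says that only coordinates in \<open>I\<close> count.
  Weak mixing enters as Cesaro decay of correlations, which is derived from ergodicity of the
  product later.\<close>

locale weakly_mixing_action = prob_space M for M :: "'a measure" +
  fixes I :: "nat set" and A :: "(nat \<Rightarrow> int) \<Rightarrow> 'a \<Rightarrow> 'a"
  assumes finite_I: "finite I"
    and A_measurable [measurable]: "A m \<in> measurable M M"
    and A_distr: "distr M M (A m) = M"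
    and A_zero: "x \<in> space M \<Longrightarrow> A (\<lambda>_. 0) x = x"
    and A_add: "x \<in> space M \<Longrightarrow> A (\<lambda>i. m i + m' i) x = A m (A m' x)"
    and A_cong: "(\<And>i. i \<in> I \<Longrightarrow> m i = m' i) \<Longrightarrow> A m = A m'"
    and weak_mixing: "i \<in> I \<Longrightarrow> bounded_measurable M f \<Longrightarrow> bounded_measurable M g \<Longrightarrow>
      (\<integral>x. f x \<partial>M) = 0 \<Longrightarrow>
      (\<lambda>N. (\<Sum>n<N. cmod (\<integral>x. f (A (unit_multiple i (int n)) x) * g x \<partial>M)) / real N) \<longlonglongrightarrow> 0"
begin

lemma bounded_measurable_A:
  assumes "bounded_measurable M f"
  shows "bounded_measurable M (\<lambda>x. f (A m x))"
  using assms unfolding bounded_measurable_def by auto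

lemma integral_A:
  fixes f :: "'a \<Rightarrow> complex"
  assumes "f \<in> borel_measurable M"
  shows "(\<integral>x. f (A m x) \<partial>M) = (\<integral>x. f x \<partial>M)"
  using integral_distr[OF A_measurable[of m], of f] assms by (simp add: A_distr)

lemma A_add': "x \<in> space M \<Longrightarrow> (\<And>i. i \<in> I \<Longrightarrow> k i = m i + m' i) \<Longrightarrow> A k x = A m (A m' x)"
  using A_add[of x m m'] A_cong[of k "\<lambda>i. m i + m' i"] by simp

lemma integral_translate:
  fixes f :: "'a \<Rightarrow> complex"
  assumes "f \<in> borel_measurable M" and "\<And>x. x \<in> space M \<Longrightarrow> g x = f (A m x)"
  shows "(\<integral>x. g x \<partial>M) = (\<integral>x. f x \<partial>M)"
  using integral_A[OF assms(1), of m] assms(2) by (simp cong: Bochner_Integration.integral_cong)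

text \<open>By invariance the translation can be moved to \<open>g\<close>; subtracting the mean of
  \<open>g\<close> changes nothing because \<open>f\<close> has integral 0, and the two functions
  have then exchanged roles.\<close>

lemma weak_mixing_negative:
  assumes i: "i \<in> I" and f: "bounded_measurable M f" and g: "bounded_measurable M g"
    and f0: "(\<integral>x. f x \<partial>M) = 0"
  shows "(\<lambda>N. (\<Sum>n<N. cmod (\<integral>x. f (A (unit_multiple i (- int n)) x) * g x \<partial>M)) / real N) \<longlonglongrightarrow> 0"
proof -
  define c where "c = (\<integral>x. g x \<partial>M)"
  have gc: "bounded_measurable M (\<lambda>x. g x - c)"
    by (intro bounded_measurable_diff g bounded_measurable_const)
  have "(\<integral>x. f (A (unit_multiple i (- int n)) x) * g x \<partial>M) = (\<integral>x. (g (A (unit_multiple i (int n)) x) - c) * f x \<partial>M)" for n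
  proof -
    have "(\<integral>x. f (A (unit_multiple i (- int n)) x) * g x \<partial>M) = (\<integral>x. f x * g (A (unit_multiple i (int n)) x) \<partial>M)"
    proof (rule integral_translate[symmetric, where m = "unit_multiple i (int n)"])
      show "(\<lambda>x. f (A (unit_multiple i (- int n)) x) * g x) \<in> borel_measurable M"
        by (intro bounded_measurable_measurable bounded_measurable_mult bounded_measurable_A f g)
      fix x assume x: "x \<in> space M"
      have "A (unit_multiple i (- int n)) (A (unit_multiple i (int n)) x) = x"
        using A_add'[OF x, of "\<lambda>_. 0" "unit_multiple i (- int n)" "unit_multiple i (int n)"] A_zero[OF x]
        by (simp add: unit_multiple_def)
      then show "f x * g (A (unit_multiple i (int n)) x) =
          f (A (unit_multiple i (- int n)) (A (unit_multiple i (int n)) x)) * g (A (unit_multiple i (int n)) x)"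
        by simp
    qed
    also have "\<dots> = (\<integral>x. f x * g (A (unit_multiple i (int n)) x) - c * f x \<partial>M)"
    proof (subst Bochner_Integration.integral_diff)
      show "integrable M (\<lambda>x. f x * g (A (unit_multiple i (int n)) x))"
        by (intro integrable_bounded_measurable bounded_measurable_mult bounded_measurable_A f g)
      show "integrable M (\<lambda>x. c * f x)"
        by (intro integrable_mult_right integrable_bounded_measurable f)
    qed (simp add: f0)
    finally show ?thesis by (simp add: algebra_simps)
  qed
  moreover have "(\<integral>x. g x - c \<partial>M) = 0"
    by (subst Bochner_Integration.integral_diff[OF integrable_bounded_measurable[OF g] integrable_const])
      (simp add: c_def prob_space)
  ultimately show ?thesis using weak_mixing[OF i gc f] by simp
qed

text \<open>The fixed displacement \<open>e\<close> is absorbed into \<open>f\<close>, whose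
  integral it preserves.\<close>

lemma weak_mixing_floor:
  assumes i: "i \<in> I" and f: "bounded_measurable M f" and g: "bounded_measurable M g"
    and f0: "(\<integral>x. f x \<partial>M) = 0" and b: "b \<noteq> (0 :: real)"
  shows "(\<lambda>H. (\<Sum>h<H. cmod (\<integral>x. f (A (\<lambda>j. unit_multiple i \<lfloor>b * real h\<rfloor> j + e j) x) * g x \<partial>M)) / real H) \<longlonglongrightarrow> 0"
proof -
  have fe: "bounded_measurable M (\<lambda>x. f (A e x))" by (rule bounded_measurable_A[OF f])
  have fe0: "(\<integral>x. f (A e x) \<partial>M) = 0" using integral_A f f0 by (simp add: bounded_measurable_def)
  have eq: "(\<integral>x. f (A (\<lambda>j. unit_multiple i k j + e j) x) * g x \<partial>M) = (\<integral>x. f (A e (A (unit_multiple i k) x)) * g x \<partial>M)" for k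
    using A_add'[of _ "\<lambda>j. unit_multiple i k j + e j" e "unit_multiple i k"]
    by (intro Bochner_Integration.integral_cong) auto
  show ?thesis
    unfolding eq
    using cesaro_floor[of "\<lambda>k. cmod (\<integral>x. f (A e (A (unit_multiple i k) x)) * g x \<partial>M)" b]
      weak_mixing[OF i fe g fe0] weak_mixing_negative[OF i fe g fe0] b by simp
qed

text \<open>Coordinates outside \<open>I\<close> are pinned to 0 to make the set finite;
  \<open>box_proj\<close> normalises a vector accordingly without changing its action.\<close>

definition box :: "real \<Rightarrow> (nat \<Rightarrow> int) set"
  where "box C = {e. (\<forall>i\<in>I. \<bar>real_of_int (e i)\<bar> \<le> C) \<and> (\<forall>i. i \<notin> I \<longrightarrow> e i = 0)}"

lemma finite_box: "finite (box C)"
proof (rule finite_subset)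
  show "box C \<subseteq> {e. \<forall>i. (i \<in> I \<longrightarrow> e i \<in> {- \<lfloor>C\<rfloor>..\<lfloor>C\<rfloor>}) \<and> (i \<notin> I \<longrightarrow> e i = 0)}"
  proof (intro subsetI CollectI allI conjI impI)
    fix e i assume e: "e \<in> box C"
    show "e i \<in> {- \<lfloor>C\<rfloor>..\<lfloor>C\<rfloor>}" if "i \<in> I"
    proof -
      have "real_of_int (e i) \<le> C" "real_of_int (- e i) \<le> C" using e that by (auto simp: box_def abs_le_iff)
      then have "e i \<le> \<lfloor>C\<rfloor>" "- e i \<le> \<lfloor>C\<rfloor>" by (simp_all only: le_floor_iff)
      then show ?thesis by simp
    qed
    show "e i = 0" if "i \<notin> I" using e that by (auto simp: box_def)
  qed
  show "finite {e. \<forall>i. (i \<in> I \<longrightarrow> e i \<in> {- \<lfloor>C\<rfloor>..\<lfloor>C\<rfloor>}) \<and> (i \<notin> I \<longrightarrow> e i = 0)}"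
    by (intro finite_set_of_finite_funs finite_I) auto
qed

definition box_proj :: "(nat \<Rightarrow> int) \<Rightarrow> nat \<Rightarrow> int"
  where "box_proj e = (\<lambda>i. if i \<in> I then e i else 0)"

lemma box_proj_in_box: "(\<And>i. i \<in> I \<Longrightarrow> \<bar>real_of_int (e i)\<bar> \<le> C) \<Longrightarrow> box_proj e \<in> box C"
  by (auto simp: box_def box_proj_def)

lemma A_box_proj: "A (box_proj e) = A e"
  by (rule A_cong) (simp add: box_proj_def)

lemma bounded_measurable_prod_A:
  assumes "\<And>j. j \<in> J \<Longrightarrow> bounded_measurable M (f j)"
  shows "bounded_measurable M (\<lambda>x. \<Prod>j\<in>J. f j (A (m j) x))"
  by (intro bounded_measurable_prod bounded_measurable_A assms)

text \<open>The order of quantifiers matters: the threshold for \<open>k\<close> may depend on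
  \<open>h\<close>, but \<open>C\<close> may not, so that one finite set of error vectors serves all
  shifts and weak mixing can be applied to each of its elements separately.\<close>

definition linear_along :: "nat \<Rightarrow> real \<Rightarrow> (nat \<Rightarrow> nat \<Rightarrow> int) \<Rightarrow> bool"
  where "linear_along i0 b m \<longleftrightarrow> (\<exists>C. \<forall>h. \<forall>\<^sub>F k in sequentially. \<forall>i\<in>I.
    \<bar>real_of_int (m (k + h) i - m k i) - (if i = i0 then b * real h else 0)\<bar> \<le> C)"

lemma linear_along_diff:
  assumes "linear_along i0 b m" "linear_along i0 c n"
  shows "linear_along i0 (b - c) (\<lambda>k i. m k i - n k i)"
proof -
  obtain C where C: "\<And>h. \<forall>\<^sub>F k in sequentially. \<forall>i\<in>I.
    \<bar>real_of_int (m (k + h) i - m k i) - (if i = i0 then b * real h else 0)\<bar> \<le> C"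
    using assms(1) by (auto simp: linear_along_def)
  obtain D where D: "\<And>h. \<forall>\<^sub>F k in sequentially. \<forall>i\<in>I.
    \<bar>real_of_int (n (k + h) i - n k i) - (if i = i0 then c * real h else 0)\<bar> \<le> D"
    using assms(2) by (auto simp: linear_along_def)
  show ?thesis
    unfolding linear_along_def
  proof (intro exI allI)
    fix h
    show "\<forall>\<^sub>F k in sequentially. \<forall>i\<in>I. \<bar>real_of_int ((m (k + h) i - n (k + h) i) - (m k i - n k i))
        - (if i = i0 then (b - c) * real h else 0)\<bar> \<le> C + D"
      using C[of h] D[of h]
    proof eventually_elim
      case (elim k)
      show ?case
      proof
        fix i assume "i \<in> I"
        with elim have "\<bar>real_of_int (m (k + h) i - m k i) - (if i = i0 then b * real h else 0)\<bar> \<le> C"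
          "\<bar>real_of_int (n (k + h) i - n k i) - (if i = i0 then c * real h else 0)\<bar> \<le> D"
          by blast+
        then show "\<bar>real_of_int ((m (k + h) i - n (k + h) i) - (m k i - n k i))
            - (if i = i0 then (b - c) * real h else 0)\<bar> \<le> C + D"
          by (cases "i = i0") (simp_all add: algebra_simps)
      qed
    qed
  qed
qed

text \<open>The correlation of \<open>u (n + h)\<close> with \<open>u n\<close> is again a product
  along the same exponents, with \<open>f j\<close> replaced by its own displacement by about
  \<open>b j * h\<close> times its conjugate. The factor of \<open>j1\<close> is split into its mean
  and the rest. The mean is small on average over \<open>h\<close> by weak mixing, as
  \<open>b j1\<close> is not 0; the rest has integral 0, and a translation reduces it to fewer
  factors. Slopes are compared with that of \<open>j1\<close> only, a condition that survives the
  subtraction of a common slope.\<close>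

lemma mean_null_linear_family:
  assumes W: "admissible_weight W" and i0: "i0 \<in> I" and J: "finite J" "j1 \<in> J"
    and b1: "b j1 \<noteq> 0" and bj: "\<And>j. j \<in> J \<Longrightarrow> j \<noteq> j1 \<Longrightarrow> b j \<noteq> b j1"
    and f: "\<And>j. j \<in> J \<Longrightarrow> bounded_measurable M (f j)" and f0: "(\<integral>x. f j1 x \<partial>M) = 0"
    and m: "\<And>j. j \<in> J \<Longrightarrow> linear_along i0 (b j) (m j)"
  shows "mean_null W (\<lambda>n x. \<Prod>j\<in>J. f j (A (m j n) x))"
  using J b1 bj f f0 m
proof (induction "card J" arbitrary: J b f m rule: less_induct)
  case less
  note J = less.prems(1,2) and b1 = less.prems(3) and bj = less.prems(4) and f = less.prems(5)
    and f0 = less.prems(6) and m = less.prems(7)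
  note pos = admissible_weightD(1)[OF W]
  have "\<forall>j\<in>J. \<exists>B. 0 < B \<and> (\<forall>x. cmod (f j x) \<le> B)"
    using f by (meson bounded_measurable_bound)
  then obtain Bf where Bf: "\<And>j. j \<in> J \<Longrightarrow> 0 < Bf j" "\<And>j x. j \<in> J \<Longrightarrow> cmod (f j x) \<le> Bf j"
    by metis
  have "\<forall>j\<in>J. \<exists>C. \<forall>h. \<forall>\<^sub>F k in sequentially. \<forall>i\<in>I.
      \<bar>real_of_int (m j (k + h) i - m j k i) - (if i = i0 then b j * real h else 0)\<bar> \<le> C"
    using m by (simp add: linear_along_def)
  from bchoice[OF this] obtain Cf where Cf: "\<forall>j\<in>J. \<forall>h. \<forall>\<^sub>F k in sequentially. \<forall>i\<in>I.
      \<bar>real_of_int (m j (k + h) i - m j k i) - (if i = i0 then b j * real h else 0)\<bar> \<le> Cf j"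
    by (elim exE)
  \<comment> \<open>The summand 1 covers the rounding of \<open>b j * real h\<close>.\<close>
  define C where "C = (\<Sum>j\<in>J. \<bar>Cf j\<bar>) + 1"
  have C: "Cf j + 1 \<le> C" if "j \<in> J" for j
    using member_le_sum[OF that, of "\<lambda>j. \<bar>Cf j\<bar>"] J(1) by (simp add: C_def)
  define E where "E = box C"
  have fin: "finite E" by (simp add: E_def finite_box)
  define F where "F h j e x = f j (A (\<lambda>i. unit_multiple i0 \<lfloor>b j * real h\<rfloor> i + e i) x) * cnj (f j x)" for h j e x
  define \<mu> where "\<mu> h e = (\<integral>x. F h j1 e x \<partial>M)" for h e
  \<comment> \<open>Only the distinguished factor is centred; the product of the others is estimated
    by \<open>P\<close>.\<close>
  define F' where "F' h j e x = F h j e x - (if j = j1 then \<mu> h e else 0)" for h j e x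
  have bF: "bounded_measurable M (F h j e)" if "j \<in> J" for h j e
    unfolding F_def using that by (intro bounded_measurable_mult bounded_measurable_A bounded_measurable_cnj f)
  have bF': "bounded_measurable M (F' h j e)" if "j \<in> J" for h j e
    unfolding F'_def by (intro bounded_measurable_diff bounded_measurable_const bF that)
  have F'0: "(\<integral>x. F' h j1 e x \<partial>M) = 0" for h e
    unfolding F'_def using J(2)
    by (subst Bochner_Integration.integral_diff[OF integrable_bounded_measurable[OF bF] integrable_const])
      (simp_all add: \<mu>_def prob_space)
  define P where "P = (\<Prod>j\<in>J - {j1}. (Bf j)\<^sup>2)"
  define \<delta> where "\<delta> h = P * (\<Sum>e\<in>E. cmod (\<mu> h e))" for h
  have P0: "0 \<le> P" by (auto simp: P_def intro: prod_nonneg)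
  define u where "u n x = (\<Prod>j\<in>J. f j (A (m j n) x))" for n x
  have bu: "bounded_measurable M (u n)" for n unfolding u_def by (intro bounded_measurable_prod_A f)
  define a where "a h ev n = cmod (\<integral>x. (\<Prod>j\<in>J. F' h j (ev j) (A (m j n) x)) \<partial>M)" for h ev n
  have a_lim: "wmean W (a h ev) \<longlonglongrightarrow> 0" for h ev
  proof (cases "J = {j1}")
    \<comment> \<open>With one factor the translation leaves nothing to apply the induction
      hypothesis to, but the integral is 0 by invariance.\<close>
    case True
    have "a h ev n = 0" for n
      unfolding a_def True using integral_A[OF bounded_measurable_measurable[OF bF'[OF J(2)]]] F'0 by simp
    then have "a h ev = (\<lambda>_. 0)" by (rule ext)
    then have "wmean W (a h ev) = (\<lambda>_. 0)" by (simp only: wmean_def[abs_def]) simp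
    then show ?thesis by (simp only: tendsto_const)
  next
    case False
    \<comment> \<open>Translating by the exponent of \<open>j0\<close> turns this factor into a
      fixed test function. Slopes become relative to \<open>b j0\<close>, and that of
      \<open>j1\<close> is still nonzero and different from the others.\<close>
    then obtain j0 where j0: "j0 \<in> J" "j0 \<noteq> j1" using J(2) by blast
    define v where "v n x = (\<Prod>j\<in>J - {j0}. F' h j (ev j) (A (\<lambda>i. m j n i - m j0 n i) x))" for n x
    have bv: "bounded_measurable M (v n)" for n
      unfolding v_def by (intro bounded_measurable_prod_A bF') auto
    have null: "mean_null W v"
      unfolding v_def
    proof (rule less.hyps[of "J - {j0}" "\<lambda>j. b j - b j0" "\<lambda>j. F' h j (ev j)" "\<lambda>j n i. m j n i - m j0 n i"])
      show "card (J - {j0}) < card J" by (rule card_Diff1_less[OF J(1) j0(1)])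
      show "linear_along i0 (b j - b j0) (\<lambda>n i. m j n i - m j0 n i)" if "j \<in> J - {j0}" for j
        using that j0 by (intro linear_along_diff m) auto
      show "b j - b j0 \<noteq> b j1 - b j0" if "j \<in> J - {j0}" "j \<noteq> j1" for j using that bj[of j] by auto
      show "b j1 - b j0 \<noteq> 0" using bj[OF j0] by auto
      show "finite (J - {j0})" "j1 \<in> J - {j0}" using J j0 by auto
      show "bounded_measurable M (F' h j (ev j))" if "j \<in> J - {j0}" for j using that by (intro bF') auto
      show "(\<integral>x. F' h j1 (ev j1) x \<partial>M) = 0" by (rule F'0)
    qed
    have "a h ev n = cmod (\<integral>x. v n x * F' h j0 (ev j0) x \<partial>M)" for n
    proof -
      have "(\<integral>x. (\<Prod>j\<in>J. F' h j (ev j) (A (m j n) x)) \<partial>M) = (\<integral>x. v n x * F' h j0 (ev j0) x \<partial>M)"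
      proof (rule integral_translate[where m = "m j0 n"])
        show "(\<lambda>x. v n x * F' h j0 (ev j0) x) \<in> borel_measurable M"
          by (intro bounded_measurable_measurable bounded_measurable_mult bv bF' j0)
        fix x assume x: "x \<in> space M"
        have "A (\<lambda>i. m j n i - m j0 n i) (A (m j0 n) x) = A (m j n) x" for j
          using A_add'[OF x, of "m j n" "\<lambda>i. m j n i - m j0 n i" "m j0 n"] by simp
        then show "(\<Prod>j\<in>J. F' h j (ev j) (A (m j n) x)) = v n (A (m j0 n) x) * F' h j0 (ev j0) (A (m j0 n) x)"
          using j0 J(1) by (simp add: v_def prod.remove[of J j0] mult.commute)
      qed
      then show ?thesis by (simp add: a_def)
    qed
    then have "a h ev = (\<lambda>n. cmod (\<integral>x. v n x * F' h j0 (ev j0) x \<partial>M))" by auto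
    then show ?thesis
      using mean_null_imp_correlations[OF pos null bv bF'[OF j0(1)], of h "ev j0"] by simp
  qed
  \<comment> \<open>The rounding errors \<open>ev\<close> vary with \<open>n\<close>, but within a
    finite set, so finitely many sequences \<open>a h ev\<close> majorise the correlations.\<close>
  have key: "\<forall>\<^sub>F n in sequentially. \<exists>ev\<in>PiE J (\<lambda>_. E). cmod (\<integral>x. u (n + h) x * cnj (u n x) \<partial>M) \<le> a h ev n + \<delta> h" for h
  proof -
    have "\<forall>\<^sub>F k in sequentially. \<forall>j\<in>J. \<forall>i\<in>I.
        \<bar>real_of_int (m j (k + h) i - m j k i) - (if i = i0 then b j * real h else 0)\<bar> \<le> Cf j"
      using Cf J(1) by (intro eventually_ball_finite) auto
    then show ?thesis
    proof eventually_elim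
      case (elim n)
      define ev where "ev = restrict (\<lambda>j. box_proj (\<lambda>i. m j (n + h) i - m j n i - unit_multiple i0 \<lfloor>b j * real h\<rfloor> i)) J"
      have ev: "ev j \<in> E" if "j \<in> J" for j
      proof -
        have "\<bar>real_of_int (m j (n + h) i - m j n i - unit_multiple i0 \<lfloor>b j * real h\<rfloor> i)\<bar> \<le> C" if "i \<in> I" for i
          using elim[rule_format, OF \<open>j \<in> J\<close> that] C[OF \<open>j \<in> J\<close>]
          by (cases "i = i0") (simp_all add: unit_multiple_def, linarith)
        then show ?thesis using that by (auto simp: ev_def E_def intro: box_proj_in_box)
      qed
      have u_eq: "u (n + h) x * cnj (u n x) = (\<Prod>j\<in>J. F h j (ev j) (A (m j n) x))" if x: "x \<in> space M" for x
      proof -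
        have "f j (A (m j (n + h)) x) * cnj (f j (A (m j n) x)) = F h j (ev j) (A (m j n) x)" if "j \<in> J" for j
        proof -
          have "A (m j (n + h)) x = A (\<lambda>i. unit_multiple i0 \<lfloor>b j * real h\<rfloor> i + ev j i) (A (m j n) x)"
            using that by (intro A_add'[OF x]) (simp add: ev_def box_proj_def)
          then show ?thesis by (simp add: F_def)
        qed
        then show ?thesis by (simp add: u_def prod.distrib[symmetric])
      qed
      define R where "R x = (\<Prod>j\<in>J - {j1}. F h j (ev j) (A (m j n) x))" for x
      have bR: "bounded_measurable M R"
        unfolding R_def by (intro bounded_measurable_prod_A bF) auto
      have R_bound: "cmod (R x) \<le> P" for x
        unfolding R_def P_def prod_norm[symmetric]
      proof (intro prod_mono conjI norm_ge_zero)
        fix j assume "j \<in> J - {j1}"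
        then have "cmod (f j y) * cmod (f j z) \<le> Bf j * Bf j" for y z
          using Bf[of j] by (intro mult_mono) (auto intro: less_imp_le)
        then show "cmod (F h j (ev j) (A (m j n) x)) \<le> (Bf j)\<^sup>2"
          by (simp add: F_def norm_mult power2_eq_square)
      qed
      have prod_split: "(\<Prod>j\<in>J. F h j (ev j) (A (m j n) x)) = (\<Prod>j\<in>J. F' h j (ev j) (A (m j n) x)) + \<mu> h (ev j1) * R x" for x
      proof -
        have "(\<Prod>j\<in>J. F' h j (ev j) (A (m j n) x)) = F' h j1 (ev j1) (A (m j1 n) x) * R x"
          using J by (simp add: prod.remove[of J j1] R_def F'_def)
        moreover have "(\<Prod>j\<in>J. F h j (ev j) (A (m j n) x)) = F h j1 (ev j1) (A (m j1 n) x) * R x"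
          using J by (simp add: prod.remove[of J j1] R_def)
        ultimately show ?thesis by (simp add: F'_def algebra_simps)
      qed
      have "(\<integral>x. u (n + h) x * cnj (u n x) \<partial>M) = (\<integral>x. (\<Prod>j\<in>J. F' h j (ev j) (A (m j n) x)) + \<mu> h (ev j1) * R x \<partial>M)"
        by (intro Bochner_Integration.integral_cong) (auto simp: u_eq prod_split)
      also have "\<dots> = (\<integral>x. (\<Prod>j\<in>J. F' h j (ev j) (A (m j n) x)) \<partial>M) + \<mu> h (ev j1) * (\<integral>x. R x \<partial>M)"
      proof (subst Bochner_Integration.integral_add)
        show "integrable M (\<lambda>x. \<Prod>j\<in>J. F' h j (ev j) (A (m j n) x))"
          by (intro integrable_bounded_measurable bounded_measurable_prod_A bF')
        show "integrable M (\<lambda>x. \<mu> h (ev j1) * R x)"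
          by (intro integrable_mult_right integrable_bounded_measurable bR)
      qed simp
      also have "cmod \<dots> \<le> a h ev n + cmod (\<mu> h (ev j1)) * P"
      proof -
        have "cmod (\<integral>x. R x \<partial>M) \<le> P"
          by (rule order_trans[OF integral_norm_bound integral_le_const[OF integrable_norm[OF integrable_bounded_measurable[OF bR]]]])
            (simp add: R_bound)
        then have "cmod (\<mu> h (ev j1) * (\<integral>x. R x \<partial>M)) \<le> cmod (\<mu> h (ev j1)) * P"
          unfolding norm_mult by (intro mult_left_mono) auto
        then show ?thesis unfolding a_def by (rule norm_triangle_mono[OF order_refl])
      qed
      also have "cmod (\<mu> h (ev j1)) * P \<le> \<delta> h"
        unfolding \<delta>_def using ev[OF J(2)] fin P0
        by (subst mult.commute) (intro mult_left_mono member_le_sum, auto)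
      finally have "cmod (\<integral>x. u (n + h) x * cnj (u n x) \<partial>M) \<le> a h ev n + \<delta> h" by simp
      moreover have "ev \<in> PiE J (\<lambda>_. E)" using ev by (auto simp: ev_def)
      ultimately show ?case by blast
    qed
  qed
  have "mean_null W u"
  proof (rule van_der_corput[OF W])
    show "u n \<in> borel_measurable M" for n by (rule bounded_measurable_measurable[OF bu])
    show "cmod (u n x) \<le> (\<Prod>j\<in>J. Bf j)" for n x
      unfolding u_def prod_norm[symmetric] by (intro prod_mono conjI Bf) auto
    show "0 \<le> \<delta> h" for h by (auto simp: \<delta>_def intro!: mult_nonneg_nonneg P0 sum_nonneg)
    show "(\<lambda>H. (\<Sum>h<H. \<delta> h) / real H) \<longlonglongrightarrow> 0"
    proof -
      have "(\<lambda>H. P * (\<Sum>e\<in>E. (\<Sum>h<H. cmod (\<mu> h e)) / real H)) \<longlonglongrightarrow> P * (\<Sum>e\<in>E. 0)"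
        unfolding \<mu>_def F_def using f[OF J(2)] f0 b1
        by (intro tendsto_intros weak_mixing_floor i0 bounded_measurable_cnj)
      moreover have "P * (\<Sum>e\<in>E. (\<Sum>h<H. cmod (\<mu> h e)) / real H) = (\<Sum>h<H. \<delta> h) / real H" for H
        unfolding \<delta>_def sum_distrib_left[symmetric] sum_divide_distrib[symmetric]
        by (subst sum.swap) simp
      ultimately show ?thesis by simp
    qed
    fix h :: nat and \<epsilon> :: real assume "0 < h" "0 < \<epsilon>"
    define \<gamma> where "\<gamma> n = cmod (\<integral>x. u (n + h) x * cnj (u n x) \<partial>M)" for n
    obtain n0 where n0: "\<And>n. n \<ge> n0 \<Longrightarrow> \<exists>ev\<in>PiE J (\<lambda>_. E). \<gamma> n \<le> a h ev n + \<delta> h"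
      using key[of h] unfolding eventually_sequentially \<gamma>_def by blast
    \<comment> \<open>Only the excess of the correlation over \<open>\<delta> h\<close> tends to 0
      in mean.\<close>
    have "wmean W (\<lambda>n. max 0 (\<gamma> n - \<delta> h)) \<longlonglongrightarrow> 0"
    proof (rule wmean_tendsto_0_finite_choice[OF pos])
      show "finite (PiE J (\<lambda>_. E))" using J(1) fin by (intro finite_PiE) auto
      show "wmean W (a h ev) \<longlonglongrightarrow> 0" for ev by (rule a_lim)
      show "0 \<le> a h ev n" for ev n by (simp add: a_def)
      show "filterlim (\<lambda>N. \<Sum>n<N. W n) at_top sequentially" by (rule sum_weight_at_top[OF W])
      fix n assume "n0 \<le> n"
      from n0[OF this] obtain ev where ev: "ev \<in> PiE J (\<lambda>_. E)" "\<gamma> n \<le> a h ev n + \<delta> h" by blast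
      moreover have "0 \<le> a h ev n" by (simp add: a_def)
      ultimately have "max 0 (\<gamma> n - \<delta> h) \<le> a h ev n" by simp
      with ev(1) show "0 \<le> max 0 (\<gamma> n - \<delta> h) \<and> (\<exists>e\<in>PiE J (\<lambda>_. E). max 0 (\<gamma> n - \<delta> h) \<le> a h e n)"
        by auto
    qed
    then have "\<forall>\<^sub>F N in sequentially. wmean W (\<lambda>n. max 0 (\<gamma> n - \<delta> h)) N < \<epsilon>"
      using \<open>0 < \<epsilon>\<close> by (rule order_tendstoD)
    then have "\<forall>\<^sub>F N in sequentially. wmean W \<gamma> N \<le> \<delta> h + \<epsilon>"
      using eventually_gt_at_top[of 0]
    proof eventually_elim
      case (elim N)
      have "wmean W \<gamma> N \<le> wmean W (\<lambda>n. max 0 (\<gamma> n - \<delta> h) + \<delta> h) N"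
        by (intro wmean_mono pos) auto
      also have "\<dots> = wmean W (\<lambda>n. max 0 (\<gamma> n - \<delta> h)) N + \<delta> h"
        using elim(2) by (simp only: wmean_add wmean_const[of W, OF pos])
      finally show ?case using elim(1) by simp
    qed
    then show "\<forall>\<^sub>F N in sequentially. wmean W (\<lambda>n. cmod (\<integral>x. u (n + h) x * cnj (u n x) \<partial>M)) N \<le> \<delta> h + \<epsilon>"
      unfolding \<gamma>_def[abs_def] .
  qed
  then show ?case unfolding u_def[abs_def] .
qed

end

section \<open>Weak mixing and decay of correlations\<close>

text \<open>This is the maximum of the sums of \<open>f\<close> along the first \<open>k\<close>
  points of the orbit of \<open>x\<close>, over k \<le> n and including the empty sum; the recursion
  is the one behind the maximal ergodic theorem.\<close>

primrec max_sum :: "('a \<Rightarrow> 'a) \<Rightarrow> ('a \<Rightarrow> real) \<Rightarrow> nat \<Rightarrow> 'a \<Rightarrow> real"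
  where "max_sum T f 0 x = 0"
  | "max_sum T f (Suc n) x = max 0 (f x + max_sum T f n (T x))"

lemma max_sum_nonneg: "0 \<le> max_sum T f n x"
  by (cases n) auto

lemma max_sum_mono_Suc: "max_sum T f n x \<le> max_sum T f (Suc n) x"
proof (induction n arbitrary: x)
  case (Suc n)
  have "max 0 (f x + max_sum T f n (T x)) \<le> max 0 (f x + max_sum T f (Suc n) (T x))"
    using Suc[of "T x"] by (intro max.mono add_left_mono order_refl)
  then show ?case by (simp only: max_sum.simps(2))
qed simp

lemma max_sum_mono: "n \<le> k \<Longrightarrow> max_sum T f n x \<le> max_sum T f k x"
  by (rule lift_Suc_mono_le[of "\<lambda>n. max_sum T f n x", OF max_sum_mono_Suc])

lemma sum_iterates_le_max_sum: "(\<Sum>k<n. f ((T ^^ k) x)) \<le> max_sum T f n x"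
proof (induction n arbitrary: x)
  case (Suc n)
  have "(\<Sum>k<Suc n. f ((T ^^ k) x)) = f x + (\<Sum>k<n. f ((T ^^ k) (T x)))"
    by (simp add: sum.lessThan_Suc_shift funpow_swap1 del: sum.lessThan_Suc)
  with Suc[of "T x"] show ?case by simp
qed simp

lemma max_sum_le:
  assumes "\<And>x. \<bar>f x\<bar> \<le> B"
  shows "max_sum T f n x \<le> real n * B"
proof (induction n arbitrary: x)
  case (Suc n)
  have "0 \<le> B" using assms[of undefined] by linarith
  then show ?case using Suc[of "T x"] assms[of x] by (auto simp: distrib_right intro!: add_nonneg_nonneg)
qed simp

context prob_space
begin

lemma max_sum_measurable:
  assumes [measurable]: "T \<in> measurable M M" "f \<in> borel_measurable M"
  shows "max_sum T f n \<in> borel_measurable M"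
proof (induction n)
  case (Suc n)
  have [measurable]: "max_sum T f n \<in> borel_measurable M" by fact
  have "(\<lambda>x. max 0 (f x + max_sum T f n (T x))) \<in> borel_measurable M" by measurable
  then show ?case by (simp add: fun_eq_iff cong: measurable_cong)
qed (simp cong: measurable_cong)

text \<open>The set on which the maximal sums \<open>m\<^sub>n\<close> are unbounded is invariant. If it had measure \<open>1\<close>, then
  \<open>m\<^sub>n\<^sub>+\<^sub>1 - m\<^sub>n \<circ> T = max (- m\<^sub>n \<circ> T) f\<close> would tend to \<open>f\<close>, although its integral is nonnegative.\<close>

lemma ergodic_sums_bounded_above:
  fixes f :: "'a \<Rightarrow> real"
  assumes T: "T \<in> measurable M M" and T_distr: "distr M M T = M" and erg: "ergodic M T"
    and f: "f \<in> borel_measurable M" and B: "\<And>x. \<bar>f x\<bar> \<le> B" and neg: "(\<integral>x. f x \<partial>M) < 0"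
  shows "AE x in M. \<exists>K. \<forall>n. (\<Sum>k<n. f ((T ^^ k) x)) \<le> K"
proof -
  note [measurable] = T f
  define m where "m = max_sum T f"
  have m_Suc: "m (Suc n) x = max 0 (f x + m n (T x))" for n x by (simp only: m_def max_sum.simps)
  have m_meas [measurable]: "m n \<in> borel_measurable M" for n unfolding m_def by (rule max_sum_measurable[OF T f])
  have m_nonneg: "0 \<le> m n x" for n x unfolding m_def by (rule max_sum_nonneg)
  have m_int: "integrable M (m n)" for n
  proof (rule integrable_const_bound[where B = "real n * B"])
    have "norm (m n x) \<le> real n * B" for x
      using max_sum_le[of f B T n x, OF B] m_nonneg[of n x] by (simp add: m_def)
    then show "AE x in M. norm (m n x) \<le> real n * B" by (intro AE_I2)
  qed (rule m_meas)
  define A where "A = {x \<in> space M. \<forall>K::nat. \<exists>n. real K < m n x}"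
  have A [measurable]: "A \<in> sets M" unfolding A_def by measurable
  have Tsp: "x \<in> space M \<Longrightarrow> T x \<in> space M" for x using T by (rule measurable_space)
  \<comment> \<open>Passing from \<open>x\<close> to \<open>T x\<close> together with a shift of the
    index by one changes the maximal sum by at most \<open>D\<close>, which gives the invariance of
    \<open>A\<close>. \<open>D\<close> is natural to match the thresholds in
    \<open>A\<close>.\<close>
  obtain D :: nat where D: "B \<le> real D" using real_arch_simple by blast
  have fD: "\<bar>f x\<bar> \<le> real D" for x using B[of x] D by linarith
  have "T -` A \<inter> space M = A"
  proof (intro equalityI subsetI)
    fix x assume x: "x \<in> T -` A \<inter> space M"
    have "\<exists>n. real K < m n x" for K
    proof -
      obtain n where "real (K + D) < m n (T x)" using x unfolding A_def by blast
      then have "real K < m (Suc n) x" using fD[of x] by (simp add: m_Suc)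
      then show ?thesis ..
    qed
    with x show "x \<in> A" by (auto simp: A_def)
  next
    fix x assume x: "x \<in> A"
    have "\<exists>n. real K < m n (T x)" for K
    proof -
      obtain n where n: "real (K + D) < m n x" using x unfolding A_def by blast
      then obtain n' where "n = Suc n'" by (cases n) (auto simp: m_def)
      with n have "real K < m n' (T x)" using fD[of x] by (auto simp: m_Suc max_def split: if_splits)
      then show ?thesis ..
    qed
    with x Tsp show "x \<in> T -` A \<inter> space M" by (auto simp: A_def)
  qed
  then consider "prob A = 0" | "prob A = 1" using erg A unfolding ergodic_def by blast
  then show ?thesis
  proof cases
    case 1
    then have "A \<in> null_sets M" using A by (intro null_setsI) (auto simp: emeasure_eq_measure)
    then have "AE x in M. x \<notin> A" by (rule AE_not_in)
    then show ?thesis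
    proof (rule AE_mp, intro AE_I2 impI)
      fix x assume x: "x \<in> space M" "x \<notin> A"
      then obtain K :: nat where "\<forall>n. m n x \<le> real K" by (auto simp: A_def not_less)
      then have "\<forall>n. (\<Sum>k<n. f ((T ^^ k) x)) \<le> real K"
        using sum_iterates_le_max_sum[of f T x] order_trans unfolding m_def by blast
      then show "\<exists>K. \<forall>n. (\<Sum>k<n. f ((T ^^ k) x)) \<le> K" ..
    qed
  next
    case 2
    then have AE_A: "AE x in M. x \<in> A" using A prob_eq_1 by blast
    define d where "d n x = m (Suc n) x - m n (T x)" for n x
    have d_eq: "d n x = max (- m n (T x)) (f x)" for n x by (simp add: d_def m_Suc)
    have int_mT: "integrable M (\<lambda>x. m n (T x))" "(\<integral>x. m n (T x) \<partial>M) = (\<integral>x. m n x \<partial>M)" for n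
      using integrable_distr[OF T, of "m n"] integral_distr[OF T, of "m n"] m_int[of n] by (simp_all add: T_distr)
    have "(\<lambda>n. \<integral>x. d n x \<partial>M) \<longlonglongrightarrow> (\<integral>x. f x \<partial>M)"
    proof (rule integral_dominated_convergence[where w = "\<lambda>_. B"])
      show "d n \<in> borel_measurable M" for n unfolding d_def by measurable
      show "AE x in M. norm (d n x) \<le> B" for n
      proof (rule AE_I2)
        fix x
        show "norm (d n x) \<le> B" using B[of x] m_nonneg[of n "T x"] by (simp add: d_eq max_def abs_le_iff)
      qed
      show "AE x in M. (\<lambda>n. d n x) \<longlonglongrightarrow> f x"
        using AE_A
      proof (rule AE_mp, intro AE_I2 impI)
        fix x assume x: "x \<in> space M" "x \<in> A"
        then have "T x \<in> A" using \<open>T -` A \<inter> space M = A\<close> by auto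
        then obtain n0 where n0: "real D < m n0 (T x)" unfolding A_def by blast
        have "d n x = f x" if "n \<ge> n0" for n
        proof -
          have "real D < m n (T x)" using n0 max_sum_mono[OF that, of T f "T x"] by (simp add: m_def)
          then show ?thesis using fD[of x] by (simp add: d_eq)
        qed
        then show "(\<lambda>n. d n x) \<longlonglongrightarrow> f x"
          by (intro tendsto_eventually eventually_sequentiallyI)
      qed
    qed (use f in auto)
    moreover have "0 \<le> (\<integral>x. d n x \<partial>M)" for n
    proof -
      have "(\<integral>x. d n x \<partial>M) = (\<integral>x. m (Suc n) x \<partial>M) - (\<integral>x. m n x \<partial>M)"
        unfolding d_def by (subst Bochner_Integration.integral_diff[OF m_int int_mT(1)]) (simp add: int_mT(2))
      also have "\<dots> \<ge> 0"
        using integral_mono[OF m_int[of n] m_int[of "Suc n"]] max_sum_mono_Suc[of T f n]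
        by (simp add: m_def del: max_sum.simps)
      finally show ?thesis .
    qed
    ultimately have "0 \<le> (\<integral>x. f x \<partial>M)" by (intro LIMSEQ_le_const) auto
    with neg show ?thesis by simp
  qed
qed

text \<open>Lowered by its integral and by \<open>1 / real (Suc j)\<close>, the function has
  negative integral, so its sums are bounded above and disappear after division by \<open>n\<close>;
  countably many \<open>j\<close> suffice.\<close>

lemma ergodic_limsup_le:
  fixes f :: "'a \<Rightarrow> real"
  assumes T: "T \<in> measurable M M" and T_distr: "distr M M T = M" and erg: "ergodic M T"
    and f: "f \<in> borel_measurable M" and B: "\<And>x. \<bar>f x\<bar> \<le> B"
  shows "AE x in M. \<forall>\<epsilon>>0. \<forall>\<^sub>F n in sequentially. (\<Sum>k<n. f ((T ^^ k) x)) / real n \<le> (\<integral>x. f x \<partial>M) + \<epsilon>"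
proof -
  define c where "c = (\<integral>x. f x \<partial>M)"
  have int: "integrable M f" using f B by (intro integrable_const_bound[where B = B]) auto
  have "AE x in M. \<exists>K. \<forall>n. (\<Sum>k<n. f ((T ^^ k) x) - c - 1 / real (Suc j)) \<le> K" for j
  proof (rule ergodic_sums_bounded_above[OF T T_distr erg])
    show "(\<lambda>x. f x - c - 1 / real (Suc j)) \<in> borel_measurable M" using f by measurable
    show "\<bar>f x - c - 1 / real (Suc j)\<bar> \<le> B + \<bar>c\<bar> + \<bar>1 / real (Suc j)\<bar>" for x
      using B[of x] by linarith
    show "(\<integral>x. f x - c - 1 / real (Suc j) \<partial>M) < 0"
      using int by (simp add: c_def prob_space)
  qed
  then have "AE x in M. \<forall>j. \<exists>K. \<forall>n. (\<Sum>k<n. f ((T ^^ k) x) - c - 1 / real (Suc j)) \<le> K"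
    by (subst AE_all_countable) blast
  then show ?thesis
  proof (rule AE_mp, intro AE_I2 impI allI)
    fix x and \<epsilon> :: real
    assume *: "\<forall>j. \<exists>K. \<forall>n. (\<Sum>k<n. f ((T ^^ k) x) - c - 1 / real (Suc j)) \<le> K" and "0 < \<epsilon>"
    obtain j where j: "1 / real (Suc j) < \<epsilon> / 2" using \<open>0 < \<epsilon>\<close> nat_approx_posE[of "\<epsilon> / 2"] by auto
    from * obtain K where K: "\<And>n. (\<Sum>k<n. f ((T ^^ k) x) - c - 1 / real (Suc j)) \<le> K" by blast
    have "(\<lambda>n. K / real n) \<longlonglongrightarrow> 0" by real_asymp
    then have "\<forall>\<^sub>F n in sequentially. K / real n < \<epsilon> / 2"
      using \<open>0 < \<epsilon>\<close> by (intro order_tendstoD) auto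
    then show "\<forall>\<^sub>F n in sequentially. (\<Sum>k<n. f ((T ^^ k) x)) / real n \<le> (\<integral>x. f x \<partial>M) + \<epsilon>"
      using eventually_gt_at_top[of 0]
    proof eventually_elim
      case (elim n)
      have "(\<Sum>k<n. f ((T ^^ k) x)) - real n * c - real n * (1 / real (Suc j)) \<le> K"
        using K[of n] unfolding sum_subtractf by (simp del: of_nat_Suc)
      then have "(\<Sum>k<n. f ((T ^^ k) x)) \<le> K + real n * (c + 1 / real (Suc j))"
        by (simp add: distrib_left del: of_nat_Suc)
      then have "(\<Sum>k<n. f ((T ^^ k) x)) / real n \<le> (K + real n * (c + 1 / real (Suc j))) / real n"
        by (rule divide_right_mono) simp
      also have "\<dots> = K / real n + (c + 1 / real (Suc j))"
        using elim(2) by (simp add: add_divide_distrib del: of_nat_Suc)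
      finally show ?case using elim(1) j unfolding c_def by linarith
    qed
  qed
qed

text \<open>Birkhoff's theorem for bounded functions: the lower estimate is the upper one for
  \<open>- f\<close>.\<close>

lemma ergodic_averages_tendsto:
  fixes f :: "'a \<Rightarrow> real"
  assumes T: "T \<in> measurable M M" and T_distr: "distr M M T = M" and erg: "ergodic M T"
    and f: "f \<in> borel_measurable M" and B: "\<And>x. \<bar>f x\<bar> \<le> B"
  shows "AE x in M. (\<lambda>n. (\<Sum>k<n. f ((T ^^ k) x)) / real n) \<longlonglongrightarrow> (\<integral>x. f x \<partial>M)"
proof -
  have "AE x in M. \<forall>\<epsilon>>0. \<forall>\<^sub>F n in sequentially. (\<Sum>k<n. f ((T ^^ k) x)) / real n \<le> (\<integral>x. f x \<partial>M) + \<epsilon>"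
    by (rule ergodic_limsup_le[OF T T_distr erg f B])
  moreover have "AE x in M. \<forall>\<epsilon>>0. \<forall>\<^sub>F n in sequentially. (\<Sum>k<n. - f ((T ^^ k) x)) / real n \<le> (\<integral>x. - f x \<partial>M) + \<epsilon>"
    by (rule ergodic_limsup_le[OF T T_distr erg, where B = B]) (use f B in auto)
  ultimately show ?thesis
  proof eventually_elim
    case (elim x)
    show ?case
    proof (rule LIMSEQ_I)
      fix \<epsilon> :: real assume "0 < \<epsilon>"
      have "\<forall>\<^sub>F n in sequentially. (\<Sum>k<n. f ((T ^^ k) x)) / real n \<le> (\<integral>x. f x \<partial>M) + \<epsilon> / 2"
        "\<forall>\<^sub>F n in sequentially. (\<Sum>k<n. - f ((T ^^ k) x)) / real n \<le> (\<integral>x. - f x \<partial>M) + \<epsilon> / 2"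
        using elim \<open>0 < \<epsilon>\<close> by simp_all
      then have "\<forall>\<^sub>F n in sequentially. norm ((\<Sum>k<n. f ((T ^^ k) x)) / real n - (\<integral>x. f x \<partial>M)) < \<epsilon>"
      proof eventually_elim
        case (elim n)
        then show ?case using \<open>0 < \<epsilon>\<close> by (simp add: sum_negf abs_less_iff)
      qed
      then show "\<exists>n0. \<forall>n\<ge>n0. norm ((\<Sum>k<n. f ((T ^^ k) x)) / real n - (\<integral>x. f x \<partial>M)) < \<epsilon>"
        by (simp add: eventually_sequentially)
    qed
  qed
qed

lemma funpow_measurable:
  assumes "T \<in> measurable M M"
  shows "T ^^ n \<in> measurable M M"
  by (induction n) (auto intro: measurable_compose[OF _ assms] simp: comp_def)

lemma ergodic_correlations:
  fixes f g :: "'a \<Rightarrow> real"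
  assumes T: "T \<in> measurable M M" and T_distr: "distr M M T = M" and erg: "ergodic M T"
    and f: "f \<in> borel_measurable M" and B: "\<And>x. \<bar>f x\<bar> \<le> B"
    and g: "g \<in> borel_measurable M" and C: "\<And>x. \<bar>g x\<bar> \<le> C"
  shows "(\<lambda>n. (\<Sum>k<n. \<integral>x. f ((T ^^ k) x) * g x \<partial>M) / real n) \<longlonglongrightarrow> (\<integral>x. f x \<partial>M) * (\<integral>x. g x \<partial>M)"
proof -
  have B0: "0 \<le> B" using B[of undefined] by linarith
  note [measurable] = f g funpow_measurable[OF T]
  have int: "integrable M (\<lambda>x. f ((T ^^ k) x) * g x)" for k
    by (rule integrable_const_bound[where B = "B * C"]) (auto simp: abs_mult intro!: mult_mono B C B0)
  have "(\<lambda>n. \<integral>x. ((\<Sum>k<n. f ((T ^^ k) x)) / real n) * g x \<partial>M) \<longlonglongrightarrow> (\<integral>x. (\<integral>x. f x \<partial>M) * g x \<partial>M)"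
  proof (rule integral_dominated_convergence[where w = "\<lambda>_. B * C"])
    show "AE x in M. (\<lambda>n. ((\<Sum>k<n. f ((T ^^ k) x)) / real n) * g x) \<longlonglongrightarrow> (\<integral>x. f x \<partial>M) * g x"
      using ergodic_averages_tendsto[OF T T_distr erg f B] by eventually_elim (intro tendsto_mult tendsto_const)
    show "AE x in M. norm (((\<Sum>k<n. f ((T ^^ k) x)) / real n) * g x) \<le> B * C" for n
    proof (rule AE_I2)
      fix x
      have "\<bar>\<Sum>k<n. f ((T ^^ k) x)\<bar> \<le> (\<Sum>k<n. B)"
        by (intro order_trans[OF sum_abs] sum_mono B)
      then have "\<bar>(\<Sum>k<n. f ((T ^^ k) x)) / real n\<bar> \<le> B"
        using B0 by (cases "n = 0") (simp_all add: abs_divide field_simps)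
      then show "norm (((\<Sum>k<n. f ((T ^^ k) x)) / real n) * g x) \<le> B * C"
        unfolding real_norm_def abs_mult using C B0 by (intro mult_mono) auto
    qed
  qed auto
  moreover have "(\<integral>x. ((\<Sum>k<n. f ((T ^^ k) x)) / real n) * g x \<partial>M) = (\<Sum>k<n. \<integral>x. f ((T ^^ k) x) * g x \<partial>M) / real n" for n
  proof -
    have "(\<integral>x. ((\<Sum>k<n. f ((T ^^ k) x)) / real n) * g x \<partial>M) = (\<integral>x. (\<Sum>k<n. f ((T ^^ k) x) * g x) / real n \<partial>M)"
      by (simp only: sum_distrib_right times_divide_eq_left)
    then show ?thesis using int by (simp add: Bochner_Integration.integral_sum)
  qed
  ultimately show ?thesis by (simp only: integral_mult_right_zero)
qed

end

section \<open>Decay of correlations from ergodicity of the product\<close>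

lemma cesaro_abs_of_cesaro_square:
  fixes a :: "nat \<Rightarrow> real"
  assumes "(\<lambda>n. (\<Sum>k<n. (a k)\<^sup>2) / real n) \<longlonglongrightarrow> 0"
  shows "(\<lambda>n. (\<Sum>k<n. \<bar>a k\<bar>) / real n) \<longlonglongrightarrow> 0"
proof -
  have eq: "wmean (\<lambda>_. 1) b n = (\<Sum>k<n. b k) / real n" for b :: "nat \<Rightarrow> real" and n
    by (simp add: wmean_def divide_inverse_commute)
  have "(\<lambda>n. sqrt ((\<Sum>k<n. (a k)\<^sup>2) / real n)) \<longlonglongrightarrow> sqrt 0"
    by (intro tendsto_real_sqrt assms)
  then have lim: "(\<lambda>n. sqrt ((\<Sum>k<n. (a k)\<^sup>2) / real n)) \<longlonglongrightarrow> 0"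
    by simp
  show ?thesis
  proof (rule Lim_null_comparison[OF always_eventually lim], rule allI)
    show "norm ((\<Sum>k<n. \<bar>a k\<bar>) / real n) \<le> sqrt ((\<Sum>k<n. (a k)\<^sup>2) / real n)" for n
      using wmean_jensen[of "\<lambda>_. 1" "\<lambda>k. \<bar>a k\<bar>" n] unfolding eq by (intro real_le_rsqrt) (simp add: sum_nonneg)
  qed
qed

text \<open>The square of a correlation is a correlation of tensor squares for the product map. Its
  ergodicity yields the Cesaro limit of these squares, which is 0 because the tensor square of
  \<open>f\<close> has integral 0.\<close>

lemma (in prob_space) weakly_mixing_correlations_real:
  assumes T: "T \<in> measurable M M" and T_distr: "distr M M T = M" and wm: "weakly_mixing M T"
    and f: "f \<in> borel_measurable M" and B: "\<And>x. \<bar>f x\<bar> \<le> B" and f0: "(\<integral>x. f x \<partial>M) = (0::real)"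
    and g: "g \<in> borel_measurable M" and C: "\<And>x. \<bar>g x\<bar> \<le> C"
  shows "(\<lambda>n. (\<Sum>k<n. \<bar>\<integral>x. f ((T ^^ k) x) * g x \<partial>M\<bar>) / real n) \<longlonglongrightarrow> 0"
proof (rule cesaro_abs_of_cesaro_square)
  note [measurable] = T f g funpow_measurable[OF T]
  interpret Q: pair_prob_space M M ..
  have B0: "0 \<le> B" and C0: "0 \<le> C" using B[of undefined] C[of undefined] by linarith+
  have S: "map_prod T T \<in> measurable (M \<Otimes>\<^sub>M M) (M \<Otimes>\<^sub>M M)"
    unfolding map_prod_def by measurable
  have S_distr: "distr (M \<Otimes>\<^sub>M M) (M \<Otimes>\<^sub>M M) (map_prod T T) = M \<Otimes>\<^sub>M M"
    using pair_measure_distr[OF T T] T_distr sigma_finite_measure_axioms by (simp add: map_prod_def)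
  have S_pow: "map_prod T T ^^ k = map_prod (T ^^ k) (T ^^ k)" for k
    by (induction k) (auto simp: fun_eq_iff)
  have prod_int: "(\<integral>z. u (fst z) * u (snd z) \<partial>(M \<Otimes>\<^sub>M M)) = (\<integral>x. u x \<partial>M)\<^sup>2"
    if u: "u \<in> borel_measurable M" "\<And>x. \<bar>u x\<bar> \<le> D" for u :: "'a \<Rightarrow> real" and D
  proof -
    note [measurable] = u(1)
    have D0: "0 \<le> D" using u(2)[of undefined] by linarith
    have "integrable (M \<Otimes>\<^sub>M M) (\<lambda>z. u (fst z) * u (snd z))"
      by (rule Q.P.integrable_const_bound[where B = "D * D"]) (auto simp: abs_mult intro!: mult_mono u(2) D0)
    then have "(\<integral>z. u (fst z) * u (snd z) \<partial>(M \<Otimes>\<^sub>M M)) = (\<integral>x. (\<integral>y. u x * u y \<partial>M) \<partial>M)"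
      by (subst Q.integral_fst'[symmetric]) auto
    then show ?thesis by (simp add: power2_eq_square)
  qed
  have "(\<lambda>n. (\<Sum>k<n. \<integral>z. (\<lambda>z. f (fst z) * f (snd z)) ((map_prod T T ^^ k) z) * (g (fst z) * g (snd z)) \<partial>(M \<Otimes>\<^sub>M M)) / real n)
      \<longlonglongrightarrow> (\<integral>z. f (fst z) * f (snd z) \<partial>(M \<Otimes>\<^sub>M M)) * (\<integral>z. g (fst z) * g (snd z) \<partial>(M \<Otimes>\<^sub>M M))"
  proof (rule Q.P.ergodic_correlations[OF S S_distr, where B = "B * B" and C = "C * C"])
    show "ergodic (M \<Otimes>\<^sub>M M) (map_prod T T)" using wm by (simp add: weakly_mixing_def)
    show "\<bar>f (fst x) * f (snd x)\<bar> \<le> B * B" for x by (auto simp: abs_mult intro!: mult_mono B B0)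
    show "\<bar>g (fst x) * g (snd x)\<bar> \<le> C * C" for x by (auto simp: abs_mult intro!: mult_mono C C0)
  qed auto
  moreover have "(\<integral>z. (\<lambda>z. f (fst z) * f (snd z)) ((map_prod T T ^^ k) z) * (g (fst z) * g (snd z)) \<partial>(M \<Otimes>\<^sub>M M))
      = (\<integral>x. f ((T ^^ k) x) * g x \<partial>M)\<^sup>2" for k
  proof -
    have "(\<integral>z. (f ((T ^^ k) (fst z)) * g (fst z)) * (f ((T ^^ k) (snd z)) * g (snd z)) \<partial>(M \<Otimes>\<^sub>M M))
        = (\<integral>x. f ((T ^^ k) x) * g x \<partial>M)\<^sup>2"
      by (rule prod_int[of "\<lambda>x. f ((T ^^ k) x) * g x" "B * C"]) (auto simp: abs_mult intro!: mult_mono B C B0)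
    then show ?thesis by (simp only: S_pow fst_map_prod snd_map_prod mult_ac)
  qed
  moreover have "(\<integral>z. f (fst z) * f (snd z) \<partial>(M \<Otimes>\<^sub>M M)) = 0"
    using prod_int[OF f B] f0 by simp
  ultimately show "(\<lambda>n. (\<Sum>k<n. (\<integral>x. f ((T ^^ k) x) * g x \<partial>M)\<^sup>2) / real n) \<longlonglongrightarrow> 0"
    by simp
qed

lemma (in prob_space) weakly_mixing_correlations:
  assumes T: "T \<in> measurable M M" and T_distr: "distr M M T = M" and wm: "weakly_mixing M T"
    and f: "bounded_measurable M f" and g: "bounded_measurable M g" and f0: "(\<integral>x. f x \<partial>M) = 0"
  shows "(\<lambda>n. (\<Sum>k<n. cmod (\<integral>x. f ((T ^^ k) x) * g x \<partial>M)) / real n) \<longlonglongrightarrow> 0"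
proof -
  obtain B C where B: "\<And>x. cmod (f x) \<le> B" and C: "\<And>x. cmod (g x) \<le> C"
    using bounded_measurable_bound[OF f] bounded_measurable_bound[OF g] by metis
  note fm [measurable] = bounded_measurable_measurable[OF f]
  note gm [measurable] = bounded_measurable_measurable[OF g]
  note [measurable] = funpow_measurable[OF T]
  have fint: "integrable M f" by (rule integrable_bounded_measurable[OF f])
  define c where "c p q k = \<bar>\<integral>x. p (f ((T ^^ k) x)) * q (g x) \<partial>M\<bar>" for p q :: "complex \<Rightarrow> real" and k
  have lim: "(\<lambda>n. (\<Sum>k<n. c p q k) / real n) \<longlonglongrightarrow> 0" if "p \<in> {Re, Im}" "q \<in> {Re, Im}" for p q
    unfolding c_def
  proof (rule weakly_mixing_correlations_real[OF T T_distr wm, of "\<lambda>x. p (f x)" B "\<lambda>x. q (g x)" C])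
    show "(\<lambda>x. p (f x)) \<in> borel_measurable M" "(\<lambda>x. q (g x)) \<in> borel_measurable M" using that by auto
    show "\<bar>p (f x)\<bar> \<le> B" for x
      using that abs_Re_le_cmod[of "f x"] abs_Im_le_cmod[of "f x"] B[of x] by auto
    show "\<bar>q (g x)\<bar> \<le> C" for x
      using that abs_Re_le_cmod[of "g x"] abs_Im_le_cmod[of "g x"] C[of x] by auto
    show "(\<integral>x. p (f x) \<partial>M) = 0"
      using that f0 integral_Re[OF fint] integral_Im[OF fint] by auto
  qed
  have bound: "cmod (\<integral>x. f ((T ^^ k) x) * g x \<partial>M) \<le> c Re Re k + c Im Im k + c Re Im k + c Im Re k" for k
  proof -
    have fT: "bounded_measurable M (\<lambda>x. f ((T ^^ k) x))"
      by (rule bounded_measurableI[where B = B]) (auto simp: B)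
    have int: "integrable M (\<lambda>x. p (f ((T ^^ k) x)) * q (g x))" if "p \<in> {Re, Im}" "q \<in> {Re, Im}" for p q
    proof (rule integrable_const_bound[where B = "B * C"])
      show "AE x in M. norm (p (f ((T ^^ k) x)) * q (g x)) \<le> B * C"
      proof (rule AE_I2)
        fix x
        have "\<bar>p (f ((T ^^ k) x))\<bar> \<le> B" "\<bar>q (g x)\<bar> \<le> C"
          using that abs_Re_le_cmod[of "g x"] abs_Im_le_cmod[of "g x"] C[of x]
            abs_Re_le_cmod[of "f ((T ^^ k) x)"] abs_Im_le_cmod[of "f ((T ^^ k) x)"] B[of "(T ^^ k) x"] by auto
        then show "norm (p (f ((T ^^ k) x)) * q (g x)) \<le> B * C"
          unfolding real_norm_def abs_mult by (intro mult_mono) auto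
      qed
      show "(\<lambda>x. p (f ((T ^^ k) x)) * q (g x)) \<in> borel_measurable M" using that by auto
    qed
    have fgint: "integrable M (\<lambda>x. f ((T ^^ k) x) * g x)"
      by (intro integrable_bounded_measurable bounded_measurable_mult fT g)
    have "cmod (\<integral>x. f ((T ^^ k) x) * g x \<partial>M)
        \<le> \<bar>\<integral>x. Re (f ((T ^^ k) x) * g x) \<partial>M\<bar> + \<bar>\<integral>x. Im (f ((T ^^ k) x) * g x) \<partial>M\<bar>"
      using cmod_le[of "\<integral>x. f ((T ^^ k) x) * g x \<partial>M"] by (simp only: integral_Re[OF fgint] integral_Im[OF fgint])
    also have "\<bar>\<integral>x. Re (f ((T ^^ k) x) * g x) \<partial>M\<bar> \<le> c Re Re k + c Im Im k"
      using int[of Re Re] int[of Im Im] by (simp add: c_def)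
    also have "\<bar>\<integral>x. Im (f ((T ^^ k) x) * g x) \<partial>M\<bar> \<le> c Re Im k + c Im Re k"
      using int[of Re Im] int[of Im Re] by (simp add: c_def)
    finally show ?thesis by simp
  qed
  have "(\<lambda>n. (\<Sum>k<n. c Re Re k) / real n + (\<Sum>k<n. c Im Im k) / real n + (\<Sum>k<n. c Re Im k) / real n
      + (\<Sum>k<n. c Im Re k) / real n) \<longlonglongrightarrow> 0 + 0 + 0 + 0"
    by (intro tendsto_add lim) auto
  then have sum_lim: "(\<lambda>n. (\<Sum>k<n. c Re Re k) / real n + (\<Sum>k<n. c Im Im k) / real n + (\<Sum>k<n. c Re Im k) / real n
      + (\<Sum>k<n. c Im Re k) / real n) \<longlonglongrightarrow> 0"
    by simp
  show ?thesis
  proof (rule Lim_null_comparison[OF always_eventually sum_lim], rule allI)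
    fix n
    have "(\<Sum>k<n. cmod (\<integral>x. f ((T ^^ k) x) * g x \<partial>M)) \<le> (\<Sum>k<n. c Re Re k + c Im Im k + c Re Im k + c Im Re k)"
      by (intro sum_mono bound)
    then show "norm ((\<Sum>k<n. cmod (\<integral>x. f ((T ^^ k) x) * g x \<partial>M)) / real n)
        \<le> (\<Sum>k<n. c Re Re k) / real n + (\<Sum>k<n. c Im Im k) / real n + (\<Sum>k<n. c Re Im k) / real n
      + (\<Sum>k<n. c Im Re k) / real n"
      unfolding add_divide_distrib[symmetric] sum.distrib[symmetric] by (simp add: divide_right_mono sum_nonneg)
  qed
qed

section \<open>Integer iterates of an invertible transformation\<close>

context
  fixes M :: "'a measure" and T :: "'a \<Rightarrow> 'a"
  assumes T: "invertible_measure_preserving M T"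
begin

lemma inv_T_space: "x \<in> space M \<Longrightarrow> inv_into (space M) T x \<in> space M"
  using T unfolding invertible_measure_preserving_def by (meson bij_betw_inv_into bij_betwE)

lemma T_space: "x \<in> space M \<Longrightarrow> T x \<in> space M"
  using T unfolding invertible_measure_preserving_def by (meson bij_betwE)

lemma T_inv_T: "x \<in> space M \<Longrightarrow> T (inv_into (space M) T x) = x"
  using T unfolding invertible_measure_preserving_def by (meson bij_betw_inv_into_right)

lemma inv_T_T: "x \<in> space M \<Longrightarrow> inv_into (space M) T (T x) = x"
  using T unfolding invertible_measure_preserving_def by (meson bij_betw_inv_into_left)

lemma T_measurable: "T \<in> measurable M M" "inv_into (space M) T \<in> measurable M M"
  using T by (auto simp: invertible_measure_preserving_def)

lemma T_distr: "distr M M T = M"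
  by (rule measure_eqI) (use T in \<open>auto simp: invertible_measure_preserving_def emeasure_distr\<close>)

lemma inv_T_distr: "distr M M (inv_into (space M) T) = M"
proof (rule measure_eqI)
  fix A assume A: "A \<in> sets (distr M M (inv_into (space M) T))"
  let ?S = "inv_into (space M) T"
  have SA: "?S -` A \<inter> space M \<in> sets M" using A T_measurable(2) by (simp add: measurable_sets)
  have "T -` (?S -` A \<inter> space M) \<inter> space M = A"
    using A sets.sets_into_space[of A M] by (auto simp: inv_T_T T_space)
  then have "emeasure M (?S -` A \<inter> space M) = emeasure M A"
    using T SA unfolding invertible_measure_preserving_def by metis
  then show "emeasure (distr M M ?S) A = emeasure M A"
    using A T_measurable(2) by (simp add: emeasure_distr)
qed simp

lemma funpow_space:
  assumes "\<And>x. x \<in> space M \<Longrightarrow> S x \<in> space M" and "x \<in> space M"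
  shows "(S ^^ n) x \<in> space M"
  using assms by (induction n) auto

lemma int_iterate_space: "x \<in> space M \<Longrightarrow> int_iterate M T k x \<in> space M"
  using funpow_space[of T x, OF T_space] funpow_space[of "inv_into (space M) T" x, OF inv_T_space]
  by (simp add: int_iterate_def)

lemma int_iterate_zero: "int_iterate M T 0 x = x"
  by (simp add: int_iterate_def)

lemma int_iterate_of_nat: "int_iterate M T (int n) = T ^^ n"
  by (simp add: int_iterate_def)

lemma int_iterate_plus1:
  assumes "x \<in> space M"
  shows "int_iterate M T (k + 1) x = T (int_iterate M T k x)"
proof (cases "0 \<le> k")
  case True
  then show ?thesis by (simp add: int_iterate_def nat_add_distrib)
next
  case False
  define p where "p = nat (- k - 1)"
  have k: "k = - int p - 1" using False by (simp add: p_def)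
  have "(inv_into (space M) T ^^ p) x \<in> space M" using funpow_space inv_T_space assms by blast
  then have "T (int_iterate M T k x) = (inv_into (space M) T ^^ p) x"
    by (simp add: int_iterate_def k nat_add_distrib T_inv_T)
  \<comment> \<open>For \<open>p = 0\<close> the exponent reaches 0, where the definition switches
    from powers of the inverse to powers of \<open>T\<close>.\<close>
  also have "\<dots> = int_iterate M T (k + 1) x"
    by (cases "p = 0") (simp_all add: int_iterate_def k)
  finally show ?thesis by simp
qed

lemma int_iterate_minus1:
  assumes "x \<in> space M"
  shows "int_iterate M T (k - 1) x = inv_into (space M) T (int_iterate M T k x)"
  using int_iterate_plus1[OF assms, of "k - 1"] inv_T_T int_iterate_space[OF assms] by simp

lemma int_iterate_add:
  assumes "x \<in> space M"
  shows "int_iterate M T (a + b) x = int_iterate M T a (int_iterate M T b x)"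
proof (induction a rule: int_induct[of _ 0])
  case base
  show ?case by (simp add: int_iterate_zero)
next
  case (step1 i)
  then show ?case
    using int_iterate_plus1[OF assms, of "i + b"] int_iterate_plus1[OF int_iterate_space[OF assms], of i b]
    by (simp add: algebra_simps)
next
  case (step2 i)
  then show ?case
    using int_iterate_minus1[OF assms, of "i + b"] int_iterate_minus1[OF int_iterate_space[OF assms], of i b]
    by (simp add: algebra_simps)
qed

lemma funpow_preserving:
  assumes S: "S \<in> measurable M M" "distr M M S = M"
  shows "S ^^ n \<in> measurable M M \<and> distr M M (S ^^ n) = M"
proof (induction n)
  case 0
  have "distr M M id = M" using distr_id[of M] by (simp add: id_def)
  then show ?case by simp
next
  case (Suc n)
  have "distr (distr M M (S ^^ n)) M S = distr M M (S \<circ> S ^^ n)"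
    using Suc S by (intro distr_distr) auto
  moreover have "S \<circ> S ^^ n \<in> measurable M M" using Suc S by (intro measurable_comp) auto
  ultimately show ?case using Suc S by (simp add: comp_def)
qed

lemma int_iterate_preserving:
  "int_iterate M T k \<in> measurable M M" "distr M M (int_iterate M T k) = M"
  using funpow_preserving[OF T_measurable(1) T_distr] funpow_preserving[OF T_measurable(2) inv_T_distr]
  by (auto simp: int_iterate_def)

lemma int_iterate_commute_map:
  assumes S: "\<And>x. x \<in> space M \<Longrightarrow> S x \<in> space M"
    and comm: "\<And>x. x \<in> space M \<Longrightarrow> S (T x) = T (S x)" and x: "x \<in> space M"
  shows "S (int_iterate M T k x) = int_iterate M T k (S x)"
proof (induction k rule: int_induct[of _ 0])
  case base
  show ?case by (simp add: int_iterate_zero)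
next
  case (step1 i)
  then show ?case
    by (simp add: int_iterate_plus1 x S comm int_iterate_space)
next
  case (step2 i)
  define y where "y = int_iterate M T i x"
  have y: "y \<in> space M" by (simp add: y_def int_iterate_space x)
  \<comment> \<open>Commutation passes to the inverse: apply \<open>T\<close> and cancel.\<close>
  have "T (S (inv_into (space M) T y)) = S y"
    using comm[OF inv_T_space[OF y]] by (simp add: T_inv_T y)
  then have "S (inv_into (space M) T y) = inv_into (space M) T (S y)"
    using inv_T_T[OF S[OF inv_T_space[OF y]]] by simp
  then show ?case using step2 by (simp add: int_iterate_minus1 x S y_def)
qed

end

lemma int_iterate_commute:
  assumes S: "invertible_measure_preserving M S" and T: "invertible_measure_preserving M T"
    and comm: "\<And>x. x \<in> space M \<Longrightarrow> S (T x) = T (S x)" and x: "x \<in> space M"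
  shows "int_iterate M S a (int_iterate M T b x) = int_iterate M T b (int_iterate M S a x)"
proof (rule int_iterate_commute_map[OF T int_iterate_space[OF S] _ x])
  fix y assume "y \<in> space M"
  then show "int_iterate M S a (T y) = T (int_iterate M S a y)"
    using int_iterate_commute_map[OF S, of T y a] T_space[OF T] comm by simp
qed

text \<open>The maps commute on \<open>space M\<close> only, so their composition is taken along a
  list, in a fixed order.\<close>

definition iterate_list :: "'a measure \<Rightarrow> (nat \<Rightarrow> 'a \<Rightarrow> 'a) \<Rightarrow> nat list \<Rightarrow> (nat \<Rightarrow> int) \<Rightarrow> 'a \<Rightarrow> 'a"
  where "iterate_list M T is m = foldr (\<lambda>i. (\<circ>) (int_iterate M (T i) (m i))) is id"

lemma iterate_list_simps [simp]:
  "iterate_list M T [] m = id"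
  "iterate_list M T (i # is) m = int_iterate M (T i) (m i) \<circ> iterate_list M T is m"
  by (simp_all add: iterate_list_def)

lemma iterate_list_cong:
  "(\<And>i. i \<in> set is \<Longrightarrow> m i = m' i) \<Longrightarrow> iterate_list M T is m = iterate_list M T is m'"
  by (induction "is") auto

context

  \<comment> \<open>The action of integer vectors given by the iterates\<close>
  fixes M :: "'a measure" and l :: nat and T :: "nat \<Rightarrow> 'a \<Rightarrow> 'a"
  assumes sys: "weakly_mixing_system M l T"
begin

lemma system_invertible: "i \<in> {1..l} \<Longrightarrow> invertible_measure_preserving M (T i)"
  using sys by (simp add: weakly_mixing_system_def measure_preserving_system_def)

lemma iterate_list_preserving:
  assumes "set is \<subseteq> {1..l}"
  shows "iterate_list M T is m \<in> measurable M M \<and> distr M M (iterate_list M T is m) = M"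
  using assms
proof (induction "is")
  case Nil
  have "distr M M id = M" using distr_id[of M] by (simp add: id_def)
  then show ?case by simp
next
  case (Cons i "is")
  let ?S = "int_iterate M (T i) (m i)" and ?F = "iterate_list M T is m"
  have S: "?S \<in> measurable M M" "distr M M ?S = M"
    using Cons.prems int_iterate_preserving[OF system_invertible] by auto
  have F: "?F \<in> measurable M M" "distr M M ?F = M" using Cons by auto
  have "distr (distr M M ?F) M ?S = distr M M (?S \<circ> ?F)"
    using S F by (intro distr_distr) auto
  moreover have "?S \<circ> ?F \<in> measurable M M" by (rule measurable_comp[OF F(1) S(1)])
  ultimately show ?case using S F by (simp add: comp_def)
qed

lemma iterate_list_space: "set is \<subseteq> {1..l} \<Longrightarrow> x \<in> space M \<Longrightarrow> iterate_list M T is m x \<in> space M"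
  using measurable_space[OF conjunct1[OF iterate_list_preserving[of "is" m]]] .

lemma iterate_list_commute:
  assumes "set is \<subseteq> {1..l}" "i \<in> {1..l}" "x \<in> space M"
  shows "iterate_list M T is m (int_iterate M (T i) k x) = int_iterate M (T i) k (iterate_list M T is m x)"
  using assms
proof (induction "is")
  case (Cons j "is")
  have "T j (T i x) = T i (T j x)" if "x \<in> space M" for x
    using sys Cons.prems that by (simp add: weakly_mixing_system_def measure_preserving_system_def)
  then have "int_iterate M (T j) (m j) (int_iterate M (T i) k (iterate_list M T is m x))
      = int_iterate M (T i) k (int_iterate M (T j) (m j) (iterate_list M T is m x))"
    using Cons.prems by (intro int_iterate_commute system_invertible iterate_list_space) auto
  then show ?case using Cons by simp
qed simp

lemma iterate_list_add:
  assumes "set is \<subseteq> {1..l}" "x \<in> space M"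
  shows "iterate_list M T is (\<lambda>i. m i + m' i) x = iterate_list M T is m (iterate_list M T is m' x)"
  using assms
proof (induction "is")
  case (Cons i "is")
  have i: "i \<in> {1..l}" "set is \<subseteq> {1..l}" using Cons.prems by auto
  let ?y = "iterate_list M T is m' x"
  have y: "?y \<in> space M" using Cons.prems i by (intro iterate_list_space) auto
  have "iterate_list M T (i # is) (\<lambda>i. m i + m' i) x = int_iterate M (T i) (m i + m' i) (iterate_list M T is m ?y)"
    using Cons by simp
  also have "\<dots> = int_iterate M (T i) (m i) (int_iterate M (T i) (m' i) (iterate_list M T is m ?y))"
    by (intro int_iterate_add system_invertible i iterate_list_space y)
  also have "int_iterate M (T i) (m' i) (iterate_list M T is m ?y) = iterate_list M T is m (int_iterate M (T i) (m' i) ?y)"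
    by (intro iterate_list_commute[symmetric] i y)
  finally show ?case by simp
qed simp

lemma iterate_list_unit_multiple_notin:
  "i \<notin> set is \<Longrightarrow> iterate_list M T is (unit_multiple i k) x = x"
  by (induction "is") (auto simp: unit_multiple_def int_iterate_def)

lemma iterate_list_unit_multiple:
  "distinct is \<Longrightarrow> i \<in> set is \<Longrightarrow> iterate_list M T is (unit_multiple i k) x = int_iterate M (T i) k x"
proof (induction "is")
  case (Cons j "is")
  then show ?case
    by (cases "i = j") (auto simp: iterate_list_unit_multiple_notin, simp_all add: unit_multiple_def int_iterate_def)
qed simp

lemma weakly_mixing_action_iterate_list:
  "weakly_mixing_action M {1..l} (iterate_list M T [1..<Suc l])"
proof -
  interpret prob_space M using sys by (simp add: weakly_mixing_system_def measure_preserving_system_def)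
  have set: "set [1..<Suc l] = {1..l}" by auto
  show ?thesis
  proof
    fix m m' :: "nat \<Rightarrow> int" and x
    show "iterate_list M T [1..<Suc l] m \<in> measurable M M" "distr M M (iterate_list M T [1..<Suc l] m) = M"
      using iterate_list_preserving[of "[1..<Suc l]" m] set by auto
    show "iterate_list M T [1..<Suc l] (\<lambda>i. m i + m' i) x
        = iterate_list M T [1..<Suc l] m (iterate_list M T [1..<Suc l] m' x)" if "x \<in> space M"
      using that set by (intro iterate_list_add) auto
    \<comment> \<open>The zero vector is written as a multiple of the unit vector at index 0, which
      is not in the list.\<close>
    show "iterate_list M T [1..<Suc l] (\<lambda>_. 0) x = x"
      using iterate_list_unit_multiple_notin[of 0 "[1..<Suc l]" 0 x] by (simp add: unit_multiple_def del: upt_Suc)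
    show "iterate_list M T [1..<Suc l] m = iterate_list M T [1..<Suc l] m'" if "\<And>i. i \<in> {1..l} \<Longrightarrow> m i = m' i"
      using that set by (intro iterate_list_cong) auto
  next
    fix i and f g :: "'a \<Rightarrow> complex"
    assume i: "i \<in> {1..l}" and f: "bounded_measurable M f" and g: "bounded_measurable M g"
      and f0: "expectation f = 0"
    have "iterate_list M T [1..<Suc l] (unit_multiple i (int n)) = T i ^^ n" for n
      using iterate_list_unit_multiple[of "[1..<Suc l]" i "int n"] i set
      by (auto simp: fun_eq_iff int_iterate_of_nat[OF system_invertible[OF i]] simp del: upt_Suc)
    moreover have "weakly_mixing M (T i)" using sys i by (simp add: weakly_mixing_system_def)
    ultimately show "(\<lambda>N. (\<Sum>n<N. cmod (\<integral>x. f (iterate_list M T [1..<Suc l] (unit_multiple i (int n)) x) * g x \<partial>M)) / real N) \<longlonglongrightarrow> 0"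
      using weakly_mixing_correlations[OF T_measurable(1)[OF system_invertible[OF i]] T_distr[OF system_invertible[OF i]] _ f g f0]
      by (simp del: upt_Suc)
  qed auto
qed

end

section \<open>Change of time scale\<close>

context prob_space
begin

lemma mean_null_cong:
  assumes "\<And>n x. x \<in> space M \<Longrightarrow> u n x = v n x"
  shows "mean_null W u \<longleftrightarrow> mean_null W v"
proof -
  have "(\<integral>x. (cmod (wmean W (\<lambda>n. c n * u n x) N))\<^sup>2 \<partial>M) = (\<integral>x. (cmod (wmean W (\<lambda>n. c n * v n x) N))\<^sup>2 \<partial>M)" for c N
    by (intro Bochner_Integration.integral_cong refl) (simp add: assms)
  then show ?thesis by (simp add: mean_null_def)
qed

text \<open>Group the sum by the value of \<kappa>. The coefficients over one fibre add up to at
  most \<open>C * W k\<close> in modulus, and division by this number gives coefficients that are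
  again admissible for the weighted mean. Fibre sizes thus need only an upper bound, and the total
  weight is comparable with \<open>N\<close> by \<open>D\<close>.\<close>

lemma mean_null_fibres:
  assumes pos: "\<And>k. 0 < W k" and null: "mean_null W y" and y: "\<And>k. bounded_measurable M (y k)"
    and C: "0 < C" "\<And>N k. real (card {n \<in> {..<N}. \<kappa> n = k}) \<le> C * W k"
    and K: "\<And>N n. n < N \<Longrightarrow> \<kappa> n < K N" "filterlim K at_top sequentially"
    and D: "\<forall>\<^sub>F N in sequentially. (\<Sum>k<K N. W k) \<le> D * real N"
  shows "mean_null (\<lambda>_. 1) (\<lambda>n. y (\<kappa> n))"
  unfolding mean_null_def
proof (intro allI impI)
  fix \<epsilon> :: real assume "0 < \<epsilon>"
  define Q where "Q = (C * \<bar>D\<bar>)\<^sup>2 + 1"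
  have Q: "0 < Q" by (simp add: Q_def add_nonneg_pos)
  have "\<forall>\<^sub>F N in sequentially. \<forall>c. (\<forall>n. cmod (c n) \<le> 1) \<longrightarrow>
      (\<integral>x. (cmod (wmean W (\<lambda>k. c k * y k x) N))\<^sup>2 \<partial>M) \<le> \<epsilon> / Q"
    using null \<open>0 < \<epsilon>\<close> Q by (simp add: mean_null_def)
  then have "\<forall>\<^sub>F N in sequentially. \<forall>c. (\<forall>n. cmod (c n) \<le> 1) \<longrightarrow>
      (\<integral>x. (cmod (wmean W (\<lambda>k. c k * y k x) (K N)))\<^sup>2 \<partial>M) \<le> \<epsilon> / Q"
    using K(2) by (rule eventually_compose_filterlim)
  then show "\<forall>\<^sub>F N in sequentially. \<forall>c. (\<forall>n. cmod (c n) \<le> 1) \<longrightarrow>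
      (\<integral>x. (cmod (wmean (\<lambda>_. 1) (\<lambda>n. c n * y (\<kappa> n) x) N))\<^sup>2 \<partial>M) \<le> \<epsilon>"
    using D eventually_gt_at_top[of 0]
  proof (eventually_elim, intro allI impI)
    fix N and c :: "nat \<Rightarrow> complex"
    assume *: "\<forall>c. (\<forall>n. cmod (c n) \<le> 1) \<longrightarrow>
      (\<integral>x. (cmod (wmean W (\<lambda>k. c k * y k x) (K N)))\<^sup>2 \<partial>M) \<le> \<epsilon> / Q"
    and DN: "(\<Sum>k<K N. W k) \<le> D * real N" and N: "0 < N" and c: "\<forall>n. cmod (c n) \<le> 1"
    define r where "r k = (\<Sum>n\<in>{n \<in> {..<N}. \<kappa> n = k}. c n)" for k
    define c' where "c' k = r k / of_real (C * W k)" for k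
    define q where "q = C * (\<Sum>k<K N. W k) / real N"
    have CW: "0 < C * W k" for k using C pos by simp
    have "cmod (r k) \<le> C * W k" for k
    proof -
      have "cmod (r k) \<le> (\<Sum>n\<in>{n \<in> {..<N}. \<kappa> n = k}. 1)"
        unfolding r_def using c by (intro order_trans[OF norm_sum] sum_mono) auto
      then show ?thesis using C(2)[of N k] by simp
    qed
    then have c': "\<forall>k. cmod (c' k) \<le> 1"
      using CW by (auto simp: c'_def norm_divide abs_of_pos field_simps simp del: of_real_mult)
    have S: "0 < (\<Sum>k<K N. W k)"
      using K(1)[OF N] by (intro sum_weight_pos pos) linarith
    have S_nz: "(\<Sum>k<K N. complex_of_real (W k)) \<noteq> 0"
      using S by (metis less_irrefl of_real_eq_0_iff of_real_sum)
    have eq: "wmean (\<lambda>_. 1) (\<lambda>n. c n * y (\<kappa> n) x) N = of_real q * wmean W (\<lambda>k. c' k * y k x) (K N)" for x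
    proof -
      have "(\<Sum>n<N. c n * y (\<kappa> n) x) = (\<Sum>k<K N. \<Sum>n\<in>{n \<in> {..<N}. \<kappa> n = k}. c n * y (\<kappa> n) x)"
        by (rule sum.group[symmetric]) (use K(1) in auto)
      also have "\<dots> = (\<Sum>k<K N. r k * y k x)"
        unfolding r_def sum_distrib_right by (intro sum.cong refl) auto
      also have "\<dots> = (\<Sum>k<K N. of_real C * (W k *\<^sub>R (c' k * y k x)))"
      proof (intro sum.cong refl)
        fix k
        have "of_real C * of_real (W k) * c' k = r k" using CW[of k] C(1) pos[of k] by (simp add: c'_def)
        then show "r k * y k x = of_real C * (W k *\<^sub>R (c' k * y k x))"
          by (metis (no_types, lifting) mult.assoc scaleR_conv_of_real)
      qed
      finally have "wmean (\<lambda>_. 1) (\<lambda>n. c n * y (\<kappa> n) x) N = of_real C * (\<Sum>k<K N. W k *\<^sub>R (c' k * y k x)) / of_nat N"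
        by (simp add: wmean_def sum_distrib_left scaleR_conv_of_real divide_inverse_commute)
      also have "\<dots> = of_real q * wmean W (\<lambda>k. c' k * y k x) (K N)"
        using S_nz by (simp add: wmean_def q_def scaleR_conv_of_real divide_inverse mult_ac)
      finally show ?thesis .
    qed
    have "q \<le> C * D"
      using DN N C(1) by (simp add: q_def divide_le_eq mult.assoc)
    moreover have "0 \<le> q" using S C(1) by (simp add: q_def)
    ultimately have "q\<^sup>2 \<le> (C * \<bar>D\<bar>)\<^sup>2"
      using C(1) by (intro power_mono) (auto intro: order_trans[OF _ mult_left_mono])
    then have qQ: "q\<^sup>2 \<le> Q" by (simp add: Q_def)
    have "(\<integral>x. (cmod (wmean (\<lambda>_. 1) (\<lambda>n. c n * y (\<kappa> n) x) N))\<^sup>2 \<partial>M)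
        = q\<^sup>2 * (\<integral>x. (cmod (wmean W (\<lambda>k. c' k * y k x) (K N)))\<^sup>2 \<partial>M)"
      unfolding eq norm_mult power_mult_distrib by simp
    also have "\<dots> \<le> Q * (\<epsilon> / Q)"
      using * c' qQ Q by (intro mult_mono) auto
    finally show "(\<integral>x. (cmod (wmean (\<lambda>_. 1) (\<lambda>n. c n * y (\<kappa> n) x) N))\<^sup>2 \<partial>M) \<le> \<epsilon>"
      using Q by simp
  qed
qed

text \<open>Change of time scale: \<open>\<psi>\<close> is an inverse of \<open>\<phi>\<close>, and in the time \<open>k = \<phi> n\<close> a function whose derivative
  is asymptotic to \<open>b \<theta> = b \<phi>'\<close> becomes linear with slope \<open>b\<close>.\<close>

definition time_change :: "real \<Rightarrow> (real \<Rightarrow> real) \<Rightarrow> (nat \<Rightarrow> real) \<Rightarrow> (nat \<Rightarrow> real) \<Rightarrow> (nat \<Rightarrow> nat) \<Rightarrow> bool"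
  where "time_change x0 \<phi> W \<psi> \<kappa> \<longleftrightarrow> admissible_weight W \<and> (\<forall>k. x0 \<le> \<psi> k) \<and> (\<forall>k. \<phi> (\<psi> k) = \<phi> x0 + real k) \<and>
    filterlim \<psi> at_top sequentially \<and>
    (\<forall>n. x0 \<le> real n \<longrightarrow> \<phi> (\<psi> (\<kappa> n)) \<le> \<phi> (real n) \<and> \<phi> (real n) < \<phi> (\<psi> (\<kappa> n)) + 1) \<and>
    (\<forall>n. x0 \<le> real n \<longrightarrow> \<psi> (\<kappa> n) \<le> real n) \<and> filterlim \<kappa> at_top sequentially \<and>
    (\<forall>y. (\<forall>k. bounded_measurable M (y k)) \<longrightarrow> mean_null W y \<longrightarrow> mean_null (\<lambda>_. 1) (\<lambda>n. y (\<kappa> n)))"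

text \<open>With \<open>W\<close> the gaps of the inverse \<psi>, the mean value theorem gives
  \<open>W k = 1 / \<theta> (\<xi> k)\<close> for a point of the \<open>k\<close>-th gap, so a
  decreasing \<theta> makes \<open>W\<close> increasing. The sum of the weights up to
  \<open>K\<close> is \<open>\<psi> (Suc K) - x0\<close>, and the quotient of the last weight by it
  is essentially at most \<open>1 / (x * \<theta> x)\<close> at
  \<open>x = \<psi> (Suc K)\<close>.\<close>

lemma time_change_exists:
  fixes \<theta> \<phi> :: "real \<Rightarrow> real"
  assumes x0: "0 \<le> x0"
    and deriv: "\<And>x. x0 \<le> x \<Longrightarrow> (\<phi> has_real_derivative \<theta> x) (at x)"
    and pos: "\<And>x. x0 \<le> x \<Longrightarrow> 0 < \<theta> x"
    and anti: "\<And>x y. x0 \<le> x \<Longrightarrow> x \<le> y \<Longrightarrow> \<theta> y \<le> \<theta> x"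
    and top: "filterlim (\<lambda>x. x * \<theta> x) at_top at_top"
    and \<phi>_top: "filterlim \<phi> at_top at_top"
  shows "\<exists>W \<psi> \<kappa>. time_change x0 \<phi> W \<psi> \<kappa>"
proof -
  have less: "\<phi> x < \<phi> y" if "x0 \<le> x" "x < y" for x y
    using that by (intro DERIV_pos_imp_increasing[of x y \<phi>]) (meson deriv pos order_trans)+
  have less_iff: "\<phi> x < \<phi> y \<longleftrightarrow> x < y" if "x0 \<le> x" "x0 \<le> y" for x y
    using less[of x y] less[of y x] that by (metis linorder_less_linear order_less_imp_not_less)
  have cont: "isCont \<phi> x" if "x0 \<le> x" for x using deriv[OF that] by (rule DERIV_isCont)
  have "\<exists>x\<ge>x0. \<phi> x = \<phi> x0 + real k" for k
  proof -
    have "\<forall>\<^sub>F x in at_top. \<phi> x0 + real k \<le> \<phi> x \<and> x0 \<le> x"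
      using \<phi>_top eventually_ge_at_top[of x0] unfolding filterlim_at_top by (auto intro: eventually_conj)
    then obtain y where y: "\<phi> x0 + real k \<le> \<phi> y" "x0 \<le> y"
      by (auto simp: eventually_at_top_linorder)
    then show ?thesis using IVT[of \<phi> x0 "\<phi> x0 + real k" y] cont by auto
  qed
  then obtain \<psi> where \<psi>: "\<And>k. x0 \<le> \<psi> k" "\<And>k. \<phi> (\<psi> k) = \<phi> x0 + real k" by metis
  have \<psi>_less: "\<psi> k < \<psi> (Suc k)" for k
    using less_iff[OF \<psi>(1)[of k] \<psi>(1)[of "Suc k"]] \<psi>(2) by simp
  have \<psi>_mono: "\<psi> k \<le> \<psi> k'" if "k \<le> k'" for k k'
    by (rule lift_Suc_mono_le[of \<psi>, OF less_imp_le[OF \<psi>_less] that])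
  define W where "W k = \<psi> (Suc k) - \<psi> k" for k
  have W_pos: "0 < W k" for k using \<psi>_less[of k] by (simp add: W_def)
  have "\<exists>\<xi>. \<psi> k < \<xi> \<and> \<xi> < \<psi> (Suc k) \<and> W k * \<theta> \<xi> = 1" for k
  proof -
    have "\<exists>z>\<psi> k. z < \<psi> (Suc k) \<and> \<phi> (\<psi> (Suc k)) - \<phi> (\<psi> k) = (\<psi> (Suc k) - \<psi> k) * \<theta> z"
      by (intro MVT2 \<psi>_less deriv) (use \<psi>(1)[of k] in auto)
    then show ?thesis using \<psi>(2)[of k] \<psi>(2)[of "Suc k"] by (auto simp: W_def)
  qed
  then obtain \<xi> where \<xi>: "\<And>k. \<psi> k < \<xi> k" "\<And>k. \<xi> k < \<psi> (Suc k)" "\<And>k. W k * \<theta> (\<xi> k) = 1" by metis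
  have \<xi>_x0: "x0 \<le> \<xi> k" for k using \<xi>(1)[of k] \<psi>(1)[of k] by linarith
  have W_eq: "W k = 1 / \<theta> (\<xi> k)" for k
    using \<xi>(3)[of k] pos[OF \<xi>_x0[of k]] by (simp add: field_simps)
  have W_mono: "mono W"
  proof (rule monoI, rule lift_Suc_mono_le[of W])
    fix k
    have "\<theta> (\<xi> (Suc k)) \<le> \<theta> (\<xi> k)"
      using \<xi>(2)[of k] \<xi>(1)[of "Suc k"] by (intro anti \<xi>_x0) linarith
    then show "W k \<le> W (Suc k)"
      unfolding W_eq using pos[OF \<xi>_x0] by (intro divide_left_mono) auto
  qed
  have S_eq: "(\<Sum>k<K. W k) = \<psi> K - \<psi> 0" for K
    by (induction K) (simp_all add: W_def)
  have \<psi>0: "\<psi> 0 = x0" using \<psi>[of 0] less_iff[of x0 "\<psi> 0"] by force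
  have \<psi>_lower: "real k * W 0 \<le> \<psi> k" for k
  proof -
    have "(\<Sum>i<k. W 0) \<le> (\<Sum>i<k. W i)" using W_mono by (intro sum_mono) (auto simp: mono_def)
    then show ?thesis using S_eq[of k] \<psi>0 x0 by simp
  qed
  have \<psi>_top: "filterlim \<psi> at_top sequentially"
  proof (rule filterlim_at_top_mono)
    show "filterlim (\<lambda>k. real k * W 0) at_top sequentially"
      using W_pos[of 0] by (intro filterlim_at_top_mult_tendsto_pos[OF tendsto_const] filterlim_real_sequentially)
  qed (simp add: \<psi>_lower)
  have W_adm: "admissible_weight W"
    unfolding admissible_weight_def
  proof (intro conjI allI W_pos W_mono)
    have lim1: "(\<lambda>K. 1 / (\<psi> (Suc K) * \<theta> (\<psi> (Suc K)))) \<longlonglongrightarrow> 0"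
      by (intro real_tendsto_divide_at_top[OF tendsto_const] filterlim_compose[OF top] filterlim_compose[OF \<psi>_top filterlim_Suc])
    have "(\<lambda>K. 1 - x0 / \<psi> (Suc K)) \<longlonglongrightarrow> 1 - 0"
      by (intro tendsto_diff tendsto_const real_tendsto_divide_at_top[OF tendsto_const] filterlim_compose[OF \<psi>_top filterlim_Suc])
    then have "(\<lambda>K. 1 / (\<psi> (Suc K) * \<theta> (\<psi> (Suc K))) / (1 - x0 / \<psi> (Suc K))) \<longlonglongrightarrow> 0 / (1 - 0)"
      by (intro tendsto_divide lim1) auto
    then have lim2: "(\<lambda>K. 1 / (\<psi> (Suc K) * \<theta> (\<psi> (Suc K))) / (1 - x0 / \<psi> (Suc K))) \<longlonglongrightarrow> 0" by simp
    show "(\<lambda>K. W K / (\<Sum>k<Suc K. W k)) \<longlonglongrightarrow> 0"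
    proof (rule Lim_null_comparison[OF always_eventually lim2], rule allI)
      fix K
      have y: "x0 < \<psi> (Suc K)" using \<psi>_less[of K] \<psi>(1)[of K] by linarith
      have "\<theta> (\<psi> (Suc K)) \<le> \<theta> (\<xi> K)" using \<xi>(2)[of K] by (intro anti \<xi>_x0) linarith
      then have "W K \<le> 1 / \<theta> (\<psi> (Suc K))"
        unfolding W_eq using pos[OF \<xi>_x0] pos[OF \<psi>(1)] by (intro divide_left_mono) auto
      then have "W K / (\<psi> (Suc K) - x0) \<le> 1 / \<theta> (\<psi> (Suc K)) / (\<psi> (Suc K) - x0)"
        using y by (intro divide_right_mono) auto
      also have "\<dots> = 1 / (\<psi> (Suc K) * \<theta> (\<psi> (Suc K))) / (1 - x0 / \<psi> (Suc K))"
      proof -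
        have "\<psi> (Suc K) - x0 = \<psi> (Suc K) * (1 - x0 / \<psi> (Suc K))" using y x0 by (simp add: field_simps)
        then show ?thesis by (simp add: mult_ac)
      qed
      finally show "norm (W K / (\<Sum>k<Suc K. W k)) \<le> 1 / (\<psi> (Suc K) * \<theta> (\<psi> (Suc K))) / (1 - x0 / \<psi> (Suc K))"
        unfolding S_eq \<psi>0 using W_pos[of K] y by simp
    qed
  qed
  \<comment> \<open>Indices below \<open>x0\<close> are sent to 0 and enlarge only the fibre of 0,
    by at most the number \<open>n0\<close> below.\<close>
  define \<kappa> where "\<kappa> n = (if x0 \<le> real n then nat \<lfloor>\<phi> (real n) - \<phi> x0\<rfloor> else 0)" for n
  have \<kappa>: "\<phi> (\<psi> (\<kappa> n)) \<le> \<phi> (real n) \<and> \<phi> (real n) < \<phi> (\<psi> (\<kappa> n)) + 1" if n: "x0 \<le> real n" for n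
  proof -
    have "0 \<le> \<phi> (real n) - \<phi> x0" using n less[of x0 "real n"] by (cases "x0 = real n") auto
    then have "real (\<kappa> n) = of_int \<lfloor>\<phi> (real n) - \<phi> x0\<rfloor>" using n by (simp add: \<kappa>_def)
    then show ?thesis unfolding \<psi>(2) by linarith
  qed
  have \<kappa>_le: "\<psi> (\<kappa> n) \<le> real n" if "x0 \<le> real n" for n
    using \<kappa>[OF that] less_iff[OF that \<psi>(1)] by (meson not_less)
  have \<kappa>_less: "real n < \<psi> (Suc (\<kappa> n))" if "x0 \<le> real n" for n
    using \<kappa>[OF that] less_iff[OF that \<psi>(1)[of "Suc (\<kappa> n)"]] \<psi>(2) by (simp add: algebra_simps)
  have \<kappa>_mono: "\<kappa> n \<le> \<kappa> n'" if "n \<le> n'" for n n'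
  proof (cases "x0 \<le> real n")
    case True
    then have "\<phi> (real n) \<le> \<phi> (real n')" using that less[of "real n" "real n'"] by (cases "n = n'") auto
    then show ?thesis using True that by (simp add: \<kappa>_def nat_mono floor_mono)
  qed (simp add: \<kappa>_def)
  have \<kappa>_top: "filterlim \<kappa> at_top sequentially"
    unfolding filterlim_at_top
  proof
    fix Z
    have "\<psi> Z \<le> real n \<Longrightarrow> Z \<le> \<kappa> n" for n
    proof -
      assume n: "\<psi> Z \<le> real n"
      then have "x0 \<le> real n" using \<psi>(1)[of Z] by linarith
      from \<kappa>_less[OF this] n have "\<psi> Z < \<psi> (Suc (\<kappa> n))" by linarith
      then have "Z < Suc (\<kappa> n)" using \<psi>_mono[of "Suc (\<kappa> n)" Z] by (meson not_le)
      then show "Z \<le> \<kappa> n" by simp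
    qed
    moreover have "\<forall>\<^sub>F n in sequentially. \<psi> Z \<le> real n"
      using filterlim_real_sequentially by (simp add: filterlim_at_top)
    ultimately show "\<forall>\<^sub>F n in sequentially. Z \<le> \<kappa> n" by (auto elim: eventually_mono)
  qed
  define n0 where "n0 = nat \<lceil>x0\<rceil>"
  \<comment> \<open>A fibre has at most \<open>n0 + W k + 1\<close> elements, and
    \<open>W 0 \<le> W k\<close> turns the constants into a multiple of \<open>W k\<close>.\<close>
  define C where "C = 1 + (1 + real n0) / W 0"
  have card_le: "real (card {n \<in> {..<N}. \<kappa> n = k}) \<le> C * W k" for N k
  proof -
    have "{n \<in> {..<N}. \<kappa> n = k} \<subseteq> {..<n0} \<union> {nat \<lceil>\<psi> k\<rceil>..<nat \<lceil>\<psi> (Suc k)\<rceil>}"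
    proof
      fix n assume n: "n \<in> {n \<in> {..<N}. \<kappa> n = k}"
      show "n \<in> {..<n0} \<union> {nat \<lceil>\<psi> k\<rceil>..<nat \<lceil>\<psi> (Suc k)\<rceil>}"
      proof (cases "x0 \<le> real n")
        case True
        then have "\<psi> k \<le> real n" "real n < \<psi> (Suc k)" using \<kappa>_le[OF True] \<kappa>_less[OF True] n by auto
        then show ?thesis by simp linarith
      next
        case False
        then show ?thesis by (simp add: n0_def) linarith
      qed
    qed
    then have "card {n \<in> {..<N}. \<kappa> n = k} \<le> card ({..<n0} \<union> {nat \<lceil>\<psi> k\<rceil>..<nat \<lceil>\<psi> (Suc k)\<rceil>})"
      by (intro card_mono) auto
    also have "\<dots> \<le> n0 + (nat \<lceil>\<psi> (Suc k)\<rceil> - nat \<lceil>\<psi> k\<rceil>)"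
      by (rule order_trans[OF card_Un_le]) simp
    finally have "real (card {n \<in> {..<N}. \<kappa> n = k}) \<le> real n0 + real (nat \<lceil>\<psi> (Suc k)\<rceil> - nat \<lceil>\<psi> k\<rceil>)"
      by linarith
    also have "real (nat \<lceil>\<psi> (Suc k)\<rceil> - nat \<lceil>\<psi> k\<rceil>) \<le> W k + 1"
      using \<psi>_less[of k] \<psi>(1)[of k] x0 unfolding W_def by linarith
    also have "real n0 + (W k + 1) \<le> W k + (1 + real n0) * (W k / W 0)"
    proof -
      have "1 \<le> W k / W 0" using W_pos[of 0] W_mono by (simp add: mono_def)
      then have "(1 + real n0) * 1 \<le> (1 + real n0) * (W k / W 0)" by (intro mult_left_mono) auto
      then show ?thesis by simp
    qed
    also have "\<dots> = C * W k" by (simp add: C_def algebra_simps)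
    finally show ?thesis by simp
  qed
  have transfer: "mean_null (\<lambda>_. 1) (\<lambda>n. y (\<kappa> n))" if y: "\<And>k. bounded_measurable M (y k)" and null: "mean_null W y" for y
  proof (rule mean_null_fibres[where K = "\<lambda>N. Suc (\<kappa> N)" and D = 2, OF W_pos null y _ card_le])
    show "0 < C" using W_pos[of 0] by (auto simp: C_def intro!: add_pos_nonneg)
    show "\<kappa> n < Suc (\<kappa> N)" if "n < N" for N n using \<kappa>_mono[of n N] that by simp
    show "filterlim (\<lambda>N. Suc (\<kappa> N)) at_top sequentially" by (rule filterlim_compose[OF filterlim_Suc \<kappa>_top])
    \<comment> \<open>Once the last weight is less than half of the total, the total is at most
      twice the sum without it, which is \<open>\<psi> (\<kappa> N) - x0\<close> and hence at most
      \<open>N\<close>.\<close>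
    have "\<forall>\<^sub>F K in sequentially. W K / (\<Sum>k<Suc K. W k) < 1 / 2"
      using W_adm unfolding admissible_weight_def by (intro order_tendstoD(2)) auto
    then have "\<forall>\<^sub>F N in sequentially. W (\<kappa> N) / (\<Sum>k<Suc (\<kappa> N). W k) < 1 / 2"
      using \<kappa>_top by (rule eventually_compose_filterlim)
    moreover have "\<forall>\<^sub>F N in sequentially. x0 \<le> real N"
      using filterlim_real_sequentially by (simp add: filterlim_at_top)
    ultimately show "\<forall>\<^sub>F N in sequentially. (\<Sum>k<Suc (\<kappa> N). W k) \<le> 2 * real N"
    proof eventually_elim
      case (elim N)
      have "0 < (\<Sum>k<Suc (\<kappa> N). W k)" by (rule sum_weight_pos[OF W_pos]) simp
      then have "2 * W (\<kappa> N) < (\<Sum>k<Suc (\<kappa> N). W k)" using elim(1) by (simp add: divide_less_eq)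
      then have "(\<Sum>k<Suc (\<kappa> N). W k) \<le> 2 * (\<Sum>k<\<kappa> N. W k)" by simp
      also have "\<dots> \<le> 2 * real N" using \<kappa>_le[OF elim(2)] \<psi>0 x0 by (simp add: S_eq)
      finally show ?case .
    qed
  qed
  show ?thesis
    unfolding time_change_def
    by (rule exI[of _ W], rule exI[of _ \<psi>], rule exI[of _ \<kappa>])
      (intro conjI allI impI W_adm \<psi> \<psi>_top \<kappa>[THEN conjunct1] \<kappa>[THEN conjunct2] \<kappa>_le \<kappa>_top, (assumption | rule transfer | blast)+)
qed

end

lemma Bseq_plus:
  fixes f g :: "nat \<Rightarrow> 'b::real_normed_vector"
  assumes "Bseq f" "Bseq g"
  shows "Bseq (\<lambda>n. f n + g n)"
proof -
  obtain K L where "\<And>n. norm (f n) \<le> K" "\<And>n. norm (g n) \<le> L"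
    using assms unfolding Bseq_def by blast
  then show ?thesis
    by (intro BseqI'[where K = "K + L"] norm_triangle_le add_mono)
qed

context weakly_mixing_action
begin

definition approximates :: "(nat \<Rightarrow> nat \<Rightarrow> int) \<Rightarrow> (nat \<Rightarrow> real \<Rightarrow> real) \<Rightarrow> bool"
  where "approximates m v \<longleftrightarrow> (\<forall>i\<in>I. Bseq (\<lambda>n. real_of_int (m n i) - v i (real n)))"

lemma uniform_Bseq:
  fixes a :: "nat \<Rightarrow> nat \<Rightarrow> nat \<Rightarrow> real"
  assumes "finite J" and "\<And>j i. j \<in> J \<Longrightarrow> i \<in> I \<Longrightarrow> Bseq (a j i)"
  shows "\<exists>C. \<forall>j\<in>J. \<forall>i\<in>I. \<forall>n. \<bar>a j i n\<bar> \<le> C"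
proof -
  have "\<forall>p\<in>J \<times> I. \<exists>C. \<forall>n. \<bar>a (fst p) (snd p) n\<bar> \<le> C"
    using assms(2) by (fastforce simp: Bseq_def)
  then obtain Cf where Cf: "\<forall>p\<in>J \<times> I. \<forall>n. \<bar>a (fst p) (snd p) n\<bar> \<le> Cf p" by (rule bchoice[THEN exE])
  show ?thesis
  proof (intro exI ballI allI)
    fix j i n assume ji: "j \<in> J" "i \<in> I"
    then have "\<bar>a j i n\<bar> \<le> \<bar>Cf (j, i)\<bar>" using Cf[rule_format, of "(j, i)" n] by simp
    also have "\<dots> \<le> (\<Sum>p\<in>J \<times> I. \<bar>Cf p\<bar>)"
      using ji assms(1) finite_I by (intro member_le_sum) auto
    finally show "\<bar>a j i n\<bar> \<le> (\<Sum>p\<in>J \<times> I. \<bar>Cf p\<bar>)" .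
  qed
qed

text \<open>By Cauchy's mean value theorem an increment of \<open>v j i\<close> is the increment of
  \<phi> times a value of \<open>v' j i / \<theta>\<close>, hence nearly the limiting slope times
  the elapsed new time. The integer parts of \<open>v j i\<close> at the points
  \<open>\<psi> k\<close> are therefore linear along \<open>i0\<close>, and the exponents at time
  \<open>n\<close> differ boundedly from those at \<open>\<kappa> n\<close>.\<close>

lemma mean_null_slow_family:
  fixes v v' :: "nat \<Rightarrow> nat \<Rightarrow> real \<Rightarrow> real"
  assumes i0: "i0 \<in> I" and J: "finite J" "j1 \<in> J"
    and x0: "0 \<le> x0"
    and deriv: "\<And>x. x0 \<le> x \<Longrightarrow> (\<phi> has_real_derivative \<theta> x) (at x)"
    and pos: "\<And>x. x0 \<le> x \<Longrightarrow> 0 < \<theta> x"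
    and anti: "\<And>x y. x0 \<le> x \<Longrightarrow> x \<le> y \<Longrightarrow> \<theta> y \<le> \<theta> x"
    and top: "filterlim (\<lambda>x. x * \<theta> x) at_top at_top"
    and \<phi>_top: "filterlim \<phi> at_top at_top"
    and v_deriv: "\<And>j i. j \<in> J \<Longrightarrow> i \<in> I \<Longrightarrow> \<forall>\<^sub>F x in at_top. (v j i has_real_derivative v' j i x) (at x)"
    and v_lim: "\<And>j i. j \<in> J \<Longrightarrow> i \<in> I \<Longrightarrow> ((\<lambda>x. v' j i x / \<theta> x) \<longlongrightarrow> (if i = i0 then b j else 0)) at_top"
    and b1: "b j1 \<noteq> 0" and bj: "\<And>j. j \<in> J \<Longrightarrow> j \<noteq> j1 \<Longrightarrow> b j \<noteq> b j1"
    and f: "\<And>j. j \<in> J \<Longrightarrow> bounded_measurable M (f j)" and f0: "(\<integral>x. f j1 x \<partial>M) = 0"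
    and m: "\<And>j. j \<in> J \<Longrightarrow> approximates (m j) (v j)"
  shows "mean_null (\<lambda>_. 1) (\<lambda>n x. \<Prod>j\<in>J. f j (A (m j n) x))"
proof -
  obtain W \<psi> \<kappa> where W: "admissible_weight W" and \<psi>_all: "\<forall>k. x0 \<le> \<psi> k" "\<forall>k. \<phi> (\<psi> k) = \<phi> x0 + real k"
    and \<psi>_top: "filterlim \<psi> at_top sequentially"
    and \<kappa>_all: "\<forall>n. x0 \<le> real n \<longrightarrow> \<phi> (\<psi> (\<kappa> n)) \<le> \<phi> (real n) \<and> \<phi> (real n) < \<phi> (\<psi> (\<kappa> n)) + 1"
      "\<forall>n. x0 \<le> real n \<longrightarrow> \<psi> (\<kappa> n) \<le> real n"
    and \<kappa>_top: "filterlim \<kappa> at_top sequentially"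
    and transfer: "\<forall>y. (\<forall>k. bounded_measurable M (y k)) \<longrightarrow> mean_null W y \<longrightarrow> mean_null (\<lambda>_. 1) (\<lambda>n. y (\<kappa> n))"
    using time_change_exists[of x0 \<phi> \<theta>] x0 deriv pos anti top \<phi>_top unfolding time_change_def by blast
  note \<psi> = \<psi>_all[rule_format] and \<kappa> = \<kappa>_all(1)[rule_format] and \<kappa>_le = \<kappa>_all(2)[rule_format]
  define s where "s j i = (if i = i0 then b j else 0)" for j i
  have slope: "\<forall>\<^sub>F x in at_top. \<forall>y\<ge>x. \<bar>(v j i y - v j i x) - s j i * (\<phi> y - \<phi> x)\<bar> \<le> \<epsilon> * (\<phi> y - \<phi> x)"
    if ji: "j \<in> J" "i \<in> I" and \<epsilon>: "0 < \<epsilon>" for j i \<epsilon>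
  proof -
    have "\<forall>\<^sub>F x in at_top. \<bar>v' j i x / \<theta> x - s j i\<bar> < \<epsilon>"
      using v_lim[OF ji] \<epsilon> unfolding s_def by (auto simp: tendsto_iff dist_real_def)
    then have "\<forall>\<^sub>F x in at_top. \<bar>v' j i x / \<theta> x - s j i\<bar> < \<epsilon> \<and> (v j i has_real_derivative v' j i x) (at x) \<and> x0 \<le> x"
      using v_deriv[OF ji] eventually_ge_at_top[of x0] by eventually_elim auto
    then obtain x1 where x1: "\<And>x. x1 \<le> x \<Longrightarrow> \<bar>v' j i x / \<theta> x - s j i\<bar> < \<epsilon>"
      "\<And>x. x1 \<le> x \<Longrightarrow> (v j i has_real_derivative v' j i x) (at x)" "\<And>x. x1 \<le> x \<Longrightarrow> x0 \<le> x"
      unfolding eventually_at_top_linorder by blast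
    show ?thesis
      unfolding eventually_at_top_linorder
    proof (intro exI allI impI)
      fix x y assume xy: "x1 \<le> x" "x \<le> y"
      show "\<bar>(v j i y - v j i x) - s j i * (\<phi> y - \<phi> x)\<bar> \<le> \<epsilon> * (\<phi> y - \<phi> x)"
      proof (cases "x = y")
        case False
        then have "x < y" using xy by simp
        have "\<exists>c. x < c \<and> c < y \<and> (v j i y - v j i x) * \<theta> c = (\<phi> y - \<phi> x) * v' j i c"
          using xy by (intro GMVT' \<open>x < y\<close>) (auto intro!: DERIV_isCont x1 deriv)
        then obtain c where c: "x < c" "c < y" "(v j i y - v j i x) * \<theta> c = (\<phi> y - \<phi> x) * v' j i c" by blast
        have \<theta>c: "0 < \<theta> c" using c xy by (intro pos x1) auto
        have "0 \<le> \<phi> y - \<phi> x"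
          using DERIV_pos_imp_increasing[OF \<open>x < y\<close>, of \<phi>] xy by (smt (verit) deriv pos x1(3))
        moreover have "v j i y - v j i x = (\<phi> y - \<phi> x) * (v' j i c / \<theta> c)" using c(3) \<theta>c by (simp add: field_simps)
        then have "(v j i y - v j i x) - s j i * (\<phi> y - \<phi> x) = (\<phi> y - \<phi> x) * (v' j i c / \<theta> c - s j i)"
          by (simp add: algebra_simps)
        moreover have "\<bar>v' j i c / \<theta> c - s j i\<bar> \<le> \<epsilon>" using x1(1)[of c] c xy by simp
        ultimately have "\<bar>(v j i y - v j i x) - s j i * (\<phi> y - \<phi> x)\<bar> \<le> (\<phi> y - \<phi> x) * \<epsilon>"
          unfolding abs_mult by (simp add: abs_mult mult_left_mono)
        then show ?thesis by (simp only: mult.commute)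
      qed simp
    qed
  qed
  define m' where "m' j k i = \<lfloor>v j i (\<psi> k)\<rfloor>" for j k i
  have lin: "linear_along i0 (b j) (m' j)" if j: "j \<in> J" for j
    unfolding linear_along_def
  proof (intro exI allI)
    fix h
    \<comment> \<open>The tolerance shrinks with \<open>h\<close>, so that the error over
      \<open>h\<close> units of new time stays below 1; only the threshold for \<open>k\<close>
      depends on \<open>h\<close>. The bound 2 leaves room for the two integer parts.\<close>
    define \<epsilon> where "\<epsilon> = 1 / (real h + 1)"
    have "\<epsilon> * real h \<le> 1" by (simp add: \<epsilon>_def)
    have "\<forall>\<^sub>F x in at_top. \<forall>i\<in>I. \<forall>y\<ge>x. \<bar>(v j i y - v j i x) - s j i * (\<phi> y - \<phi> x)\<bar> \<le> \<epsilon> * (\<phi> y - \<phi> x)"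
      by (intro eventually_ball_finite finite_I ballI slope j) (simp_all add: \<epsilon>_def)
    then have "\<forall>\<^sub>F k in sequentially. \<forall>i\<in>I. \<forall>y\<ge>\<psi> k. \<bar>(v j i y - v j i (\<psi> k)) - s j i * (\<phi> y - \<phi> (\<psi> k))\<bar> \<le> \<epsilon> * (\<phi> y - \<phi> (\<psi> k))"
      using \<psi>_top by (rule eventually_compose_filterlim)
    then show "\<forall>\<^sub>F k in sequentially. \<forall>i\<in>I. \<bar>real_of_int (m' j (k + h) i - m' j k i) - (if i = i0 then b j * real h else 0)\<bar> \<le> 2"
    proof eventually_elim
      case (elim k)
      show ?case
      proof
        fix i assume i: "i \<in> I"
        have "\<psi> k \<le> \<psi> (k + h)"
        proof (rule ccontr)
          assume "\<not> \<psi> k \<le> \<psi> (k + h)"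
          then have "\<phi> (\<psi> (k + h)) < \<phi> (\<psi> k)"
            using \<psi>(1) by (intro DERIV_pos_imp_increasing[of _ _ \<phi>]) (auto, meson deriv pos order_trans)
          then show False using \<psi>(2) by simp
        qed
        then have "\<bar>(v j i (\<psi> (k + h)) - v j i (\<psi> k)) - s j i * real h\<bar> \<le> \<epsilon> * real h"
          using elim[rule_format, OF i, of "\<psi> (k + h)"] by (simp add: \<psi>(2))
        then have "\<bar>(v j i (\<psi> (k + h)) - v j i (\<psi> k)) - s j i * real h\<bar> \<le> 1" using \<open>\<epsilon> * real h \<le> 1\<close> by linarith
        then have "\<bar>real_of_int (m' j (k + h) i - m' j k i) - s j i * real h\<bar> \<le> 2"
          unfolding m'_def by linarith
        then show "\<bar>real_of_int (m' j (k + h) i - m' j k i) - (if i = i0 then b j * real h else 0)\<bar> \<le> 2"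
          by (simp add: s_def split: if_splits)
      qed
    qed
  qed
  have Bseq_err: "Bseq (\<lambda>n. real_of_int (m j n i - m' j (\<kappa> n) i))" if ji: "j \<in> J" "i \<in> I" for j i
  proof -
    have "\<forall>\<^sub>F x in at_top. \<forall>y\<ge>x. \<bar>(v j i y - v j i x) - s j i * (\<phi> y - \<phi> x)\<bar> \<le> 1 * (\<phi> y - \<phi> x)"
      by (intro slope ji) simp
    then have "\<forall>\<^sub>F n in sequentially. \<forall>y\<ge>\<psi> (\<kappa> n). \<bar>(v j i y - v j i (\<psi> (\<kappa> n))) - s j i * (\<phi> y - \<phi> (\<psi> (\<kappa> n)))\<bar> \<le> 1 * (\<phi> y - \<phi> (\<psi> (\<kappa> n)))"
      using filterlim_compose[OF \<psi>_top \<kappa>_top] by (rule eventually_compose_filterlim)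
    moreover have "\<forall>\<^sub>F n in sequentially. x0 \<le> real n"
      using filterlim_real_sequentially by (simp add: filterlim_at_top)
    \<comment> \<open>Less than one unit of new time passes between
      \<open>\<psi> (\<kappa> n)\<close> and \<open>n\<close>, so \<open>v j i\<close> moves by at
      most \<open>\<bar>s j i\<bar> + 1\<close>; rounding adds 1.\<close>
    ultimately have "\<forall>\<^sub>F n in sequentially. norm (v j i (real n) - of_int (m' j (\<kappa> n) i)) \<le> \<bar>s j i\<bar> + 2"
    proof eventually_elim
      case (elim n)
      define t where "t = \<phi> (real n) - \<phi> (\<psi> (\<kappa> n))"
      have t: "0 \<le> t" "t < 1" using \<kappa>[OF elim(2)] by (auto simp: t_def)
      have "\<bar>(v j i (real n) - v j i (\<psi> (\<kappa> n))) - s j i * t\<bar> \<le> t"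
        using elim(1)[rule_format, OF \<kappa>_le[OF elim(2)]] by (simp add: t_def)
      moreover have "\<bar>s j i * t\<bar> \<le> \<bar>s j i\<bar>" using t by (simp add: abs_mult mult_left_le)
      ultimately show ?case using t unfolding m'_def real_norm_def by linarith
    qed
    then have "Bseq (\<lambda>n. v j i (real n) - of_int (m' j (\<kappa> n) i))" by (rule BfunI)
    moreover have "Bseq (\<lambda>n. real_of_int (m j n i) - v j i (real n))" using m ji by (simp add: approximates_def)
    ultimately have "Bseq (\<lambda>n. (real_of_int (m j n i) - v j i (real n)) + (v j i (real n) - of_int (m' j (\<kappa> n) i)))"
      by (intro Bseq_plus)
    then show ?thesis by simp
  qed
  have "\<exists>C. \<forall>j\<in>J. \<forall>i\<in>I. \<forall>n. \<bar>real_of_int (m j n i - m' j (\<kappa> n) i)\<bar> \<le> C"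
    by (rule uniform_Bseq[OF J(1) Bseq_err])
  then obtain C where C: "\<And>j i n. j \<in> J \<Longrightarrow> i \<in> I \<Longrightarrow> \<bar>real_of_int (m j n i - m' j (\<kappa> n) i)\<bar> \<le> C"
    by blast
  define E where "E = PiE J (\<lambda>_. box C)"
  \<comment> \<open>For each of the finitely many error patterns the displacements are absorbed into
    the functions, so the linear case applies to \<open>y ev\<close>.\<close>
  define y where "y ev k x = (\<Prod>j\<in>J. f j (A (ev j) (A (m' j k) x)))" for ev k x
  define e where "e n = restrict (\<lambda>j. box_proj (\<lambda>i. m j n i - m' j (\<kappa> n) i)) J" for n
  have y_bounded: "bounded_measurable M (y ev k)" for ev k
    unfolding y_def by (intro bounded_measurable_prod bounded_measurable_A f)
  have "mean_null (\<lambda>_. 1) (\<lambda>n. y (e n) (\<kappa> n))"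
  proof (rule mean_null_finite_choice[where E = E and y = "\<lambda>ev n. y ev (\<kappa> n)" and s = e])
    show "finite E" unfolding E_def using J(1) by (intro finite_PiE finite_box)
    show "mean_null (\<lambda>_. 1) (\<lambda>n. y ev (\<kappa> n))" for ev
    proof (rule transfer[rule_format])
      show "mean_null W (y ev)"
        unfolding y_def
        using J b1 bj lin f0 integral_A[OF bounded_measurable_measurable[OF f[OF J(2)]]]
        by (intro mean_null_linear_family[OF W i0, where f = "\<lambda>j x. f j (A (ev j) x)" and b = b and ?j1.0 = j1] bounded_measurable_A f)
          auto
    qed (rule y_bounded)
    show "e n \<in> E" for n
      using C by (auto simp: E_def e_def intro!: box_proj_in_box)
  qed (auto intro: y_bounded)
  moreover have "y (e n) (\<kappa> n) x = (\<Prod>j\<in>J. f j (A (m j n) x))" if x: "x \<in> space M" for n x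
    unfolding y_def
  proof (intro prod.cong refl)
    fix j assume "j \<in> J"
    then have "A (m j n) x = A (e n j) (A (m' j (\<kappa> n)) x)"
      by (intro A_add'[OF x]) (simp add: e_def box_proj_def)
    then show "f j (A (e n j) (A (m' j (\<kappa> n)) x)) = f j (A (m j n) x)" by simp
  qed
  ultimately show ?thesis
    using mean_null_cong[of "\<lambda>n. y (e n) (\<kappa> n)" "\<lambda>n x. \<Prod>j\<in>J. f j (A (m j n) x)" "\<lambda>_. 1"] by simp
qed

end

section \<open>Orders of growth\<close>

text \<open>The entries are successive derivatives, on one half-line for all orders. They are
  carried along explicitly because shifts and differences can then be formed entry by entry.\<close>

definition tower :: "(nat \<Rightarrow> real \<Rightarrow> real) \<Rightarrow> bool"
  where "tower q \<longleftrightarrow> (\<forall>\<^sub>F x in at_top. \<forall>m. (q m has_real_derivative q (Suc m) x) (at x))"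

lemma tower_diff:
  assumes "tower p" "tower q"
  shows "tower (\<lambda>m x. p m x - q m x)"
  using assms unfolding tower_def by eventually_elim (auto intro!: derivative_eq_intros)

lemma eventually_at_top_shift:
  assumes "\<forall>\<^sub>F x in at_top. P x" and "0 \<le> h"
  shows "\<forall>\<^sub>F x in at_top. P (x + h :: real)"
proof -
  obtain x1 where "\<And>x. x1 \<le> x \<Longrightarrow> P x" using assms(1) by (auto simp: eventually_at_top_linorder)
  then show ?thesis using assms(2) by (auto simp: eventually_at_top_linorder intro!: exI[of _ x1])
qed

lemma filterlim_plus_const_at_top: "filterlim (\<lambda>x :: real. x + h) at_top at_top"
  using filterlim_tendsto_add_at_top[OF tendsto_const[of h] filterlim_ident] by (simp add: add.commute)

lemma tower_shift:
  assumes "tower q"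
  shows "tower (\<lambda>m x. q m (x + real h))"
proof -
  have "\<forall>\<^sub>F x in at_top. \<forall>m. (q m has_real_derivative q (Suc m) (x + real h)) (at (x + real h))"
    using eventually_at_top_shift[OF assms[unfolded tower_def], of "real h"] by simp
  then show ?thesis
    unfolding tower_def by eventually_elim (auto simp: DERIV_shift)
qed

lemma tower_zero: "tower (\<lambda>_ _. 0)"
  by (simp add: tower_def)

text \<open>These are the properties of the time \<phi> and its derivative that are extracted from
  \<open>g_1\<close>. The divergence of \<open>x * \<theta> x\<close> serves the weights of the time
  change, \<theta> tending to 0 makes degree 0 mean bounded, and the ratio condition makes orders of
  growth invariant under shifts.\<close>

locale slow_scale =
  fixes \<theta> \<phi> :: "real \<Rightarrow> real" and x0 :: real
  assumes x0: "0 \<le> x0"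
    and \<phi>_deriv: "\<And>x. x0 \<le> x \<Longrightarrow> (\<phi> has_real_derivative \<theta> x) (at x)"
    and \<theta>_pos: "\<And>x. x0 \<le> x \<Longrightarrow> 0 < \<theta> x"
    and \<theta>_anti: "\<And>x y. x0 \<le> x \<Longrightarrow> x \<le> y \<Longrightarrow> \<theta> y \<le> \<theta> x"
    and x\<theta>_top: "filterlim (\<lambda>x. x * \<theta> x) at_top at_top"
    and \<phi>_top: "filterlim \<phi> at_top at_top"
    and \<theta>_lim: "(\<theta> \<longlongrightarrow> 0) at_top"
    and \<theta>_ratio: "((\<lambda>x. \<theta> (x + 1) / \<theta> x) \<longlongrightarrow> 1) at_top"
begin

lemma \<theta>_ratio_shift: "((\<lambda>x. \<theta> (x + real h) / \<theta> x) \<longlongrightarrow> 1) at_top"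
proof (induction h)
  case 0
  have "\<forall>\<^sub>F x in at_top. 1 = \<theta> (x + real 0) / \<theta> x"
    using eventually_ge_at_top[of x0] by eventually_elim (use \<theta>_pos in force)
  then show ?case by (rule Lim_transform_eventually[OF tendsto_const])
next
  case (Suc h)
  have "((\<lambda>x. \<theta> ((x + real h) + 1) / \<theta> (x + real h)) \<longlongrightarrow> 1) at_top"
    by (rule filterlim_compose[OF \<theta>_ratio filterlim_plus_const_at_top])
  from tendsto_mult[OF this Suc]
  have "((\<lambda>x. \<theta> ((x + real h) + 1) / \<theta> (x + real h) * (\<theta> (x + real h) / \<theta> x)) \<longlongrightarrow> 1) at_top" by simp
  moreover have "\<forall>\<^sub>F x in at_top. \<theta> ((x + real h) + 1) / \<theta> (x + real h) * (\<theta> (x + real h) / \<theta> x) = \<theta> (x + real (Suc h)) / \<theta> x"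
    using eventually_ge_at_top[of x0]
  proof eventually_elim
    case (elim x)
    have "0 < \<theta> (x + real h)" using elim by (intro \<theta>_pos) auto
    then show ?case by (simp add: add_ac)
  qed
  ultimately show ?case by (rule Lim_transform_eventually)
qed

text \<open>As \<open>b = 0\<close> is allowed, \<open>r\<close> is only an upper bound for the
  degree, with \<open>b\<close> the coefficient of that degree. This makes the notion additive and
  compatible with raising \<open>r\<close>.\<close>

definition has_order :: "nat \<Rightarrow> real \<Rightarrow> (nat \<Rightarrow> real \<Rightarrow> real) \<Rightarrow> bool"
  where "has_order r b q \<longleftrightarrow> tower q \<and> ((\<lambda>x. q r x / \<theta> x) \<longlongrightarrow> b) at_top \<and>
    (\<forall>m>r. ((\<lambda>x. q m x / \<theta> x) \<longlongrightarrow> 0) at_top)"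

lemma has_order_diff:
  assumes "has_order r b p" "has_order r c q"
  shows "has_order r (b - c) (\<lambda>m x. p m x - q m x)"
proof -
  have "((\<lambda>x. (p r x - q r x) / \<theta> x) \<longlongrightarrow> b - c) at_top"
    using assms unfolding has_order_def diff_divide_distrib by (intro tendsto_diff) auto
  moreover have "((\<lambda>x. (p m x - q m x) / \<theta> x) \<longlongrightarrow> 0) at_top" if "m > r" for m
  proof -
    have "((\<lambda>x. p m x / \<theta> x - q m x / \<theta> x) \<longlongrightarrow> 0 - 0) at_top"
      using assms that unfolding has_order_def by (intro tendsto_diff) auto
    then show ?thesis by (simp add: diff_divide_distrib)
  qed
  ultimately show ?thesis
    using assms unfolding has_order_def by (intro conjI tower_diff) auto
qed

lemma has_order_shift:
  assumes "has_order r b q"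
  shows "has_order r b (\<lambda>m x. q m (x + real h))"
proof -
  have *: "((\<lambda>x. q m (x + real h) / \<theta> x) \<longlongrightarrow> c) at_top" if "((\<lambda>x. q m x / \<theta> x) \<longlongrightarrow> c) at_top" for m c
  proof -
    have "((\<lambda>x. q m (x + real h) / \<theta> (x + real h) * (\<theta> (x + real h) / \<theta> x)) \<longlongrightarrow> c * 1) at_top"
      by (intro tendsto_mult \<theta>_ratio_shift filterlim_compose[OF that filterlim_plus_const_at_top])
    then have 1: "((\<lambda>x. q m (x + real h) / \<theta> (x + real h) * (\<theta> (x + real h) / \<theta> x)) \<longlongrightarrow> c) at_top" by simp
    have "\<forall>\<^sub>F x in at_top. q m (x + real h) / \<theta> (x + real h) * (\<theta> (x + real h) / \<theta> x) = q m (x + real h) / \<theta> x"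
      using eventually_ge_at_top[of x0]
    proof eventually_elim
      case (elim x)
      have "0 < \<theta> (x + real h)" using elim by (intro \<theta>_pos) auto
      then show ?case by simp
    qed
    with 1 show ?thesis by (rule Lim_transform_eventually)
  qed
  show ?thesis
    using assms unfolding has_order_def by (intro conjI tower_shift allI impI *) auto
qed

lemma has_order_zero: "has_order r 0 (\<lambda>_ _. 0)"
  by (simp add: has_order_def tower_zero)

text \<open>By the mean value theorem a difference is \<open>h\<close> times the next derivative at
  an intermediate point, and monotonicity squeezes \<theta> there between its values at the ends,
  whose ratio tends to 1. As for polynomials, the degree drops by one.\<close>

lemma has_order_shift_diff:
  assumes "has_order (Suc r) b q"
  shows "has_order r (real h * b) (\<lambda>m x. q m (x + real h) - q m x)"
proof (cases "h = 0")
  case True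
  then show ?thesis using has_order_zero by simp
next
  case False
  have tower: "tower q" using assms by (simp add: has_order_def)
  then obtain x1 where x1: "\<And>x m. x1 \<le> x \<Longrightarrow> (q m has_real_derivative q (Suc m) x) (at x)"
    by (auto simp: tower_def eventually_at_top_linorder)
  have *: "((\<lambda>x. (q m (x + real h) - q m x) / \<theta> x) \<longlongrightarrow> real h * c) at_top"
    if lim: "((\<lambda>x. q (Suc m) x / \<theta> x) \<longlongrightarrow> c) at_top" for m c
  proof -
    have "\<exists>z. x < z \<and> z < x + real h \<and> q m (x + real h) - q m x = real h * q (Suc m) z" if "x1 \<le> x" for x
      using MVT2[of x "x + real h" "q m" "q (Suc m)"] x1 that False by auto
    then obtain z where z: "\<And>x. x1 \<le> x \<Longrightarrow> x < z x \<and> z x < x + real h \<and> q m (x + real h) - q m x = real h * q (Suc m) (z x)"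
      by metis
    have z_top: "filterlim z at_top at_top"
      by (rule filterlim_at_top_mono[OF filterlim_ident])
        (use z in \<open>auto simp: eventually_at_top_linorder intro!: exI[of _ x1] less_imp_le\<close>)
    have ratio: "((\<lambda>x. \<theta> (z x) / \<theta> x) \<longlongrightarrow> 1) at_top"
    proof (rule tendsto_sandwich[OF _ _ \<theta>_ratio_shift[of h] tendsto_const])
      show "\<forall>\<^sub>F x in at_top. \<theta> (x + real h) / \<theta> x \<le> \<theta> (z x) / \<theta> x"
        using eventually_ge_at_top[of x0] eventually_ge_at_top[of x1]
      proof eventually_elim
        case (elim x)
        then show ?case using z[of x] by (intro divide_right_mono \<theta>_anti less_imp_le[OF \<theta>_pos]) auto
      qed
      show "\<forall>\<^sub>F x in at_top. \<theta> (z x) / \<theta> x \<le> 1"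
        using eventually_ge_at_top[of x0] eventually_ge_at_top[of x1]
      proof eventually_elim
        case (elim x)
        then have "\<theta> (z x) \<le> \<theta> x" using z[of x] by (intro \<theta>_anti) auto
        then show ?case using \<theta>_pos[OF elim(1)] by simp
      qed
    qed
    have "((\<lambda>x. real h * (q (Suc m) (z x) / \<theta> (z x) * (\<theta> (z x) / \<theta> x))) \<longlongrightarrow> real h * (c * 1)) at_top"
      by (intro tendsto_mult tendsto_const ratio filterlim_compose[OF lim z_top])
    then have 1: "((\<lambda>x. real h * (q (Suc m) (z x) / \<theta> (z x) * (\<theta> (z x) / \<theta> x))) \<longlongrightarrow> real h * c) at_top" by simp
    have "\<forall>\<^sub>F x in at_top. real h * (q (Suc m) (z x) / \<theta> (z x) * (\<theta> (z x) / \<theta> x)) = (q m (x + real h) - q m x) / \<theta> x"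
      using eventually_ge_at_top[of x0] eventually_ge_at_top[of x1]
    proof eventually_elim
      case (elim x)
      have "0 < \<theta> (z x)" using elim z[of x] by (intro \<theta>_pos) auto
      then show ?case using z[of x] elim by simp
    qed
    with 1 show ?thesis by (rule Lim_transform_eventually)
  qed
  show ?thesis
    unfolding has_order_def
  proof (intro conjI allI impI tower_diff tower_shift tower)
    show "((\<lambda>x. (q r (x + real h) - q r x) / \<theta> x) \<longlongrightarrow> real h * b) at_top"
      using assms by (intro *) (simp add: has_order_def)
    show "((\<lambda>x. (q m (x + real h) - q m x) / \<theta> x) \<longlongrightarrow> 0) at_top" if "r < m" for m
      using *[of m 0] assms that by (simp add: has_order_def)
  qed
qed

lemma has_order_less: "has_order r b q \<Longrightarrow> r < r' \<Longrightarrow> has_order r' 0 q"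
  by (simp add: has_order_def)

lemma has_order_unique: "has_order r b q \<Longrightarrow> has_order r c q \<Longrightarrow> b = c"
  unfolding has_order_def using tendsto_unique trivial_limit_at_top_linorder by blast

lemma has_order_0_Bseq:
  assumes "has_order 0 b q"
  shows "Bseq (\<lambda>n. q 0 (real n))"
proof -
  have "((\<lambda>x. q 0 x / \<theta> x * \<theta> x) \<longlongrightarrow> b * 0) at_top"
    using assms unfolding has_order_def by (intro tendsto_mult \<theta>_lim) auto
  moreover have "\<forall>\<^sub>F x in at_top. q 0 x / \<theta> x * \<theta> x = q 0 x"
    using eventually_ge_at_top[of x0] by eventually_elim (use \<theta>_pos in force)
  ultimately have "(q 0 \<longlongrightarrow> b * 0) at_top" by (rule Lim_transform_eventually)
  then have "(\<lambda>n. q 0 (real n)) \<longlonglongrightarrow> b * 0" by (rule filterlim_compose[OF _ filterlim_real_sequentially])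
  then show ?thesis by (rule convergent_imp_Bseq[OF convergentI])
qed

end

text \<open>The measure for the PET induction is the multiset of degrees of the classes. Each label
  counts once, however many members carry it, so duplicating members within a class is free; a step
  must trade one label for finitely many of smaller degree.\<close>

lemma mult1_class_degrees:
  fixes C C' :: "(nat \<times> nat) set"
  assumes fin: "finite C" "finite C'" and a: "a \<in> C" and sub: "C - {a} \<subseteq> C'"
    and new: "\<And>x. x \<in> C' - (C - {a}) \<Longrightarrow> fst x < fst a"
  shows "(image_mset fst (mset_set C'), image_mset fst (mset_set C)) \<in> mult1 less_than"
proof -
  define M0 where "M0 = image_mset fst (mset_set (C - {a}))"
  define K where "K = image_mset fst (mset_set (C' - (C - {a})))"
  have "mset_set C = add_mset a (mset_set (C - {a}))" using fin a by (simp add: mset_set.remove)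
  then have 1: "image_mset fst (mset_set C) = add_mset (fst a) M0" by (simp add: M0_def)
  have "mset_set C' = mset_set ((C - {a}) \<union> (C' - (C - {a})))" using sub by (simp add: Un_absorb1)
  also have "\<dots> = mset_set (C - {a}) + mset_set (C' - (C - {a}))" using fin by (intro mset_set_Union) auto
  finally have 2: "image_mset fst (mset_set C') = M0 + K" by (simp add: M0_def K_def)
  have "b < fst a" if "b \<in># K" for b using that new fin by (auto simp: K_def)
  then show ?thesis unfolding 1 2 mult1_def by auto
qed

section \<open>The van der Corput step for families of exponents\<close>

context weakly_mixing_action
begin

lemma approximates_diff:
  assumes "approximates m v" "approximates n w"
  shows "approximates (\<lambda>k i. m k i - n k i) (\<lambda>i x. v i x - w i x)"
  unfolding approximates_def
proof
  fix i assume i: "i \<in> I"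
  have "Bseq (\<lambda>k. (real_of_int (m k i) - v i (real k)) + - (real_of_int (n k i) - w i (real k)))"
    using assms i unfolding approximates_def by (intro Bseq_plus Bseq_minus_iff[THEN iffD2]) auto
  then show "Bseq (\<lambda>k. real_of_int (m k i - n k i) - (v i (real k) - w i (real k)))"
    by (simp add: algebra_simps)
qed

lemma approximates_shift:
  assumes "approximates m v"
  shows "approximates (\<lambda>k. m (k + h)) (\<lambda>i x. v i (x + real h))"
  unfolding approximates_def
proof
  fix i assume i: "i \<in> I"
  have "Bseq (\<lambda>k. real_of_int (m k i) - v i (real k))" using assms i by (simp add: approximates_def)
  then obtain K where "\<And>k. norm (real_of_int (m k i) - v i (real k)) \<le> K" by (auto simp: Bseq_def)
  then have "norm (real_of_int (m (k + h) i) - v i (real k + real h)) \<le> K" for k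
    by (metis of_nat_add)
  then show "Bseq (\<lambda>k. real_of_int (m (k + h) i) - v i (real k + real h))" by (rule BseqI')
qed

definition double_family :: "nat set \<Rightarrow> nat \<Rightarrow> nat set"
  where "double_family J b = (\<lambda>j. 2 * j) ` (J - {b}) \<union> (\<lambda>j. Suc (2 * j)) ` J"

text \<open>One van der Corput step, followed by a translation by \<open>m b n\<close>: the term \<open>b\<close> becomes the fixed
  test function \<open>cnj \<circ> f b\<close>. Index \<open>2 j\<close> stands for the unshifted and \<open>2 j + 1\<close> for the shifted copy
  of the term \<open>j\<close>.\<close>

lemma mean_null_van_der_corput_step:
  assumes J: "finite J" "b \<in> J" and f: "\<And>j. j \<in> J \<Longrightarrow> bounded_measurable M (f j)"
    and step: "\<And>h. H0 \<le> h \<Longrightarrow> mean_null (\<lambda>_. 1) (\<lambda>n x. \<Prod>y\<in>double_family J b.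
      (if even y then \<lambda>z. cnj (f (y div 2) z) else f (y div 2))
        (A (\<lambda>i. (if even y then m (y div 2) n i else m (y div 2) (n + h) i) - m b n i) x))"
  shows "mean_null (\<lambda>_. 1) (\<lambda>n x. \<Prod>j\<in>J. f j (A (m j n) x))"
proof -
  have "\<forall>j\<in>J. \<exists>B. 0 < B \<and> (\<forall>x. cmod (f j x) \<le> B)"
    using f by (meson bounded_measurable_bound)
  from bchoice[OF this] obtain Bf where Bf: "\<forall>j\<in>J. 0 < Bf j \<and> (\<forall>x. cmod (f j x) \<le> Bf j)" by blast
  define B where "B = (\<Prod>j\<in>J. Bf j)"
  define u where "u n x = (\<Prod>j\<in>J. f j (A (m j n) x))" for n x
  have bu: "bounded_measurable M (u n)" for n unfolding u_def by (intro bounded_measurable_prod_A f)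
  have u_bound: "cmod (u n x) \<le> B" for n x
    unfolding u_def B_def prod_norm[symmetric] using Bf by (intro prod_mono) auto
  have B0: "0 \<le> B" using order_trans[OF norm_ge_zero u_bound[of 0 undefined]] .
  define w where "w h n x = (\<Prod>y\<in>double_family J b.
      (if even y then \<lambda>z. cnj (f (y div 2) z) else f (y div 2))
        (A (\<lambda>i. (if even y then m (y div 2) n i else m (y div 2) (n + h) i) - m b n i) x))" for h n x
  have w_eq: "w h n x = (\<Prod>j\<in>J - {b}. cnj (f j (A (\<lambda>i. m j n i - m b n i) x))) * (\<Prod>j\<in>J. f j (A (\<lambda>i. m j (n + h) i - m b n i) x))" for h n x
  proof -
    have "w h n x = (\<Prod>y\<in>(\<lambda>j. 2 * j) ` (J - {b}). (if even y then \<lambda>z. cnj (f (y div 2) z) else f (y div 2))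
        (A (\<lambda>i. (if even y then m (y div 2) n i else m (y div 2) (n + h) i) - m b n i) x))
      * (\<Prod>y\<in>(\<lambda>j. Suc (2 * j)) ` J. (if even y then \<lambda>z. cnj (f (y div 2) z) else f (y div 2))
        (A (\<lambda>i. (if even y then m (y div 2) n i else m (y div 2) (n + h) i) - m b n i) x))"
      unfolding w_def double_family_def
      by (rule prod.union_disjoint) (use J in \<open>auto simp: disjoint_iff, presburger\<close>)
    then show ?thesis by (simp add: prod.reindex inj_on_def)
  qed
  have bw: "bounded_measurable M (w h n)" for h n
    unfolding w_eq using f by (intro bounded_measurable_mult bounded_measurable_prod bounded_measurable_cnj bounded_measurable_A) auto
  have corr: "(\<integral>x. u (n + h) x * cnj (u n x) \<partial>M) = (\<integral>x. w h n x * cnj (f b x) \<partial>M)" for h n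
  proof (rule integral_translate[where m = "m b n"])
    show "(\<lambda>x. w h n x * cnj (f b x)) \<in> borel_measurable M"
      by (intro bounded_measurable_measurable bounded_measurable_mult bw bounded_measurable_cnj f J)
    fix x assume x: "x \<in> space M"
    have "A (\<lambda>i. k i - m b n i) (A (m b n) x) = A k x" for k
      using A_add'[OF x, of k "\<lambda>i. k i - m b n i" "m b n"] by simp
    then show "u (n + h) x * cnj (u n x) = w h n (A (m b n) x) * cnj (f b (A (m b n) x))"
      unfolding w_eq u_def using J by (simp add: prod.remove[of J b "\<lambda>j. cnj (f j (A (m j n) x))"] mult_ac)
  qed
  have "mean_null (\<lambda>_. 1) u"
  \<comment> \<open>The finitely many shifts below \<open>H0\<close>, about which nothing is known,
    get the trivial bound and vanish in the Cesaro mean.\<close>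
  proof (rule van_der_corput[OF admissible_weight_const, where B = B and \<delta> = "\<lambda>h. if h < H0 then B\<^sup>2 else 0"])
    show "u n \<in> borel_measurable M" for n by (rule bounded_measurable_measurable[OF bu])
    show "cmod (u n x) \<le> B" for n x by (rule u_bound)
    show "(\<lambda>H. (\<Sum>h<H. if h < H0 then B\<^sup>2 else 0) / real H) \<longlonglongrightarrow> 0"
    proof -
      have "(\<lambda>H. (real H0 * B\<^sup>2) / real H) \<longlonglongrightarrow> 0"
        by (rule real_tendsto_divide_at_top[OF tendsto_const filterlim_real_sequentially])
      moreover have "\<forall>\<^sub>F H in sequentially. (real H0 * B\<^sup>2) / real H = (\<Sum>h<H. if h < H0 then B\<^sup>2 else 0) / real H"
        using eventually_ge_at_top[of H0]
      proof eventually_elim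
        case (elim H)
        have "{h \<in> {..<H}. h < H0} = {..<H0}" using elim by auto
        moreover have "(\<Sum>h<H. if h < H0 then B\<^sup>2 else 0) = (\<Sum>h\<in>{h \<in> {..<H}. h < H0}. B\<^sup>2)"
          by (rule sum.inter_filter[symmetric]) simp
        ultimately show ?case by simp
      qed
      ultimately show ?thesis by (rule Lim_transform_eventually)
    qed
    fix h :: nat and \<epsilon> :: real assume "0 < \<epsilon>"
    show "\<forall>\<^sub>F N in sequentially. wmean (\<lambda>_. 1) (\<lambda>n. cmod (\<integral>x. u (n + h) x * cnj (u n x) \<partial>M)) N \<le> (if h < H0 then B\<^sup>2 else 0) + \<epsilon>"
    proof (cases "h < H0")
      case True
      have "cmod (\<integral>x. u (n + h) x * cnj (u n x) \<partial>M) \<le> B\<^sup>2" for n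
      proof (rule order_trans[OF integral_norm_bound integral_le_const])
        show "integrable M (\<lambda>x. cmod (u (n + h) x * cnj (u n x)))"
          by (intro integrable_norm integrable_bounded_measurable bounded_measurable_mult bounded_measurable_cnj bu)
        show "AE x in M. cmod (u (n + h) x * cnj (u n x)) \<le> B\<^sup>2"
          unfolding power2_eq_square by (auto simp: norm_mult intro!: mult_mono u_bound B0)
      qed
      then have "norm (wmean (\<lambda>_. 1) (\<lambda>n. cmod (\<integral>x. u (n + h) x * cnj (u n x) \<partial>M)) N) \<le> B\<^sup>2" for N
        by (intro norm_wmean_bound) auto
      then have "wmean (\<lambda>_. 1) (\<lambda>n. cmod (\<integral>x. u (n + h) x * cnj (u n x) \<partial>M)) N \<le> B\<^sup>2 + \<epsilon>" for N
        using \<open>0 < \<epsilon>\<close> by (smt (verit) real_norm_def)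
      then show ?thesis using True by simp
    next
      case False
      then have "mean_null (\<lambda>_. 1) (w h)" using step[of h] unfolding w_def[abs_def] by simp
      then have "wmean (\<lambda>_. 1) (\<lambda>n. cmod (\<integral>x. w h n x * cnj (f b x) \<partial>M)) \<longlonglongrightarrow> 0"
        by (intro mean_null_imp_correlations bw bounded_measurable_cnj f J) auto
      then have "\<forall>\<^sub>F N in sequentially. wmean (\<lambda>_. 1) (\<lambda>n. cmod (\<integral>x. w h n x * cnj (f b x) \<partial>M)) N < \<epsilon>"
        using \<open>0 < \<epsilon>\<close> by (rule order_tendstoD)
      then show ?thesis using False unfolding corr by (auto elim: eventually_mono)
    qed
  qed simp
  then show ?thesis unfolding u_def[abs_def] .
qed

end

section \<open>Polynomial exhaustion\<close>

locale action_with_scale = weakly_mixing_action M I A + slow_scale \<theta> \<phi> x0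
  for M :: "'a measure" and I A \<theta> \<phi> x0 +
  fixes i0 :: nat
  assumes i0: "i0 \<in> I"
begin

text \<open>Leading coefficients are confined to the direction \<open>i0\<close>, so a single number
  \<open>b\<close> describes the leading behaviour of a whole exponent vector.\<close>

definition leads :: "nat \<Rightarrow> real \<Rightarrow> (nat \<Rightarrow> nat \<Rightarrow> real \<Rightarrow> real) \<Rightarrow> (nat \<Rightarrow> nat \<Rightarrow> real \<Rightarrow> real) \<Rightarrow> bool"
  where "leads r b v w \<longleftrightarrow> (\<forall>i\<in>I. has_order r (if i = i0 then b else 0) (\<lambda>m x. v i m x - w i m x))"

definition vzero :: "nat \<Rightarrow> nat \<Rightarrow> real \<Rightarrow> real"
  where "vzero = (\<lambda>_ _ _. 0)"

definition vshift :: "nat \<Rightarrow> (nat \<Rightarrow> nat \<Rightarrow> real \<Rightarrow> real) \<Rightarrow> nat \<Rightarrow> nat \<Rightarrow> real \<Rightarrow> real"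
  where "vshift h v = (\<lambda>i m x. v i m (x + real h))"

definition vdiff :: "(nat \<Rightarrow> nat \<Rightarrow> real \<Rightarrow> real) \<Rightarrow> (nat \<Rightarrow> nat \<Rightarrow> real \<Rightarrow> real) \<Rightarrow> nat \<Rightarrow> nat \<Rightarrow> real \<Rightarrow> real"
  where "vdiff v w = (\<lambda>i m x. v i m x - w i m x)"

lemma leads_refl: "leads r 0 v v"
  by (simp add: leads_def has_order_zero)

lemma leads_sym: "leads r b v w \<Longrightarrow> leads r (- b) w v"
  unfolding leads_def
proof
  fix i assume *: "\<forall>i\<in>I. has_order r (if i = i0 then b else 0) (\<lambda>m x. v i m x - w i m x)" and i: "i \<in> I"
  have "has_order r (0 - (if i = i0 then b else 0)) (\<lambda>m x. 0 - (v i m x - w i m x))"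
    using * i by (intro has_order_diff has_order_zero) auto
  then show "has_order r (if i = i0 then - b else 0) (\<lambda>m x. w i m x - v i m x)"
    by (simp split: if_splits)
qed

lemma leads_trans:
  assumes "leads r b u v" "leads r c v w"
  shows "leads r (b + c) u w"
  unfolding leads_def
proof
  fix i assume i: "i \<in> I"
  have "has_order r ((if i = i0 then b else 0) - (if i = i0 then - c else 0)) (\<lambda>m x. (u i m x - v i m x) - (w i m x - v i m x))"
    using assms(1) leads_sym[OF assms(2)] i unfolding leads_def by (intro has_order_diff) auto
  then show "has_order r (if i = i0 then b + c else 0) (\<lambda>m x. u i m x - w i m x)"
    by (simp split: if_splits)
qed

lemma leads_shift: "leads r b v w \<Longrightarrow> leads r b (vshift h v) (vshift h w)"
  using has_order_shift unfolding leads_def vshift_def by blast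

lemma leads_Suc: "leads (Suc r) b v vzero \<Longrightarrow> leads r (real h * b) (vshift h v) v"
  unfolding leads_def vshift_def vzero_def
proof
  fix i assume *: "\<forall>i\<in>I. has_order (Suc r) (if i = i0 then b else 0) (\<lambda>m x. v i m x - 0)" and i: "i \<in> I"
  have "has_order r (real h * (if i = i0 then b else 0)) (\<lambda>m x. v i m (x + real h) - v i m x)"
    using * i by (intro has_order_shift_diff) auto
  then show "has_order r (if i = i0 then real h * b else 0) (\<lambda>m x. v i m (x + real h) - v i m x)"
    by (simp split: if_splits)
qed

lemma leads_less: "leads r b v w \<Longrightarrow> r < r' \<Longrightarrow> leads r' 0 v w"
  unfolding leads_def by (auto intro: has_order_less split: if_splits)

lemma leads_le: "leads r b v w \<Longrightarrow> r \<le> r' \<Longrightarrow> \<exists>c. leads r' c v w"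
  using leads_less[of r b v w r'] by (cases "r = r'") auto

lemma leads_unique:
  assumes "leads r b v w" "leads r c v w"
  shows "b = c"
proof (rule has_order_unique)
  show "has_order r b (\<lambda>m x. v i0 m x - w i0 m x)" "has_order r c (\<lambda>m x. v i0 m x - w i0 m x)"
    using assms[unfolded leads_def, THEN bspec, OF i0] by simp_all
qed

lemma leads_vdiff: "leads r b (vdiff v u) (vdiff w u) \<longleftrightarrow> leads r b v w"
  by (simp add: leads_def vdiff_def)

lemma leads_vdiff_vzero: "leads r b (vdiff v u) vzero \<longleftrightarrow> leads r b v u"
  by (simp add: leads_def vdiff_def vzero_def)

text \<open>The shift alters an exponent only in degree \<open>r - 1\<close>.\<close>

lemma leads_shift_self_less:
  assumes "leads q b v vzero" "q \<le> r" "0 < r"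
  shows "leads r 0 v (vshift h v)"
proof -
  obtain r' where r': "r = Suc r'" using assms(3) gr0_implies_Suc by blast
  obtain c where "leads (Suc r') c v vzero" using leads_le[OF assms(1,2)] r' by blast
  from leads_sym[OF leads_Suc[OF this, of h]] show ?thesis
    by (rule leads_less) (simp add: r')
qed

text \<open>A family of exponents \<open>v j\<close> with distinguished member \<open>j1\<close>. The first component of the label \<open>c j\<close>
  bounds the degree of \<open>v j\<close>, and members with equal labels differ by something of lower degree; the labels
  are the classes counted in polynomial exhaustion (PET) induction.\<close>

definition good_family ::
    "nat set \<Rightarrow> nat \<Rightarrow> (nat \<Rightarrow> nat \<Rightarrow> nat \<Rightarrow> real \<Rightarrow> real) \<Rightarrow> (nat \<Rightarrow> nat \<times> nat) \<Rightarrow> bool"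
  where "good_family J j1 v c \<longleftrightarrow> finite J \<and> j1 \<in> J \<and>
    (\<forall>j\<in>J. \<exists>b. leads (fst (c j)) b (v j) vzero) \<and>
    (\<forall>j\<in>J. \<forall>j'\<in>J. j \<noteq> j' \<longrightarrow> c j = c j' \<longrightarrow> 1 \<le> fst (c j) \<and> (\<exists>b. leads (fst (c j) - 1) b (v j) (v j'))) \<and>
    1 \<le> fst (c j1) \<and> (\<exists>b. b \<noteq> 0 \<and> leads (fst (c j1)) b (v j1) vzero) \<and>
    (\<forall>j\<in>J. fst (c j) \<le> fst (c j1)) \<and>
    (\<forall>j\<in>J. j \<noteq> j1 \<longrightarrow> c j \<noteq> c j1 \<longrightarrow> (\<exists>b. b \<noteq> 0 \<and> leads (fst (c j1)) b (v j1) (v j))) \<and>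
    (\<forall>j\<in>J. j \<noteq> j1 \<longrightarrow> c j = c j1 \<longrightarrow> (\<exists>r b. 1 \<le> r \<and> r < fst (c j1) \<and> b \<noteq> 0 \<and> leads r b (v j1) (v j)))"

text \<open>The last two clauses say that \<open>v j1\<close> differs from every other member in
  exact degree at least 1. A difference of degree 0 would be bounded and could fuse two factors into
  one whose integral is not known to vanish. Maximality of the degree of \<open>j1\<close> ensures
  that the whole family is slow once \<open>j1\<close> is.\<close>

lemma good_familyD:
  assumes "good_family J j1 v c"
  shows "finite J" "j1 \<in> J"
    and "\<And>j. j \<in> J \<Longrightarrow> \<exists>b. leads (fst (c j)) b (v j) vzero"
    and "\<And>j j'. j \<in> J \<Longrightarrow> j' \<in> J \<Longrightarrow> j \<noteq> j' \<Longrightarrow> c j = c j' \<Longrightarrow> 1 \<le> fst (c j) \<and> (\<exists>b. leads (fst (c j) - 1) b (v j) (v j'))"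
    and "1 \<le> fst (c j1)" "\<exists>b. b \<noteq> 0 \<and> leads (fst (c j1)) b (v j1) vzero"
    and "\<And>j. j \<in> J \<Longrightarrow> fst (c j) \<le> fst (c j1)"
    and "\<And>j. j \<in> J \<Longrightarrow> j \<noteq> j1 \<Longrightarrow> c j \<noteq> c j1 \<Longrightarrow> \<exists>b. b \<noteq> 0 \<and> leads (fst (c j1)) b (v j1) (v j)"
    and "\<And>j. j \<in> J \<Longrightarrow> j \<noteq> j1 \<Longrightarrow> c j = c j1 \<Longrightarrow> \<exists>r b. 1 \<le> r \<and> r < fst (c j1) \<and> b \<noteq> 0 \<and> leads r b (v j1) (v j)"
  using assms unfolding good_family_def by blast+

lemma good_familyI:
  assumes "finite J" "j1 \<in> J"
    and "\<And>j. j \<in> J \<Longrightarrow> \<exists>b. leads (fst (c j)) b (v j) vzero"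
    and "\<And>j j'. j \<in> J \<Longrightarrow> j' \<in> J \<Longrightarrow> j \<noteq> j' \<Longrightarrow> c j = c j' \<Longrightarrow> 1 \<le> fst (c j) \<and> (\<exists>b. leads (fst (c j) - 1) b (v j) (v j'))"
    and "1 \<le> fst (c j1)" "\<exists>b. b \<noteq> 0 \<and> leads (fst (c j1)) b (v j1) vzero"
    and "\<And>j. j \<in> J \<Longrightarrow> fst (c j) \<le> fst (c j1)"
    and "\<And>j. j \<in> J \<Longrightarrow> j \<noteq> j1 \<Longrightarrow> c j \<noteq> c j1 \<Longrightarrow> \<exists>b. b \<noteq> 0 \<and> leads (fst (c j1)) b (v j1) (v j)"
    and "\<And>j. j \<in> J \<Longrightarrow> j \<noteq> j1 \<Longrightarrow> c j = c j1 \<Longrightarrow> \<exists>r b. 1 \<le> r \<and> r < fst (c j1) \<and> b \<noteq> 0 \<and> leads r b (v j1) (v j)"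
  shows "good_family J j1 v c"
  using assms unfolding good_family_def by simp

text \<open>Labels of degree 0 are never shared, so removing the member removes its class.\<close>

lemma good_family_delete:
  assumes good: "good_family J j1 v c" and j: "j \<in> J" "fst (c j) = 0"
  shows "good_family (J - {j}) j1 v c"
    and "(image_mset fst (mset_set (c ` (J - {j}))), image_mset fst (mset_set (c ` J))) \<in> mult1 less_than"
proof -
  note D = good_familyD[OF good]
  have ne: "j \<noteq> j1" using D(5) j(2) by auto
  show "good_family (J - {j}) j1 v c"
    by (rule good_familyI) (use D ne in \<open>auto simp del: One_nat_def\<close>)
  have "c j' \<noteq> c j" if "j' \<in> J" "j' \<noteq> j" for j'
    using D(4)[OF j(1) that(1)] that j(2) by force
  note ne_label = this
  have img: "c ` (J - {j}) = c ` J - {c j}"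
  proof (intro equalityI subsetI)
    fix x assume "x \<in> c ` (J - {j})"
    then obtain j' where "j' \<in> J" "j' \<noteq> j" "x = c j'" by blast
    then show "x \<in> c ` J - {c j}" using ne_label[of j'] by simp
  next
    fix x assume "x \<in> c ` J - {c j}"
    then obtain j' where "j' \<in> J" "x = c j'" "c j' \<noteq> c j" by blast
    then show "x \<in> c ` (J - {j})" by (intro image_eqI[of _ _ j']) auto
  qed
  show "(image_mset fst (mset_set (c ` (J - {j}))), image_mset fst (mset_set (c ` J))) \<in> mult1 less_than"
    using D(1) j(1) by (intro mult1_class_degrees[where a = "c j"]) (auto simp: img)
qed

text \<open>A member sharing the label of \<open>j1\<close> would differ from it in a degree at
  least 1 and less than 1. So the labels differ, and with them the slopes.\<close>

lemma good_family_slow: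
  assumes good: "good_family J j1 v c" and deg: "fst (c j1) = 1"
  obtains b where "b j1 \<noteq> 0" "\<And>j. j \<in> J \<Longrightarrow> j \<noteq> j1 \<Longrightarrow> b j \<noteq> b j1" "\<And>j. j \<in> J \<Longrightarrow> leads 1 (b j) (v j) vzero"
proof -
  note D = good_familyD[OF good]
  have "\<forall>j\<in>J. \<exists>b. leads 1 b (v j) vzero"
  proof
    fix j assume j: "j \<in> J"
    obtain b where "leads (fst (c j)) b (v j) vzero" using D(3)[OF j] by blast
    then show "\<exists>b. leads 1 b (v j) vzero" using leads_le D(7)[OF j] deg by metis
  qed
  from bchoice[OF this] obtain b where b: "\<forall>j\<in>J. leads 1 (b j) (v j) vzero" by blast
  show thesis
  proof (rule that[of b])
    obtain b1 where "b1 \<noteq> 0" "leads 1 b1 (v j1) vzero" using D(6) deg by auto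
    then show "b j1 \<noteq> 0" using leads_unique b D(2) by blast
    fix j assume j: "j \<in> J" "j \<noteq> j1"
    have "c j \<noteq> c j1" using D(9)[OF j] deg by force
    then obtain \<beta> where \<beta>: "\<beta> \<noteq> 0" "leads 1 \<beta> (v j1) (v j)" using D(8)[OF j] deg by auto
    have "leads 1 (\<beta> + b j) (v j1) vzero" using leads_trans[OF \<beta>(2)] b j(1) by blast
    then have "b j1 = \<beta> + b j" using leads_unique b D(2) by blast
    then show "b j \<noteq> b j1" using \<beta>(1) by simp
  qed (use b in auto)
qed

text \<open>A step produces leading coefficients of the form \<beta> - h b1 up to sign, which cannot
  vanish once the shift part dominates.\<close>

lemma eventually_shift_dominates:
  assumes "finite J" and b1: "b1 \<noteq> (0::real)"
  obtains H0 where "1 \<le> H0"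
    "\<And>h j \<beta>. H0 \<le> h \<Longrightarrow> j \<in> J \<Longrightarrow> leads r \<beta> u (v j) \<Longrightarrow> \<bar>\<beta>\<bar> < real h * \<bar>b1\<bar>"
proof -
  \<comment> \<open>Where no \<beta> exists, the value of \<open>THE\<close> is arbitrary and can
    only enlarge \<open>S\<close>.\<close>
  define \<beta>f where "\<beta>f j = (THE \<beta>. leads r \<beta> u (v j))" for j
  define S where "S = (\<Sum>j\<in>J. \<bar>\<beta>f j\<bar>)"
  show thesis
  proof
    show "1 \<le> Suc (nat \<lceil>S / \<bar>b1\<bar>\<rceil>)" by simp
    fix h j \<beta> assume h: "Suc (nat \<lceil>S / \<bar>b1\<bar>\<rceil>) \<le> h" and j: "j \<in> J" and \<beta>: "leads r \<beta> u (v j)"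
    have "\<beta>f j = \<beta>" unfolding \<beta>f_def using \<beta> leads_unique by (intro the_equality) auto
    then have "\<bar>\<beta>\<bar> \<le> S" unfolding S_def using j assms(1) member_le_sum[of j J "\<lambda>j. \<bar>\<beta>f j\<bar>"] by auto
    also have "S / \<bar>b1\<bar> < real h" using h by linarith
    then have "S < real h * \<bar>b1\<bar>" using b1 by (simp add: divide_less_eq)
    finally show "\<bar>\<beta>\<bar> < real h * \<bar>b1\<bar>" .
  qed
qed

definition vstep :: "nat \<Rightarrow> nat \<Rightarrow> (nat \<Rightarrow> nat \<Rightarrow> nat \<Rightarrow> real \<Rightarrow> real) \<Rightarrow> nat \<Rightarrow> nat \<Rightarrow> nat \<Rightarrow> real \<Rightarrow> real"
  where "vstep h b v y = vdiff (if even y then v (y div 2) else vshift h (v (y div 2))) (v b)"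

lemma double_familyE:
  assumes "y \<in> double_family J b"
  obtains (even) j where "y = 2 * j" "j \<in> J" "j \<noteq> b" | (odd) j where "y = Suc (2 * j)" "j \<in> J"
  using assms by (auto simp: double_family_def)

lemma vstep_simps [simp]:
  "vstep h b v (2 * j) = vdiff (v j) (v b)"
  "vstep h b v (Suc (2 * j)) = vdiff (vshift h (v j)) (v b)"
  by (simp_all add: vstep_def)

lemma double_family_mem [simp]:
  "2 * j \<in> double_family J b \<longleftrightarrow> j \<in> J \<and> j \<noteq> b"
  "Suc (2 * j) \<in> double_family J b \<longleftrightarrow> j \<in> J"
  by (auto simp: double_family_def) presburger+

lemma finite_double_family: "finite J \<Longrightarrow> finite (double_family J b)"
  by (simp add: double_family_def)

text \<open>Subtracting \<open>v b\<close> lowers the degree of everything in the class of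
  \<open>b\<close>, whose copies get labels of their own. All other members keep their label:
  \<open>b\<close> has minimal degree, and in a difference of two members the subtracted
  \<open>v b\<close> cancels, while a shift matters only in lower degree. The distinguished member
  is the unshifted copy of \<open>j1\<close>; its new leading coefficient is that of
  \<open>v j1 - v b\<close>, nonzero because the labels differ. Large \<open>h\<close> keeps it
  apart from shifted copies of its own class.\<close>

lemma good_family_step_other_class:
  assumes good: "good_family J j1 v c" and b: "b \<in> J" "c b \<noteq> c j1"
    and min: "\<And>j. j \<in> J \<Longrightarrow> fst (c b) \<le> fst (c j)" and deg: "1 \<le> fst (c b)" "2 \<le> fst (c j1)"
    and b1: "b1 \<noteq> 0" "leads (fst (c j1)) b1 (v j1) vzero"
    and h: "1 \<le> h" "\<And>j \<beta>. j \<in> J \<Longrightarrow> leads (fst (c j1) - 1) \<beta> (v j1) (v j) \<Longrightarrow> \<bar>\<beta>\<bar> < real h * \<bar>b1\<bar>"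
  defines "c' \<equiv> (\<lambda>y. if c (y div 2) = c b then (fst (c b) - 1, y) else c (y div 2))"
  shows "good_family (double_family J b) (2 * j1) (vstep h b v) c'"
    and "(image_mset fst (mset_set (c' ` double_family J b)), image_mset fst (mset_set (c ` J))) \<in> mult1 less_than"
proof -
  note D = good_familyD[OF good]
  define r where "r = fst (c b)"
  define r1 where "r1 = fst (c j1)"
  have r: "1 \<le> r" "r - 1 < r" and r1: "2 \<le> r1" using deg by (auto simp: r_def r1_def)
  have c'_fresh: "c' y = (r - 1, y)" if "c (y div 2) = c b" for y using that by (simp add: c'_def r_def)
  have c'_old: "c' y = c (y div 2)" if "c (y div 2) \<noteq> c b" for y using that by (simp add: c'_def)
  have in_J: "y div 2 \<in> J" if "y \<in> double_family J b" for y using that by (rule double_familyE) auto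
  have shift_self: "\<exists>\<beta>. leads (fst (c j) - 1) \<beta> (vshift h (v j)) (v j)" if "j \<in> J" for j
  proof -
    have "1 \<le> fst (c j)" using min[OF that] deg by linarith
    then obtain q where q: "fst (c j) = Suc q" by (cases "fst (c j)") auto
    then show ?thesis using D(3)[OF that] leads_Suc by fastforce
  qed
  have lower: "\<exists>\<beta>. leads (fst (c j) - 1) \<beta> (v j) (v j')" if "j \<in> J" "j' \<in> J" "c j = c j'" for j j'
    using D(4)[OF that(1,2)] that(3) leads_refl by (cases "j = j'") blast+
  have step_lower: "\<exists>\<beta>. leads (fst (c (y div 2)) - 1) \<beta> (if even y then v (y div 2) else vshift h (v (y div 2))) (v j')"
    if "y div 2 \<in> J" "j' \<in> J" "c (y div 2) = c j'" for y j'
  proof (cases "even y")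
    case False
    note lows = lower[OF that] shift_self[OF that(1)]
    obtain \<beta> \<gamma> where "leads (fst (c (y div 2)) - 1) \<beta> (vshift h (v (y div 2))) (v (y div 2))"
      "leads (fst (c (y div 2)) - 1) \<gamma> (v (y div 2)) (v j')"
      using lows by blast
    from leads_trans[OF this] show ?thesis using False by auto
  qed (use lower[OF that] in simp)
  show "good_family (double_family J b) (2 * j1) (vstep h b v) c'"
  proof (rule good_familyI)
    show "finite (double_family J b)" by (rule finite_double_family[OF D(1)])
    show "2 * j1 \<in> double_family J b" using D(2) b by auto
  next
    fix y assume y: "y \<in> double_family J b"
    let ?j = "y div 2"
    show "\<exists>\<beta>. leads (fst (c' y)) \<beta> (vstep h b v y) vzero"
    proof (cases "c ?j = c b")
      case True
      then show ?thesis
        using step_lower[OF in_J[OF y] b(1)] by (simp add: c'_fresh vstep_def leads_vdiff_vzero r_def)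
    next
      case False
      obtain \<beta>1 where 1: "leads (fst (c ?j)) \<beta>1 (v ?j) vzero" using D(3)[OF in_J[OF y]] by blast
      obtain \<beta>2 where "leads (fst (c b)) \<beta>2 (v b) vzero" using D(3)[OF b(1)] by blast
      then obtain \<beta>3 where 2: "leads (fst (c ?j)) \<beta>3 (v b) vzero" using leads_le min[OF in_J[OF y]] by blast
      have "\<exists>\<beta>. leads (fst (c ?j)) \<beta> (if even y then v ?j else vshift h (v ?j)) vzero"
      proof (cases "even y")
        case False
        have "vshift h vzero = vzero" by (simp add: vshift_def vzero_def)
        then show ?thesis using leads_shift[OF 1, of h] False by auto
      qed (use 1 in auto)
      then obtain \<beta> where "leads (fst (c ?j)) \<beta> (if even y then v ?j else vshift h (v ?j)) vzero" by blast
      from leads_trans[OF this leads_sym[OF 2]] show ?thesis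
        using c'_old[OF False] unfolding vstep_def leads_vdiff_vzero by auto
    qed
  next
    fix y y' assume y: "y \<in> double_family J b" "y' \<in> double_family J b" and ne: "y \<noteq> y'" and eq: "c' y = c' y'"
    let ?j = "y div 2" and ?j' = "y' div 2"
    \<comment> \<open>Since \<open>r\<close> is the minimal degree, the labels of degree
      \<open>r - 1\<close> are new, so a coincidence of labels never involves the class of
      \<open>b\<close>.\<close>
    have fst_r: "fst (c (z div 2)) \<noteq> r - 1" if "z \<in> double_family J b" for z
      using min[OF in_J[OF that]] r by (simp add: r_def)
    have 1: "c ?j \<noteq> c b"
    proof
      assume *: "c ?j = c b"
      then show False using eq ne fst_r[OF y(2)] c'_fresh[OF *] c'_fresh[of y'] c'_old[of y'] by (metis fst_conv snd_conv)
    qed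
    moreover have 2: "c ?j' \<noteq> c b"
    proof
      assume *: "c ?j' = c b"
      then show False using eq ne fst_r[OF y(1)] c'_fresh[OF *] c'_fresh[of y] c'_old[of y] by (metis fst_conv snd_conv)
    qed
    ultimately have cc: "c ?j = c ?j'" using eq by (simp add: c'_old)
    obtain \<beta>1 where s1: "leads (fst (c ?j) - 1) \<beta>1 (if even y then v ?j else vshift h (v ?j)) (v ?j)"
      using step_lower[OF in_J[OF y(1)] in_J[OF y(1)] refl] by blast
    obtain \<beta>2 where s2: "leads (fst (c ?j) - 1) \<beta>2 (if even y' then v ?j' else vshift h (v ?j')) (v ?j)"
      using step_lower[OF in_J[OF y(2)] in_J[OF y(1)] cc[symmetric]] cc by auto
    from leads_trans[OF s1 leads_sym[OF s2]] show "1 \<le> fst (c' y) \<and> (\<exists>\<beta>. leads (fst (c' y) - 1) \<beta> (vstep h b v y) (vstep h b v y'))"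
      using c'_old[OF 1] min[OF in_J[OF y(1)]] deg by (auto simp: vstep_def leads_vdiff)
  next
    have c'1: "c' (2 * j1) = c j1" using b by (simp add: c'_def)
    show "1 \<le> fst (c' (2 * j1))" using r1 by (simp add: c'1 r1_def)
    show "\<exists>\<beta>. \<beta> \<noteq> 0 \<and> leads (fst (c' (2 * j1))) \<beta> (vstep h b v (2 * j1)) vzero"
      using D(8)[OF b(1)] b(2) by (auto simp: c'1 leads_vdiff_vzero)
    show "fst (c' y) \<le> fst (c' (2 * j1))" if "y \<in> double_family J b" for y
      using D(7)[OF in_J[OF that]] D(7)[OF b(1)] unfolding c'1 by (auto simp: c'_def)
    have b1': "leads (Suc (r1 - 1)) b1 (v j1) vzero" using b1 r1 by (simp add: r1_def)
    show "\<exists>\<beta>. \<beta> \<noteq> 0 \<and> leads (fst (c' (2 * j1))) \<beta> (vstep h b v (2 * j1)) (vstep h b v y)"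
      if y: "y \<in> double_family J b" "y \<noteq> 2 * j1" "c' y \<noteq> c' (2 * j1)" for y
    proof -
      let ?j = "y div 2"
      have ne: "c ?j \<noteq> c j1"
      proof
        assume "c ?j = c j1"
        then have "c' y = c j1" using b(2) by (simp add: c'_old)
        then show False using y(3) c'1 by simp
      qed
      then have "?j \<noteq> j1" by auto
      then obtain \<beta> where \<beta>: "\<beta> \<noteq> 0" "leads r1 \<beta> (v j1) (v ?j)" using D(8)[OF in_J[OF y(1)]] ne r1_def by blast
      obtain \<gamma> where \<gamma>: "leads (fst (c ?j)) \<gamma> (v ?j) vzero" using D(3)[OF in_J[OF y(1)]] by blast
      \<comment> \<open>In degree \<open>r1\<close> a shift is invisible, so the nonzero coefficient
        \<beta> serves for both copies.\<close>
      have "leads r1 0 (v ?j) (vshift h (v ?j))"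
        using D(7)[OF in_J[OF y(1)]] r1 by (intro leads_shift_self_less[OF \<gamma>]) (auto simp: r1_def)
      from leads_trans[OF \<beta>(2) this] \<beta> show ?thesis
        by (cases "even y") (auto simp: vstep_def leads_vdiff c'1 r1_def)
    qed
    show "\<exists>q \<beta>. 1 \<le> q \<and> q < fst (c' (2 * j1)) \<and> \<beta> \<noteq> 0 \<and> leads q \<beta> (vstep h b v (2 * j1)) (vstep h b v y)"
      if y: "y \<in> double_family J b" "y \<noteq> 2 * j1" "c' y = c' (2 * j1)" for y
    proof -
      let ?j = "y div 2"
      have "c ?j \<noteq> c b"
      proof
        assume "c ?j = c b"
        then have "c j1 = (r - 1, y)" using y(3) c'_fresh[of y] c'1 by simp
        then have "r - 1 = r1" by (simp add: r1_def)
        then show False using min[OF D(2)] r by (simp add: r_def r1_def)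
      qed
      then have cj: "c ?j = c j1" using y(3) c'1 by (simp add: c'_old)
      have r1': "1 \<le> r1 - 1" "r1 - 1 < r1" using r1 by auto
      show ?thesis
      proof (cases "?j = j1")
        case True
        then have odd: "odd y" using y(2) by auto
        \<comment> \<open>The distinguished member and its own shifted copy differ in degree
          \<open>r1 - 1\<close>, which is at least 1 because \<open>j1\<close> has degree at least
          2.\<close>
        have "leads (r1 - 1) (- (real h * b1)) (v j1) (vshift h (v j1))"
          by (rule leads_sym[OF leads_Suc[OF b1']])
        then show ?thesis using r1' odd True h(1) b1(1)
          by (intro exI[of _ "r1 - 1"] exI[of _ "- (real h * b1)"]) (auto simp: vstep_def leads_vdiff c'1 r1_def)
      next
        case False
        then obtain q \<beta> where q: "1 \<le> q" "q < r1" "\<beta> \<noteq> 0" "leads q \<beta> (v j1) (v ?j)"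
          using D(9)[OF in_J[OF y(1)]] cj r1_def by blast
        show ?thesis
        proof (cases "even y")
          case True
          then show ?thesis using q by (intro exI[of _ q] exI[of _ \<beta>]) (auto simp: vstep_def leads_vdiff c'1 r1_def)
        next
          case odd: False
          \<comment> \<open>Being in the class of \<open>j1\<close>, the member has the same leading
            coefficient \<open>b1\<close>, so its shift contributes \<open>real h * b1\<close> in
            degree \<open>r1 - 1\<close>; this dominates whatever coefficient \<gamma> the
            difference from \<open>v j1\<close> has there.\<close>
          have "leads r1 (- 0 + b1) (v ?j) vzero"
            by (rule leads_trans[OF leads_sym[OF leads_less[OF q(4,2)]]]) (use b1 r1_def in auto)
          then have "leads (Suc (r1 - 1)) b1 (v ?j) vzero" using r1 by simp
          from leads_sym[OF leads_Suc[OF this, of h]]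
          have s: "leads (r1 - 1) (- (real h * b1)) (v ?j) (vshift h (v ?j))" .
          have "q \<le> r1 - 1" using q(2) by linarith
          then obtain \<gamma> where \<gamma>: "leads (r1 - 1) \<gamma> (v j1) (v ?j)" using leads_le[OF q(4)] by blast
          have "\<bar>\<gamma>\<bar> < \<bar>real h * b1\<bar>"
            using h(2)[OF in_J[OF y(1)]] \<gamma> by (simp add: abs_mult r1_def)
          then have "\<gamma> + - (real h * b1) \<noteq> 0" by auto
          then show ?thesis using leads_trans[OF \<gamma> s] r1' odd
            by (intro exI[of _ "r1 - 1"] exI[of _ "\<gamma> + - (real h * b1)"]) (auto simp: vstep_def leads_vdiff c'1 r1_def)
        qed
      qed
    qed
  qed
  show "(image_mset fst (mset_set (c' ` double_family J b)), image_mset fst (mset_set (c ` J))) \<in> mult1 less_than"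
  proof (rule mult1_class_degrees[where a = "c b"])
    show "finite (c ` J)" "finite (c' ` double_family J b)" using D(1) finite_double_family by auto
    show "c b \<in> c ` J" using b(1) by simp
    show "c ` J - {c b} \<subseteq> c' ` double_family J b"
    proof
      fix x assume "x \<in> c ` J - {c b}"
      then obtain j where "j \<in> J" "x = c j" "c j \<noteq> c b" by auto
      then have "x = c' (Suc (2 * j))" "Suc (2 * j) \<in> double_family J b" by (auto simp: c'_def)
      then show "x \<in> c' ` double_family J b" by blast
    qed
    fix x assume x: "x \<in> c' ` double_family J b - (c ` J - {c b})"
    then obtain y where y: "y \<in> double_family J b" "x = c' y" by auto
    have "c (y div 2) = c b"
    proof (rule ccontr)
      assume "c (y div 2) \<noteq> c b"
      then have "x \<in> c ` J - {c b}" using y in_J[OF y(1)] by (auto simp: c'_old)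
      then show False using x by blast
    qed
    then show "fst x < fst (c b)" using y(2) c'_fresh[of y] r by (simp add: r_def)
  qed
qed

text \<open>Here \<open>j1\<close> itself serves as the base, and its shifted copy takes over its role.\<close>

lemma good_family_step_single_class:
  assumes good: "good_family J j1 v c" and single: "\<And>j. j \<in> J \<Longrightarrow> c j = c j1" and deg: "2 \<le> fst (c j1)"
    and b1: "b1 \<noteq> 0" "leads (fst (c j1)) b1 (v j1) vzero"
    and h: "1 \<le> h" "\<And>j \<beta>. j \<in> J \<Longrightarrow> leads (fst (c j1) - 1) \<beta> (v j1) (v j) \<Longrightarrow> \<bar>\<beta>\<bar> < real h * \<bar>b1\<bar>"
  defines "c' \<equiv> (\<lambda>y. (fst (c j1) - 1, if odd y \<and> (\<exists>\<beta>. leads (fst (c j1) - 2) \<beta> (v j1) (v (y div 2))) then 0 else Suc y))"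
  shows "good_family (double_family J j1) (Suc (2 * j1)) (vstep h j1 v) c'"
    and "(image_mset fst (mset_set (c' ` double_family J j1)), image_mset fst (mset_set (c ` J))) \<in> mult1 less_than"
proof -
  note D = good_familyD[OF good]
  define s where "s = fst (c j1) - 2"
  have s: "fst (c j1) = Suc (Suc s)" using deg by (simp add: s_def)
  \<comment> \<open>The tag 0 collects the shifted copies of members that agree with
    \<open>v j1\<close> down to degree \<open>s\<close>: their difference from the new distinguished
    member has too low a degree for a class of their own. Every other copy gets its own tag.\<close>
  have c': "c' y = (Suc s, if odd y \<and> (\<exists>\<beta>. leads s \<beta> (v j1) (v (y div 2))) then 0 else Suc y)" for y
    by (simp add: c'_def s)
  have c'1: "c' (Suc (2 * j1)) = (Suc s, 0)" using leads_refl by (auto simp: c')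
  have in_J: "y div 2 \<in> J" if "y \<in> double_family J j1" for y using that by (rule double_familyE) auto
  have lower: "\<exists>\<beta>. leads (Suc s) \<beta> (v j) (v j1)" if "j \<in> J" for j
  proof (cases "j = j1")
    case False
    then show ?thesis using D(4)[OF that D(2) False single[OF that]] single[OF that] s by auto
  qed (use leads_refl in auto)
  have shift1: "leads (Suc s) (real h * b1) (vshift h (v j1)) (v j1)"
    using b1(2) s by (intro leads_Suc) auto
  have shift_self: "\<exists>\<beta>. leads (Suc s) \<beta> (vshift h (v j)) (v j)" if "j \<in> J" for j
    using D(3)[OF that] single[OF that] s leads_Suc by fastforce
  have nz: "real h * b1 \<noteq> 0" using h(1) b1(1) by simp
  show "good_family (double_family J j1) (Suc (2 * j1)) (vstep h j1 v) c'"
  proof (rule good_familyI)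
    show "finite (double_family J j1)" by (rule finite_double_family[OF D(1)])
    show "Suc (2 * j1) \<in> double_family J j1" using D(2) by auto
    show "1 \<le> fst (c' (Suc (2 * j1)))" by (simp add: c'1)
    show "\<exists>\<beta>. \<beta> \<noteq> 0 \<and> leads (fst (c' (Suc (2 * j1)))) \<beta> (vstep h j1 v (Suc (2 * j1))) vzero"
      using shift1 nz unfolding c'1 vstep_simps leads_vdiff_vzero fst_conv by blast
    show "fst (c' y) \<le> fst (c' (Suc (2 * j1)))" if "y \<in> double_family J j1" for y by (simp add: c')
  next
    fix y assume y: "y \<in> double_family J j1"
    obtain \<beta> \<gamma> where \<beta>: "leads (Suc s) \<beta> (v (y div 2)) (v j1)"
      and \<gamma>: "leads (Suc s) \<gamma> (vshift h (v (y div 2))) (v (y div 2))"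
      using lower[OF in_J[OF y]] shift_self[OF in_J[OF y]] by blast
    have "\<exists>\<beta>. leads (Suc s) \<beta> (if even y then v (y div 2) else vshift h (v (y div 2))) (v j1)"
      using \<beta> leads_trans[OF \<gamma> \<beta>] by (cases "even y") auto
    then show "\<exists>\<beta>. leads (fst (c' y)) \<beta> (vstep h j1 v y) vzero"
      by (simp add: c' vstep_def leads_vdiff_vzero)
  next
    fix y y' assume y: "y \<in> double_family J j1" "y' \<in> double_family J j1" and ne: "y \<noteq> y'" and eq: "c' y = c' y'"
    \<comment> \<open>Positive tags determine \<open>y\<close>, so equal labels of different copies
      must both carry the tag 0.\<close>
    have "odd y \<and> (\<exists>\<beta>. leads s \<beta> (v j1) (v (y div 2)))" "odd y' \<and> (\<exists>\<beta>. leads s \<beta> (v j1) (v (y' div 2)))"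
      using eq ne by (auto simp: c' split: if_splits)
    then obtain \<beta> \<gamma> where "odd y" "odd y'" "leads s \<beta> (v j1) (v (y div 2))" "leads s \<gamma> (v j1) (v (y' div 2))" by blast
    then have "leads s (- \<beta> + \<gamma>) (vshift h (v (y div 2))) (vshift h (v (y' div 2)))"
      by (intro leads_shift leads_trans[OF leads_sym])
    then show "1 \<le> fst (c' y) \<and> (\<exists>\<beta>. leads (fst (c' y) - 1) \<beta> (vstep h j1 v y) (vstep h j1 v y'))"
      using \<open>odd y\<close> \<open>odd y'\<close> by (auto simp: c' vstep_def leads_vdiff)
  next
    fix y assume y: "y \<in> double_family J j1" "y \<noteq> Suc (2 * j1)" "c' y \<noteq> c' (Suc (2 * j1))"
    let ?j = "y div 2"
    show "\<exists>\<beta>. \<beta> \<noteq> 0 \<and> leads (fst (c' (Suc (2 * j1)))) \<beta> (vstep h j1 v (Suc (2 * j1))) (vstep h j1 v y)"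
    proof (cases "even y")
      case True
      obtain \<gamma> where \<gamma>: "leads (Suc s) \<gamma> (v ?j) (v j1)" using lower[OF in_J[OF y(1)]] by blast
      have "\<bar>- \<gamma>\<bar> < real h * \<bar>b1\<bar>" using h(2)[OF in_J[OF y(1)], of "- \<gamma>"] leads_sym[OF \<gamma>] s by simp
      then have "\<bar>\<gamma>\<bar> < \<bar>real h * b1\<bar>" by (simp add: abs_mult)
      \<comment> \<open>The shifted copy of \<open>j1\<close> has leading coefficient
        \<open>real h * b1\<close> after subtraction of \<open>v j1\<close>, and an unshifted copy
        has \<gamma>, which is too small to equal it.\<close>
      then have "real h * b1 + - \<gamma> \<noteq> 0" by auto
      then show ?thesis using leads_trans[OF shift1 leads_sym[OF \<gamma>]] True
        by (intro exI[of _ "real h * b1 + - \<gamma>"]) (auto simp: c'1 vstep_def leads_vdiff)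
    next
      case False
      have notlow: "\<not> (\<exists>\<beta>. leads s \<beta> (v j1) (v ?j))" using y(3)[unfolded c'1] False by (auto simp: c' split: if_splits)
      then have "?j \<noteq> j1" using leads_refl by metis
      then obtain q \<beta> where q: "1 \<le> q" "q < Suc (Suc s)" "\<beta> \<noteq> 0" "leads q \<beta> (v j1) (v ?j)"
        using D(9)[OF in_J[OF y(1)]] single[OF in_J[OF y(1)]] s by metis
      \<comment> \<open>A lower degree of the difference would have given the tag 0.\<close>
      have "q = Suc s"
      proof (rule ccontr)
        assume "q \<noteq> Suc s"
        then have "q \<le> s" using q(2) by simp
        then show False using notlow leads_le[OF q(4)] by blast
      qed
      then show ?thesis using leads_shift[OF q(4), of h] q(3) False by (auto simp: c'1 vstep_def leads_vdiff)
    qed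
  next
    fix y assume y: "y \<in> double_family J j1" "y \<noteq> Suc (2 * j1)" "c' y = c' (Suc (2 * j1))"
    let ?j = "y div 2"
    have "odd y" and low: "\<exists>\<beta>. leads s \<beta> (v j1) (v ?j)" using y(3)[unfolded c'1] by (auto simp: c' split: if_splits)
    then have "?j \<noteq> j1" using y(2) by auto
    then obtain q \<beta> where q: "1 \<le> q" "q < Suc (Suc s)" "\<beta> \<noteq> 0" "leads q \<beta> (v j1) (v ?j)"
      using D(9)[OF in_J[OF y(1)]] single[OF in_J[OF y(1)]] s by metis
    have "q \<noteq> Suc s"
    proof
      assume "q = Suc s"
      moreover have "leads (Suc s) 0 (v j1) (v ?j)" using low leads_less by blast
      ultimately show False using leads_unique q(3,4) by blast
    qed
    then have "q < Suc s" using q(2) by simp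
    then show "\<exists>q \<beta>. 1 \<le> q \<and> q < fst (c' (Suc (2 * j1))) \<and> \<beta> \<noteq> 0 \<and>
        leads q \<beta> (vstep h j1 v (Suc (2 * j1))) (vstep h j1 v y)"
      using leads_shift[OF q(4), of h] q \<open>odd y\<close> by (auto simp: c'1 vstep_def leads_vdiff)
  qed
  have "c ` J = (\<lambda>_. c j1) ` J" by (rule image_cong[OF refl single])
  also have "\<dots> = {c j1}" by (rule image_constant[OF D(2)])
  finally have img: "c ` J = {c j1}" .
  show "(image_mset fst (mset_set (c' ` double_family J j1)), image_mset fst (mset_set (c ` J))) \<in> mult1 less_than"
    unfolding img
    by (rule mult1_class_degrees[where a = "c j1"]) (use finite_double_family[OF D(1)] in \<open>auto simp: c' s\<close>)
qed

text \<open>PET induction. A member of degree 0 has bounded exponents and becomes one of finitely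
  many fixed factors; degree 1 is the slow case. Otherwise a van der Corput step needs a base of
  minimal degree, as subtracting a larger one would raise degrees. A class other than that of
  \<open>j1\<close> is preferred as base, since \<open>j1\<close> can then remain
  distinguished.\<close>

lemma mean_null_good_family:
  assumes "good_family J j1 v c" and "\<And>j. j \<in> J \<Longrightarrow> bounded_measurable M (f j)" and "(\<integral>x. f j1 x \<partial>M) = 0"
    and "\<And>j. j \<in> J \<Longrightarrow> approximates (m j) (\<lambda>i. v j i 0)"
  shows "mean_null (\<lambda>_. 1) (\<lambda>n x. \<Prod>j\<in>J. f j (A (m j n) x))"
  using assms
proof (induction "image_mset fst (mset_set (c ` J))" arbitrary: J j1 v c f m rule: wf_induct_rule[OF wf_mult1[OF wf_less_than]])
  case less: (1 J c j1 v f m)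
  note good = less.prems(1) and f = less.prems(2) and f0 = less.prems(3) and m = less.prems(4)
  note D = good_familyD[OF good]
  show ?case
  proof (cases "\<exists>j\<in>J. fst (c j) = 0")
    case True
    then obtain j where j: "j \<in> J" "fst (c j) = 0" by blast
    have ne: "j \<noteq> j1" using D(5) j(2) by auto
    have null: "mean_null (\<lambda>_. 1) (\<lambda>n x. \<Prod>j\<in>J - {j}. f j (A (m j n) x))"
      by (rule less.hyps[OF good_family_delete(2)[OF good j] good_family_delete(1)[OF good j]]) (use f f0 m in auto)
    \<comment> \<open>The index \<open>j'\<close> ranges over a singleton merely to match the form
      of \<open>uniform_Bseq\<close>.\<close>
    have bs: "Bseq (\<lambda>n. real_of_int (m j n i))" if "j' \<in> {j}" and i: "i \<in> I" for i j'
    proof -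
      obtain b where "leads 0 b (v j) vzero" using D(3)[OF j(1)] j(2) by auto
      then have "has_order 0 (if i = i0 then b else 0) (v j i)" using i by (simp add: leads_def vzero_def)
      then have "Bseq (\<lambda>n. v j i 0 (real n))" by (rule has_order_0_Bseq)
      moreover have "Bseq (\<lambda>n. real_of_int (m j n i) - v j i 0 (real n))" using m[OF j(1)] i by (simp add: approximates_def)
      ultimately have "Bseq (\<lambda>n. v j i 0 (real n) + (real_of_int (m j n i) - v j i 0 (real n)))" by (rule Bseq_plus)
      then show ?thesis by simp
    qed
    have "\<exists>C. \<forall>j'\<in>{j}. \<forall>i\<in>I. \<forall>n. \<bar>real_of_int (m j n i)\<bar> \<le> C"
      by (rule uniform_Bseq) (use bs in simp_all)
    then obtain C where C: "\<And>i n. i \<in> I \<Longrightarrow> \<bar>real_of_int (m j n i)\<bar> \<le> C" by blast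
    have "mean_null (\<lambda>_. 1) (\<lambda>n x. f j (A (box_proj (m j n)) x) * (\<Prod>j\<in>J - {j}. f j (A (m j n) x)))"
    proof (rule mean_null_finite_choice[where E = "box C" and s = "\<lambda>n. box_proj (m j n)"
          and y = "\<lambda>e n x. f j (A e x) * (\<Prod>j\<in>J - {j}. f j (A (m j n) x))"])
      show "finite (box C)" by (rule finite_box)
      show "mean_null (\<lambda>_. 1) (\<lambda>n x. f j (A e x) * (\<Prod>j\<in>J - {j}. f j (A (m j n) x)))" for e
        using f j(1) by (intro mean_null_mult[OF null] bounded_measurable_prod_A bounded_measurable_A) auto
      show "bounded_measurable M (\<lambda>x. f j (A e x) * (\<Prod>j\<in>J - {j}. f j (A (m j n) x)))" for e n
        using f j(1) by (intro bounded_measurable_mult bounded_measurable_prod_A bounded_measurable_A) auto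
      show "box_proj (m j n) \<in> box C" for n by (rule box_proj_in_box[OF C])
    qed simp
    then show ?thesis using D(1) j(1) by (simp add: A_box_proj prod.remove[of J j])
  next
    case False
    then have pos: "1 \<le> fst (c j)" if "j \<in> J" for j using that by force
    show ?thesis
    proof (cases "fst (c j1) = 1")
      case True
      obtain b where b: "b j1 \<noteq> 0" "\<And>j. j \<in> J \<Longrightarrow> j \<noteq> j1 \<Longrightarrow> b j \<noteq> b j1" "\<And>j. j \<in> J \<Longrightarrow> leads 1 (b j) (v j) vzero"
        using good_family_slow[OF good True] by blast
      have order: "has_order 1 (if i = i0 then b j else 0) (v j i)" if "j \<in> J" "i \<in> I" for j i
        using b(3)[OF that(1)] that(2) by (simp add: leads_def vzero_def)
      show ?thesis
      proof (rule mean_null_slow_family[where v = "\<lambda>j i. v j i 0" and v' = "\<lambda>j i. v j i 1" and b = b and ?j1.0 = j1,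
            OF i0 D(1,2) x0 \<phi>_deriv \<theta>_pos \<theta>_anti x\<theta>_top \<phi>_top])
        show "\<forall>\<^sub>F x in at_top. (v j i 0 has_real_derivative v j i 1 x) (at x)" if "j \<in> J" "i \<in> I" for j i
          using order[OF that] unfolding has_order_def tower_def by (auto elim!: eventually_mono)
        show "((\<lambda>x. v j i 1 x / \<theta> x) \<longlongrightarrow> (if i = i0 then b j else 0)) at_top" if "j \<in> J" "i \<in> I" for j i
          using order[OF that] unfolding has_order_def by blast
      qed (use b f f0 m in auto)
    next
      case False
      then have deg: "2 \<le> fst (c j1)" using D(5) by linarith
      obtain b1 where b1: "b1 \<noteq> 0" "leads (fst (c j1)) b1 (v j1) vzero" using D(6) by blast
      obtain H0 where H0: "1 \<le> H0" "\<And>h j \<beta>. H0 \<le> h \<Longrightarrow> j \<in> J \<Longrightarrow> leads (fst (c j1) - 1) \<beta> (v j1) (v j) \<Longrightarrow> \<bar>\<beta>\<bar> < real h * \<bar>b1\<bar>"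
        using eventually_shift_dominates[OF D(1) b1(1)] by metis
      have reduce: ?thesis if b: "b \<in> J"
        and step: "\<And>h. H0 \<le> h \<Longrightarrow> \<exists>j' c'. good_family (double_family J b) j' (vstep h b v) c' \<and> j' div 2 = j1 \<and>
          (image_mset fst (mset_set (c' ` double_family J b)), image_mset fst (mset_set (c ` J))) \<in> mult1 less_than" for b
      proof (rule mean_null_van_der_corput_step[where ?H0.0 = H0, OF D(1) b f])
        fix h assume "H0 \<le> h"
        from step[OF this] obtain j' c' where good': "good_family (double_family J b) j' (vstep h b v) c'" and j': "j' div 2 = j1"
          and dec: "(image_mset fst (mset_set (c' ` double_family J b)), image_mset fst (mset_set (c ` J))) \<in> mult1 less_than"
          by blast
        have in_J: "y div 2 \<in> J" if "y \<in> double_family J b" for y using that by (rule double_familyE) auto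
        show "mean_null (\<lambda>_. 1) (\<lambda>n x. \<Prod>y\<in>double_family J b.
            (if even y then \<lambda>z. cnj (f (y div 2) z) else f (y div 2))
            (A (\<lambda>i. (if even y then m (y div 2) n i else m (y div 2) (n + h) i) - m b n i) x))"
        proof (rule less.hyps[OF dec good'])
          show "bounded_measurable M (if even y then \<lambda>z. cnj (f (y div 2) z) else f (y div 2))"
            if "y \<in> double_family J b" for y
            using f[OF in_J[OF that]] by (auto intro: bounded_measurable_cnj)
          show "expectation (if even j' then \<lambda>z. cnj (f (j' div 2) z) else f (j' div 2)) = 0"
            using f0 by (simp add: j')
          show "approximates (\<lambda>n i. (if even y then m (y div 2) n i else m (y div 2) (n + h) i) - m b n i) (\<lambda>i. vstep h b v y i 0)"
            if "y \<in> double_family J b" for y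
          proof (cases "even y")
            case True
            then show ?thesis
              using approximates_diff[OF m[OF in_J[OF that]] m[OF b]] by (simp add: vstep_def vdiff_def)
          next
            case False
            then show ?thesis
              using approximates_diff[OF approximates_shift[OF m[OF in_J[OF that]], of h] m[OF b]]
              by (simp add: vstep_def vdiff_def vshift_def)
          qed
        qed
      qed
      define r where "r = Min (fst ` c ` J)"
      have r_le: "r \<le> fst (c j)" if "j \<in> J" for j unfolding r_def using that D(1) by (intro Min_le) auto
      have "r \<in> fst ` c ` J" unfolding r_def using D(1,2) by (intro Min_in) auto
      then obtain b0 where b0: "b0 \<in> J" "fst (c b0) = r" by auto
      show ?thesis
      proof (cases "\<exists>b\<in>J. fst (c b) = r \<and> c b \<noteq> c j1")
        case True
        then obtain b where b: "b \<in> J" "fst (c b) = r" "c b \<noteq> c j1" by blast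
        show ?thesis
        proof (rule reduce[OF b(1)])
          fix h assume h: "H0 \<le> h"
          have min: "fst (c b) \<le> fst (c j)" if "j \<in> J" for j using r_le[OF that] b(2) by simp
          have h1: "1 \<le> h" using h H0(1) by simp
          define c' where "c' = (\<lambda>y. if c (y div 2) = c b then (fst (c b) - 1, y) else c (y div 2))"
          have "good_family (double_family J b) (2 * j1) (vstep h b v) c'"
            "(image_mset fst (mset_set (c' ` double_family J b)), image_mset fst (mset_set (c ` J))) \<in> mult1 less_than"
            unfolding c'_def
            by (rule good_family_step_other_class[OF good b(1,3) _ pos[OF b(1)] deg b1 h1];
              (erule min | erule (1) H0(2)[OF h]))+
          then show "\<exists>j' c'. good_family (double_family J b) j' (vstep h b v) c' \<and> j' div 2 = j1 \<and>
            (image_mset fst (mset_set (c' ` double_family J b)), image_mset fst (mset_set (c ` J))) \<in> mult1 less_than"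
            by (intro exI[of _ "2 * j1"] exI[of _ c']) simp
        qed
      next
        case False
        \<comment> \<open>If the minimal degree occurs in the class of \<open>j1\<close> only, it is
          the degree of \<open>j1\<close>, which is also the maximum; hence there is just one
          class.\<close>
        then have "r = fst (c j1)" using b0 by auto
        then have "fst (c j) = r" if "j \<in> J" for j using r_le[OF that] D(7)[OF that] by simp
        then have single: "c j = c j1" if "j \<in> J" for j using False that by blast
        show ?thesis
        proof (rule reduce[OF D(2)])
          fix h assume h: "H0 \<le> h"
          have h1: "1 \<le> h" using h H0(1) by simp
          define c' where "c' = (\<lambda>y. (fst (c j1) - 1,
            if odd y \<and> (\<exists>\<beta>. leads (fst (c j1) - 2) \<beta> (v j1) (v (y div 2))) then 0 else Suc y))"
          have "good_family (double_family J j1) (Suc (2 * j1)) (vstep h j1 v) c'"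
            "(image_mset fst (mset_set (c' ` double_family J j1)), image_mset fst (mset_set (c ` J))) \<in> mult1 less_than"
            unfolding c'_def
            by (rule good_family_step_single_class[OF good _ deg b1 h1];
              (erule single | erule (1) H0(2)[OF h]))+
          then show "\<exists>j' c'. good_family (double_family J j1) j' (vstep h j1 v) c' \<and> j' div 2 = j1 \<and>
            (image_mset fst (mset_set (c' ` double_family J j1)), image_mset fst (mset_set (c ` J))) \<in> mult1 less_than"
            by (intro exI[of _ "Suc (2 * j1)"] exI[of _ c']) simp
        qed
      qed
    qed
  qed
qed

end

section \<open>Tempered functions\<close>

lemma eventually_const_sign:
  fixes F :: "real \<Rightarrow> real"
  assumes deriv: "\<forall>\<^sub>F x in at_top. (F has_real_derivative F' x) (at x)" and nz: "\<forall>\<^sub>F x in at_top. F x \<noteq> 0"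
  obtains \<sigma> :: real where "\<bar>\<sigma>\<bar> = 1" "\<forall>\<^sub>F x in at_top. 0 < \<sigma> * F x"
proof -
  have "\<forall>\<^sub>F x in at_top. (F has_real_derivative F' x) (at x) \<and> F x \<noteq> 0"
    using deriv nz by eventually_elim auto
  then obtain x1 where x1: "\<And>x. x1 \<le> x \<Longrightarrow> (F has_real_derivative F' x) (at x)" "\<And>x. x1 \<le> x \<Longrightarrow> F x \<noteq> 0"
    by (auto simp: eventually_at_top_linorder)
  define \<sigma> where "\<sigma> = sgn (F x1)"
  have "0 < \<sigma> * F x" if x: "x1 \<le> x" for x
  proof (rule ccontr)
    assume neg: "\<not> 0 < \<sigma> * F x"
    have cont: "\<forall>y. x1 \<le> y \<and> y \<le> x \<longrightarrow> isCont (\<lambda>y. - (\<sigma> * F y)) y"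
      using x1(1) by (auto intro!: continuous_minus continuous_mult continuous_const intro: DERIV_isCont)
    have "0 < \<sigma> * F x1" using x1(2)[of x1] by (auto simp: \<sigma>_def sgn_if)
    then obtain y where "x1 \<le> y" "- (\<sigma> * F y) = 0"
      using IVT[of "\<lambda>y. - (\<sigma> * F y)" x1 0 x] neg x cont by (auto simp: not_less)
    then show False using x1(2)[of y] x1(2)[of x1] by (simp add: \<sigma>_def sgn_eq_0_iff)
  qed
  then have "\<forall>\<^sub>F x in at_top. 0 < \<sigma> * F x" by (auto simp: eventually_at_top_linorder)
  moreover have "\<bar>\<sigma>\<bar> = 1" using x1(2)[of x1] by (simp add: \<sigma>_def abs_sgn_eq)
  ultimately show thesis by (rule that[rotated])
qed

text \<open>Eventually the derivative of ln (F^2) is at least L / x, so the modulus of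
  \<open>F\<close> grows at least like a multiple of x to the power L / 2. The square avoids a case
  distinction on the sign.\<close>

lemma abs_at_top_of_log_derivative:
  fixes F :: "real \<Rightarrow> real"
  assumes deriv: "\<forall>\<^sub>F x in at_top. (F has_real_derivative F' x) (at x)" and nz: "\<forall>\<^sub>F x in at_top. F x \<noteq> 0"
    and lim: "((\<lambda>x. x * F' x / F x) \<longlongrightarrow> L) at_top" and L: "0 < L"
  shows "filterlim (\<lambda>x. \<bar>F x\<bar>) at_top at_top"
proof -
  have "\<forall>\<^sub>F x in at_top. L / 2 < x * F' x / F x" using lim L by (intro order_tendstoD(1)) auto
  then have "\<forall>\<^sub>F x in at_top. (F has_real_derivative F' x) (at x) \<and> F x \<noteq> 0 \<and> L / 2 < x * F' x / F x \<and> 0 < x"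
    using deriv nz eventually_gt_at_top[of 0] by eventually_elim auto
  then obtain x1 where x1: "\<And>x. x1 \<le> x \<Longrightarrow> (F has_real_derivative F' x) (at x)" "\<And>x. x1 \<le> x \<Longrightarrow> F x \<noteq> 0"
      "\<And>x. x1 \<le> x \<Longrightarrow> L / 2 < x * F' x / F x" "\<And>x. x1 \<le> x \<Longrightarrow> 0 < x"
    unfolding eventually_at_top_linorder by blast
  define H where "H x = ln ((F x)\<^sup>2) - L * ln x" for x
  have H: "H x1 \<le> H x" if x: "x1 \<le> x" for x
  proof (rule DERIV_nonneg_imp_nondecreasing[OF x])
    fix y assume y: "x1 \<le> y" "y \<le> x"
    have nzy: "0 < (F y)\<^sup>2" "0 < y" using x1(2,4)[OF y(1)] by auto
    have "(H has_real_derivative (1 / (F y)\<^sup>2) * (2 * F y * F' y) - L * (1 / y)) (at y)"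
      unfolding H_def[abs_def] using nzy by (auto intro!: derivative_eq_intros x1(1)[OF y(1)])
    moreover have "0 \<le> (1 / (F y)\<^sup>2) * (2 * F y * F' y) - L * (1 / y)"
    proof -
      have "(1 / (F y)\<^sup>2) * (2 * F y * F' y) = 2 * (y * F' y / F y) / y"
        using nzy by (simp add: power2_eq_square field_simps)
      moreover have "L / y \<le> 2 * (y * F' y / F y) / y" using less_imp_le[OF x1(3)[OF y(1)]] nzy(2) by (intro divide_right_mono) linarith+
      ultimately show ?thesis by simp
    qed
    ultimately show "\<exists>z. (H has_real_derivative z) (at y) \<and> 0 \<le> z" by blast
  qed
  have "filterlim (\<lambda>x. exp ((H x1 + L * ln x) / 2)) at_top at_top" using L by real_asymp
  moreover have "\<forall>\<^sub>F x in at_top. exp ((H x1 + L * ln x) / 2) \<le> \<bar>F x\<bar>"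
    using eventually_ge_at_top[of x1]
  proof eventually_elim
    case (elim x)
    have "ln ((F x)\<^sup>2) = 2 * ln \<bar>F x\<bar>" using ln_realpow[of "\<bar>F x\<bar>" 2] x1(2)[OF elim] by simp
    then have "(H x1 + L * ln x) / 2 \<le> ln \<bar>F x\<bar>" using H[OF elim] by (simp add: H_def)
    then have "exp ((H x1 + L * ln x) / 2) \<le> exp (ln \<bar>F x\<bar>)" by simp
    then show ?case using x1(2)[OF elim] by simp
  qed
  ultimately show ?thesis by (rule filterlim_at_top_mono)
qed

text \<open>L'Hospital's rule for x F' / F: the quotient of the derivatives is 1 + x F'' / F'. The
  sign \<sigma> makes the denominator tend to plus infinity.\<close>

lemma log_derivative_limit_Suc:
  fixes F :: "real \<Rightarrow> real"
  assumes deriv: "\<forall>\<^sub>F x in at_top. (F has_real_derivative F' x) (at x)"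
    and deriv': "\<forall>\<^sub>F x in at_top. (F' has_real_derivative F'' x) (at x)"
    and nz: "\<forall>\<^sub>F x in at_top. F x \<noteq> 0" and nz': "\<forall>\<^sub>F x in at_top. F' x \<noteq> 0"
    and lim: "((\<lambda>x. x * F' x / F x) \<longlongrightarrow> L) at_top" and L: "0 < L"
    and lim': "((\<lambda>x. x * F'' x / F' x) \<longlongrightarrow> L') at_top"
  shows "L' = L - 1"
proof -
  obtain \<sigma> where \<sigma>: "\<bar>\<sigma>\<bar> = 1" "\<forall>\<^sub>F x in at_top. 0 < \<sigma> * F x" by (rule eventually_const_sign[OF deriv nz])
  have \<sigma>0: "\<sigma> \<noteq> 0" using \<sigma>(1) by auto
  have "((\<lambda>x. (\<sigma> * (x * F' x)) / (\<sigma> * F x)) \<longlongrightarrow> 1 + L') at_top"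
  proof (rule lhospital_at_top_at_top)
    have "\<forall>\<^sub>F x in at_top. \<bar>F x\<bar> = \<sigma> * F x"
      using \<sigma>(2) by eventually_elim (metis \<sigma>(1) abs_mult abs_of_pos mult_1)
    then show "filterlim (\<lambda>x. \<sigma> * F x) at_top at_top"
      using abs_at_top_of_log_derivative[OF deriv nz lim L] filterlim_cong by fast
    show "\<forall>\<^sub>F x in at_top. \<sigma> * F' x \<noteq> 0" using nz' by eventually_elim (use \<sigma>0 in simp)
    show "\<forall>\<^sub>F x in at_top. ((\<lambda>x. \<sigma> * (x * F' x)) has_real_derivative \<sigma> * (F' x + x * F'' x)) (at x)"
      using deriv' by eventually_elim (auto intro!: derivative_eq_intros)
    show "\<forall>\<^sub>F x in at_top. ((\<lambda>x. \<sigma> * F x) has_real_derivative \<sigma> * F' x) (at x)"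
      using deriv by eventually_elim (auto intro!: derivative_eq_intros)
    have "\<forall>\<^sub>F x in at_top. 1 + x * F'' x / F' x = \<sigma> * (F' x + x * F'' x) / (\<sigma> * F' x)"
      using nz' by eventually_elim (use \<sigma>0 in \<open>simp add: field_simps\<close>)
    then show "((\<lambda>x. \<sigma> * (F' x + x * F'' x) / (\<sigma> * F' x)) \<longlongrightarrow> 1 + L') at_top"
      by (rule Lim_transform_eventually[OF tendsto_add[OF tendsto_const lim']])
  qed
  then have "((\<lambda>x. x * F' x / F x) \<longlongrightarrow> 1 + L') at_top" using \<sigma>0 by simp
  then have "1 + L' = L" using lim tendsto_unique trivial_limit_at_top_linorder by blast
  then show ?thesis by simp
qed

section \<open>Derivatives of functions in \<open>class_R\<close>\<close>

lemma class_R_tower: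
  assumes "g \<in> class_R"
  shows "tower (\<lambda>m. (deriv ^^ m) g)"
proof -
  obtain x0 where "\<forall>j. \<forall>x\<ge>x0. (deriv ^^ j) g field_differentiable at x"
    using assms by (auto simp: class_R_def smooth_on_half_line_def)
  then show ?thesis
    unfolding tower_def eventually_at_top_linorder
    by (intro exI[of _ x0]) (auto simp: DERIV_deriv_iff_field_differentiable)
qed

lemma towerD: "tower q \<Longrightarrow> \<forall>\<^sub>F x in at_top. (q m has_real_derivative q (Suc m) x) (at x)"
  unfolding tower_def by (auto elim: eventually_mono)

lemma class_R_nonzero: "g \<in> class_R \<Longrightarrow> \<forall>\<^sub>F x in at_top. (deriv ^^ j) g x \<noteq> 0"
  by (simp add: class_R_def)

lemma class_R_limit: "g \<in> class_R \<Longrightarrow> \<exists>L. ((\<lambda>x. x * (deriv ^^ Suc j) g x / (deriv ^^ j) g x) \<longlongrightarrow> L) at_top"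
  by (simp add: class_R_def)

lemma class_R_ratio:
  assumes "g \<in> class_R"
  shows "((\<lambda>x. (deriv ^^ Suc j) g x / (deriv ^^ j) g x) \<longlongrightarrow> 0) at_top"
proof -
  obtain L where L: "((\<lambda>x. x * (deriv ^^ Suc j) g x / (deriv ^^ j) g x) \<longlongrightarrow> L) at_top"
    using class_R_limit[OF assms] by blast
  have 1: "((\<lambda>x. x * (deriv ^^ Suc j) g x / (deriv ^^ j) g x / x) \<longlongrightarrow> 0) at_top"
    by (rule real_tendsto_divide_at_top[OF L filterlim_ident])
  have "\<forall>\<^sub>F x in at_top. x * (deriv ^^ Suc j) g x / (deriv ^^ j) g x / x = (deriv ^^ Suc j) g x / (deriv ^^ j) g x"
    using eventually_gt_at_top[of 0] by eventually_elim simp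
  with 1 show ?thesis by (rule Lim_transform_eventually)
qed

text \<open>Each differentiation lowers the exponent by 1 as long as it is positive, and \<alpha> >
  d keeps it positive up to the derivative of order \<open>d\<close>.\<close>

lemma tempered_exponents:
  assumes g: "g \<in> class_R" and \<alpha>: "((\<lambda>x. x * deriv g x / g x) \<longlongrightarrow> \<alpha>) at_top" "real d < \<alpha>" and j: "j \<le> d"
  shows "((\<lambda>x. x * (deriv ^^ Suc j) g x / (deriv ^^ j) g x) \<longlongrightarrow> \<alpha> - real j) at_top"
  using j
proof (induction j)
  case 0
  then show ?case using \<alpha>(1) by simp
next
  case (Suc j)
  then have IH: "((\<lambda>x. x * (deriv ^^ Suc j) g x / (deriv ^^ j) g x) \<longlongrightarrow> \<alpha> - real j) at_top" by simp
  obtain L where L: "((\<lambda>x. x * (deriv ^^ Suc (Suc j)) g x / (deriv ^^ Suc j) g x) \<longlongrightarrow> L) at_top"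
    using class_R_limit[OF g] by blast
  have "L = (\<alpha> - real j) - 1"
    using Suc.prems \<alpha>(2)
    by (intro log_derivative_limit_Suc[OF towerD[OF class_R_tower[OF g]] towerD[OF class_R_tower[OF g]]
        class_R_nonzero[OF g] class_R_nonzero[OF g] IH _ L]) simp
  then have "L = \<alpha> - real (Suc j)" by simp
  with L show ?case by (simp only:)
qed

text \<open>The exponent \<alpha> - d of \<phi> is positive, so \<phi> diverges, and
  \<open>x * \<theta> x\<close>, being asymptotically a positive multiple of \<phi>, diverges with
  it. The factor \<sigma> is the sign of the derivative of order \<open>d + 1\<close>, which makes
  \<theta> positive.\<close>

lemma tempered_slow_scale:
  assumes "g \<in> tempered_of_order d"
  obtains \<sigma> x0 where "\<bar>\<sigma>\<bar> = 1" "slow_scale (\<lambda>x. \<sigma> * (deriv ^^ Suc d) g x) (\<lambda>x. \<sigma> * (deriv ^^ d) g x) x0"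
proof -
  have g: "g \<in> class_R" using assms by (simp add: tempered_of_order_def)
  obtain \<alpha> where \<alpha>: "real d < \<alpha>" "((\<lambda>x. x * deriv g x / g x) \<longlongrightarrow> \<alpha>) at_top"
    and lim0: "((deriv ^^ Suc d) g \<longlongrightarrow> 0) at_top"
    using assms by (auto simp: tempered_of_order_def)
  define G where "G m = (deriv ^^ m) g" for m
  have tower: "tower G" using class_R_tower[OF g] by (simp add: G_def[abs_def])
  have nz: "\<forall>\<^sub>F x in at_top. G m x \<noteq> 0" for m using class_R_nonzero[OF g] by (simp add: G_def)
  have exp_d: "((\<lambda>x. x * G (Suc d) x / G d x) \<longlongrightarrow> \<alpha> - real d) at_top"
    using tempered_exponents[OF g \<alpha>(2,1), of d] by (simp add: G_def)
  obtain \<sigma> where \<sigma>: "\<bar>\<sigma>\<bar> = 1" "\<forall>\<^sub>F x in at_top. 0 < \<sigma> * G (Suc d) x"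
    by (rule eventually_const_sign[OF towerD[OF tower] nz])
  have \<sigma>0: "\<sigma> \<noteq> 0" using \<sigma>(1) by auto
  define \<theta> where "\<theta> x = \<sigma> * G (Suc d) x" for x
  define \<phi> where "\<phi> x = \<sigma> * G d x" for x
  have \<theta>_lim: "(\<theta> \<longlongrightarrow> 0) at_top"
    using tendsto_mult_right_zero[OF lim0, of \<sigma>] by (simp add: \<theta>_def[abs_def] G_def)
  have \<phi>_deriv: "\<forall>\<^sub>F x in at_top. (\<phi> has_real_derivative \<theta> x) (at x)"
    using towerD[OF tower, of d] unfolding \<phi>_def[abs_def] \<theta>_def by eventually_elim (auto intro!: derivative_eq_intros)
  have \<theta>_deriv: "\<forall>\<^sub>F x in at_top. (\<theta> has_real_derivative \<sigma> * G (Suc (Suc d)) x) (at x)"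
    using towerD[OF tower, of "Suc d"] unfolding \<theta>_def[abs_def] by eventually_elim (auto intro!: derivative_eq_intros)
  have \<theta>_pos: "\<forall>\<^sub>F x in at_top. 0 < \<theta> x" using \<sigma>(2) by (simp add: \<theta>_def)
  have exp_\<phi>: "((\<lambda>x. x * \<theta> x / \<phi> x) \<longlongrightarrow> \<alpha> - real d) at_top"
    using exp_d \<sigma>0 by (simp add: \<theta>_def \<phi>_def)
  have "\<forall>\<^sub>F x in at_top. 0 < x * \<theta> x / \<phi> x"
    using exp_\<phi> \<alpha>(1) by (intro order_tendstoD(1)) auto
  then have \<phi>_pos: "\<forall>\<^sub>F x in at_top. 0 < \<phi> x"
    using \<theta>_pos eventually_gt_at_top[of 0] by eventually_elim (metis divide_pos_neg linorder_neqE_linordered_idom mult_pos_pos not_less_iff_gr_or_eq order_less_irrefl divide_eq_0_iff)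
  have \<phi>_nz: "\<forall>\<^sub>F x in at_top. \<phi> x \<noteq> 0" using \<phi>_pos by eventually_elim simp
  have "filterlim (\<lambda>x. \<bar>\<phi> x\<bar>) at_top at_top"
    using abs_at_top_of_log_derivative[OF \<phi>_deriv \<phi>_nz exp_\<phi>] \<alpha>(1) by simp
  moreover have "\<forall>\<^sub>F x in at_top. \<bar>\<phi> x\<bar> = \<phi> x" using \<phi>_pos by eventually_elim simp
  ultimately have \<phi>_top: "filterlim \<phi> at_top at_top" using filterlim_cong[OF refl refl] by fast
  have "filterlim (\<lambda>x. (x * \<theta> x / \<phi> x) * \<phi> x) at_top at_top"
    using \<alpha>(1) by (intro filterlim_tendsto_pos_mult_at_top[OF exp_\<phi> _ \<phi>_top]) simp
  moreover have "\<forall>\<^sub>F x in at_top. (x * \<theta> x / \<phi> x) * \<phi> x = x * \<theta> x" using \<phi>_nz by eventually_elim simp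
  ultimately have x\<theta>_top: "filterlim (\<lambda>x. x * \<theta> x) at_top at_top" using filterlim_cong[OF refl refl] by fast
  have "\<forall>\<^sub>F x in at_top. \<sigma> * G (Suc (Suc d)) x \<noteq> 0" using nz[of "Suc (Suc d)"] by eventually_elim (use \<sigma>0 in simp)
  moreover have "\<forall>\<^sub>F x in at_top. ((\<lambda>x. \<sigma> * G (Suc (Suc d)) x) has_real_derivative \<sigma> * G (Suc (Suc (Suc d))) x) (at x)"
    using towerD[OF tower, of "Suc (Suc d)"] by eventually_elim (auto intro!: derivative_eq_intros)
  ultimately obtain \<tau> where \<tau>: "\<bar>\<tau>\<bar> = 1" "\<forall>\<^sub>F x in at_top. 0 < \<tau> * (\<sigma> * G (Suc (Suc d)) x)"
    using eventually_const_sign by metis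
  have "\<forall>\<^sub>F x in at_top. (\<phi> has_real_derivative \<theta> x) (at x) \<and> (\<theta> has_real_derivative \<sigma> * G (Suc (Suc d)) x) (at x)
      \<and> 0 < \<theta> x \<and> 0 < \<tau> * (\<sigma> * G (Suc (Suc d)) x) \<and> 0 < x"
    using \<phi>_deriv \<theta>_deriv \<theta>_pos \<tau>(2) eventually_gt_at_top[of 0] by eventually_elim auto
  then obtain x0 where x0: "\<And>x. x0 \<le> x \<Longrightarrow> (\<phi> has_real_derivative \<theta> x) (at x)"
    "\<And>x. x0 \<le> x \<Longrightarrow> (\<theta> has_real_derivative \<sigma> * G (Suc (Suc d)) x) (at x)" "\<And>x. x0 \<le> x \<Longrightarrow> 0 < \<theta> x"
    "\<And>x. x0 \<le> x \<Longrightarrow> 0 < \<tau> * (\<sigma> * G (Suc (Suc d)) x)" "\<And>x. x0 \<le> x \<Longrightarrow> 0 < x"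
    unfolding eventually_at_top_linorder by blast
  \<comment> \<open>The derivative of \<theta> has no zeros far out, so \<theta> is monotone; a
    positive function with limit 0 cannot increase.\<close>
  have "\<tau> = - 1"
  proof (rule ccontr)
    assume "\<tau> \<noteq> - 1"
    then have "\<tau> = 1" using \<tau>(1) by linarith
    have "\<theta> x0 \<le> \<theta> x" if "x0 \<le> x" for x
      using x0(2,4) \<open>\<tau> = 1\<close> by (intro DERIV_nonneg_imp_nondecreasing[OF that]) (metis less_imp_le mult_1)
    then have "\<forall>\<^sub>F x in at_top. \<theta> x0 \<le> \<theta> x" by (auto simp: eventually_at_top_linorder)
    then have "\<theta> x0 \<le> 0" by (intro tendsto_lowerbound[OF \<theta>_lim]) auto
    then show False using x0(3)[of x0] by simp
  qed
  then have \<theta>'_neg: "\<sigma> * G (Suc (Suc d)) x < 0" if "x0 \<le> x" for x using x0(4)[OF that] by simp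
  have \<theta>_anti: "\<theta> y \<le> \<theta> x" if "x0 \<le> x" "x \<le> y" for x y
    using x0(2) \<theta>'_neg that by (intro DERIV_nonpos_imp_nonincreasing[of x y \<theta>]) (auto, meson less_imp_le order_trans)
  have ratio0: "((\<lambda>x. \<sigma> * G (Suc (Suc d)) x / \<theta> x) \<longlongrightarrow> 0) at_top"
    using class_R_ratio[OF g, of "Suc d"] \<sigma>0 by (simp add: \<theta>_def G_def)
  have \<theta>_ratio: "((\<lambda>x. \<theta> (x + 1) / \<theta> x) \<longlongrightarrow> 1) at_top"
  proof (rule tendstoI)
    fix \<epsilon> :: real assume "0 < \<epsilon>"
    have "\<forall>\<^sub>F x in at_top. \<bar>\<sigma> * G (Suc (Suc d)) x / \<theta> x\<bar> < \<epsilon>"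
      using tendstoD[OF ratio0 \<open>0 < \<epsilon>\<close>] by (simp add: dist_real_def)
    then obtain x2 where x2: "\<And>x. x2 \<le> x \<Longrightarrow> \<bar>\<sigma> * G (Suc (Suc d)) x / \<theta> x\<bar> < \<epsilon>"
      by (auto simp: eventually_at_top_linorder)
    show "\<forall>\<^sub>F x in at_top. dist (\<theta> (x + 1) / \<theta> x) 1 < \<epsilon>"
      using eventually_ge_at_top[of x0] eventually_ge_at_top[of x2]
    proof eventually_elim
      case (elim x)
      \<comment> \<open>The increment of \<theta> over a unit step is the derivative at
        \<open>z\<close>, small against \<open>\<theta> z\<close>, which is at most
        \<open>\<theta> x\<close>.\<close>
      have "\<exists>z>x. z < x + 1 \<and> \<theta> (x + 1) - \<theta> x = (x + 1 - x) * (\<sigma> * G (Suc (Suc d)) z)"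
        using elim by (intro MVT2 x0(2)) auto
      then obtain z where z: "x < z" "z < x + 1" "\<theta> (x + 1) - \<theta> x = \<sigma> * G (Suc (Suc d)) z" by auto
      have pz: "0 < \<theta> z" "0 < \<theta> x" using elim z by (auto intro!: x0(3))
      have "\<bar>\<theta> (x + 1) - \<theta> x\<bar> < \<epsilon> * \<theta> z"
        using x2[of z] z elim pz by (simp add: abs_divide divide_less_eq)
      also have "\<dots> \<le> \<epsilon> * \<theta> x" using \<theta>_anti[of x z] z elim \<open>0 < \<epsilon>\<close> by (intro mult_left_mono) auto
      finally have "\<bar>\<theta> (x + 1) - \<theta> x\<bar> / \<theta> x < \<epsilon>" using pz by (simp add: divide_less_eq)
      moreover have "\<theta> (x + 1) / \<theta> x - 1 = (\<theta> (x + 1) - \<theta> x) / \<theta> x" using pz by (simp add: diff_divide_distrib)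
      ultimately show ?case using pz by (simp add: dist_real_def abs_divide)
    qed
  qed
  have "0 \<le> x0" using x0(5)[of x0] by simp
  then have "slow_scale \<theta> \<phi> x0"
    by unfold_locales (use x0 \<theta>_anti x\<theta>_top \<phi>_top \<theta>_lim \<theta>_ratio in auto)
  then show thesis using that[OF \<sigma>(1)] by (simp add: \<theta>_def[abs_def] \<phi>_def[abs_def] G_def)
qed

text \<open>In \<open>class_R\<close> each derivative is negligible against the preceding one, so
  the orders above \<open>r\<close> follow from the limit at \<open>r\<close>.\<close>

lemma (in slow_scale) class_R_has_order:
  assumes g: "g \<in> class_R" and lim: "((\<lambda>x. (deriv ^^ r) g x / \<theta> x) \<longlongrightarrow> b) at_top"
  shows "has_order r b (\<lambda>m. (deriv ^^ m) g)"
proof -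
  have step: "((\<lambda>x. (deriv ^^ Suc m) g x / \<theta> x) \<longlongrightarrow> 0) at_top" if "((\<lambda>x. (deriv ^^ m) g x / \<theta> x) \<longlongrightarrow> c) at_top" for m c
  proof -
    have 1: "((\<lambda>x. (deriv ^^ Suc m) g x / (deriv ^^ m) g x * ((deriv ^^ m) g x / \<theta> x)) \<longlongrightarrow> 0) at_top"
      using tendsto_mult[OF class_R_ratio[OF g, of m] that] by (simp only: mult_zero_left)
    have "\<forall>\<^sub>F x in at_top. (deriv ^^ Suc m) g x / (deriv ^^ m) g x * ((deriv ^^ m) g x / \<theta> x) = (deriv ^^ Suc m) g x / \<theta> x"
      using class_R_nonzero[OF g, of m] by eventually_elim (simp del: funpow.simps)
    with 1 show ?thesis by (rule Lim_transform_eventually)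
  qed
  have "((\<lambda>x. (deriv ^^ (Suc r + k)) g x / \<theta> x) \<longlongrightarrow> 0) at_top" for k
  proof (induction k)
    case 0
    then show ?case using step[OF lim] by simp
  next
    case (Suc k)
    then show ?case using step[of "Suc r + k" 0] by simp
  qed
  then have "((\<lambda>x. (deriv ^^ m) g x / \<theta> x) \<longlongrightarrow> 0) at_top" if "r < m" for m
    using that by (metis Suc_leI le_add_diff_inverse)
  then show ?thesis using lim class_R_tower[OF g] by (simp add: has_order_def)
qed

text \<open>Here \<open>g'\<close> is a second function. Passing to the next derivatives multiplies
  the quotient by a ratio of logarithmic derivatives, which has a finite limit since that of
  \<open>g\<close> tends to \<alpha> - j, nonzero for j \<le> d.\<close>

lemma grows_slower_derivatives:
  assumes g: "g \<in> class_R" and \<alpha>: "((\<lambda>x. x * deriv g x / g x) \<longlongrightarrow> \<alpha>) at_top" "real d < \<alpha>"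
    and g': "g' \<in> class_R" and slower: "g' \<prec>\<^sub>g g" and j: "j \<le> Suc d"
  shows "((\<lambda>x. (deriv ^^ j) g' x / (deriv ^^ j) g x) \<longlongrightarrow> 0) at_top"
  using j
proof (induction j)
  case 0
  have "((\<lambda>x. inverse (\<bar>g x\<bar> / \<bar>g' x\<bar>)) \<longlongrightarrow> 0) at_top"
    using slower unfolding grows_slower_def by (rule tendsto_inverse_0_at_top)
  then have "((\<lambda>x. \<bar>g' x / g x\<bar>) \<longlongrightarrow> 0) at_top" by (simp add: abs_divide)
  then show ?case unfolding tendsto_rabs_zero_iff by simp
next
  case (Suc j)
  obtain L where L: "((\<lambda>x. x * (deriv ^^ Suc j) g' x / (deriv ^^ j) g' x) \<longlongrightarrow> L) at_top"
    using class_R_limit[OF g'] by blast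
  have E: "((\<lambda>x. x * (deriv ^^ Suc j) g x / (deriv ^^ j) g x) \<longlongrightarrow> \<alpha> - real j) at_top"
    using Suc.prems by (intro tempered_exponents[OF g \<alpha>]) simp
  have "\<alpha> - real j \<noteq> 0" using Suc.prems \<alpha>(2) by simp
  then have "((\<lambda>x. (x * (deriv ^^ Suc j) g' x / (deriv ^^ j) g' x) / (x * (deriv ^^ Suc j) g x / (deriv ^^ j) g x)
      * ((deriv ^^ j) g' x / (deriv ^^ j) g x)) \<longlongrightarrow> L / (\<alpha> - real j) * 0) at_top"
    using Suc by (intro tendsto_mult tendsto_divide L E) auto
  moreover have "\<forall>\<^sub>F x in at_top. (x * (deriv ^^ Suc j) g' x / (deriv ^^ j) g' x) / (x * (deriv ^^ Suc j) g x / (deriv ^^ j) g x)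
      * ((deriv ^^ j) g' x / (deriv ^^ j) g x) = (deriv ^^ Suc j) g' x / (deriv ^^ Suc j) g x"
    using class_R_nonzero[OF g, of j] class_R_nonzero[OF g', of j] eventually_gt_at_top[of 0]
    by eventually_elim simp
  ultimately show ?case by (simp add: Lim_transform_eventually)
qed

lemma grows_slower_trans:
  assumes nz: "\<forall>\<^sub>F x in at_top. g x \<noteq> 0" and fg: "f \<prec>\<^sub>g g" and gh: "g \<prec>\<^sub>g h"
  shows "f \<prec>\<^sub>g h"
proof -
  have "filterlim (\<lambda>x. (\<bar>h x\<bar> / \<bar>g x\<bar>) * (\<bar>g x\<bar> / \<bar>f x\<bar>)) at_top at_top"
    using fg gh unfolding grows_slower_def by (intro filterlim_at_top_mult_at_top)
  moreover have "\<forall>\<^sub>F x in at_top. (\<bar>h x\<bar> / \<bar>g x\<bar>) * (\<bar>g x\<bar> / \<bar>f x\<bar>) = \<bar>h x\<bar> / \<bar>f x\<bar>"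
    using nz by eventually_elim simp
  ultimately show ?thesis unfolding grows_slower_def using filterlim_cong[OF refl refl] by fast
qed

section \<open>Convergence of the averages\<close>

text \<open>All functions enter the PET induction with degree \<open>Suc d\<close>, the fastest with
  coefficient \<sigma> and the slower ones with coefficient 0. Every difference from the fastest
  thus has the nonzero coefficient \<sigma>.\<close>

lemma (in weakly_mixing_action) mean_null_tempered:
  assumes I: "k \<in> J" "J \<subseteq> I" and g: "g k \<in> tempered"
    and slower: "\<And>j. j \<in> J \<Longrightarrow> j \<noteq> k \<Longrightarrow> g j \<in> class_R \<and> g j \<prec>\<^sub>g g k"
    and f: "\<And>j. j \<in> J \<Longrightarrow> bounded_measurable M (f j)" and f0: "(\<integral>x. f k x \<partial>M) = 0"
  shows "mean_null (\<lambda>_. 1) (\<lambda>n x. \<Prod>j\<in>J. f j (A (unit_multiple j \<lfloor>g j (real (Suc n))\<rfloor>) x))"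
proof -
  obtain d where d: "g k \<in> tempered_of_order d" using g by (auto simp: tempered_def)
  then have gk: "g k \<in> class_R" by (simp add: tempered_of_order_def)
  obtain \<alpha> where \<alpha>: "((\<lambda>x. x * deriv (g k) x / g k x) \<longlongrightarrow> \<alpha>) at_top" "real d < \<alpha>"
    using d by (auto simp: tempered_of_order_def)
  obtain \<sigma> x0 where \<sigma>: "\<bar>\<sigma>\<bar> = 1"
    and scale: "slow_scale (\<lambda>x. \<sigma> * (deriv ^^ Suc d) (g k) x) (\<lambda>x. \<sigma> * (deriv ^^ d) (g k) x) x0"
    by (rule tempered_slow_scale[OF d])
  define \<theta> where "\<theta> = (\<lambda>x. \<sigma> * (deriv ^^ Suc d) (g k) x)"
  define \<phi> where "\<phi> = (\<lambda>x. \<sigma> * (deriv ^^ d) (g k) x)"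
  interpret S: slow_scale \<theta> \<phi> x0 using scale unfolding \<theta>_def \<phi>_def .
  interpret action_with_scale M I A \<theta> \<phi> x0 k by unfold_locales (use I in auto)
  have \<sigma>0: "\<sigma> \<noteq> 0" using \<sigma> by auto
  have head: "S.has_order (Suc d) \<sigma> (\<lambda>m. (deriv ^^ m) (g k))"
  proof (rule S.class_R_has_order[OF gk])
    have "\<forall>\<^sub>F x in at_top. \<sigma> = (deriv ^^ Suc d) (g k) x / \<theta> x"
      using class_R_nonzero[OF gk, of "Suc d"]
    proof eventually_elim
      case (elim x)
      have "\<sigma> * \<sigma> = 1" using \<sigma> by (metis abs_mult_self_eq mult_1)
      then show ?case using elim \<sigma>0 unfolding \<theta>_def by (simp add: eq_divide_eq)
    qed
    then show "((\<lambda>x. (deriv ^^ Suc d) (g k) x / \<theta> x) \<longlongrightarrow> \<sigma>) at_top"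
      by (rule Lim_transform_eventually[OF tendsto_const])
  qed
  have rest: "S.has_order (Suc d) 0 (\<lambda>m. (deriv ^^ m) (g j))" if j: "j \<in> J" "j \<noteq> k" for j
  proof (rule S.class_R_has_order)
    show gj: "g j \<in> class_R" using slower[OF j] by simp
    have "((\<lambda>x. (deriv ^^ Suc d) (g j) x / (deriv ^^ Suc d) (g k) x) \<longlongrightarrow> 0) at_top"
      using slower[OF j] by (intro grows_slower_derivatives[OF gk \<alpha> gj]) auto
    from tendsto_divide[OF this tendsto_const[of \<sigma>] \<sigma>0]
    show "((\<lambda>x. (deriv ^^ Suc d) (g j) x / \<theta> x) \<longlongrightarrow> 0) at_top"
      unfolding \<theta>_def by (simp add: mult.commute del: funpow.simps)
  qed
  \<comment> \<open>The shift by 1 matches the argument \<open>real (Suc n)\<close>: means run over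
    n < N, the averages of the theorem over 1, ..., N.\<close>
  define v where "v j i m x = (if i = j then (deriv ^^ m) (g j) (x + real 1) else 0)" for j i m x
  have lead: "leads (Suc d) (if j = k then \<sigma> else 0) (v j) vzero" if j: "j \<in> J" for j
    unfolding leads_def
  proof
    fix i assume "i \<in> I"
    show "S.has_order (Suc d) (if i = k then if j = k then \<sigma> else 0 else 0) (\<lambda>m x. v j i m x - vzero i m x)"
    proof (cases "i = j")
      case True
      then show ?thesis
        using S.has_order_shift[OF head, of 1] S.has_order_shift[OF rest[OF j], of 1]
        by (cases "j = k") (simp_all add: v_def vzero_def)
    next
      case False
      then show ?thesis using S.has_order_zero by (auto simp: v_def vzero_def)
    qed
  qed
  \<comment> \<open>Each member is its own class, so the conditions on equal labels are vacuous at
    the start.\<close>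
  have good: "good_family J k v (\<lambda>j. (Suc d, j))"
  proof (rule good_familyI)
    show "finite J" using I finite_I finite_subset by blast
    show "\<exists>b. leads (fst (Suc d, j)) b (v j) vzero" if "j \<in> J" for j using lead[OF that] by auto
    show "\<exists>b. b \<noteq> 0 \<and> leads (fst (Suc d, k)) b (v k) vzero"
      using lead[OF I(1)] \<sigma>0 by (intro exI[of _ \<sigma>]) simp
    show "\<exists>b. b \<noteq> 0 \<and> leads (fst (Suc d, k)) b (v k) (v j)" if j: "j \<in> J" "j \<noteq> k" for j
      using leads_trans[OF lead[OF I(1)] leads_sym[OF lead[OF j(1)]]] j \<sigma>0 by (intro exI[of _ \<sigma>]) simp
  qed (use I in auto)
  show ?thesis
  proof (rule mean_null_good_family[where f = f and m = "\<lambda>j n. unit_multiple j \<lfloor>g j (real (Suc n))\<rfloor>", OF good f f0])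
    fix j assume "j \<in> J"
    show "approximates (\<lambda>n. unit_multiple j \<lfloor>g j (real (Suc n))\<rfloor>) (\<lambda>i. v j i 0)"
      unfolding approximates_def
    proof (intro ballI BseqI'[where K = 1])
      fix i n
      show "norm (real_of_int (unit_multiple j \<lfloor>g j (real (Suc n))\<rfloor> i) - v j i 0 (real n)) \<le> 1"
      proof (cases "i = j")
        case True
        have "\<bar>real_of_int \<lfloor>y\<rfloor> - y\<bar> \<le> 1" for y :: real by linarith
        then show ?thesis using True by (simp add: v_def unit_multiple_def add.commute)
      qed (simp add: v_def unit_multiple_def)
    qed
  qed
qed

lemma (in weakly_mixing_action) tempered_averages_tendsto:
  assumes I: "{1..l} \<subseteq> I" and k: "1 \<le> k" "k \<le> Suc l"
    and g: "\<And>i. i \<in> {1..l} \<Longrightarrow> g i \<in> tempered"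
    and slower: "\<And>i j. 1 \<le> i \<Longrightarrow> i < j \<Longrightarrow> j \<le> l \<Longrightarrow> g j \<prec>\<^sub>g g i"
    and f: "\<And>i. i \<in> {1..l} \<Longrightarrow> bounded_measurable M (f i)"
  shows "(\<lambda>N. \<integral>x. (cmod (wmean (\<lambda>_. 1) (\<lambda>n. \<Prod>i\<in>{k..l}. f i (A (unit_multiple i \<lfloor>g i (real (Suc n))\<rfloor>) x)) N
    - (\<Prod>i\<in>{k..l}. \<integral>y. f i y \<partial>M)))\<^sup>2 \<partial>M) \<longlonglongrightarrow> 0"
  using k(2,1)
proof (induction k rule: inc_induct)
  case base
  \<comment> \<open>For \<open>N = 0\<close> the mean is 0 and not 1, so the difference vanishes
    only from \<open>N = 1\<close> on.\<close>
  have "wmean (\<lambda>_. 1) (\<lambda>_. 1 :: complex) N = 1" if "0 < N" for N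
    using that by (intro wmean_const) auto
  then have "\<forall>\<^sub>F N in sequentially. 0 = (\<integral>x. (cmod (wmean (\<lambda>_. 1) (\<lambda>n. \<Prod>i\<in>{Suc l..l}. f i (A (unit_multiple i \<lfloor>g i (real (Suc n))\<rfloor>) x)) N
    - (\<Prod>i\<in>{Suc l..l}. \<integral>y. f i y \<partial>M)))\<^sup>2 \<partial>M)"
    by (intro eventually_sequentiallyI[of 1]) simp
  then show ?case by (rule Lim_transform_eventually[OF tendsto_const])
next
  case (step k)
  note k = step.hyps(2) step.prems
  have set: "{k..l} = insert k {Suc k..l}" "k \<notin> {Suc k..l}" using k by auto
  define c where "c = (\<integral>y. f k y \<partial>M)"
  define P where "P = (\<Prod>i\<in>{Suc k..l}. \<integral>y. f i y \<partial>M)"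
  define u where "u n x = (\<Prod>i\<in>{Suc k..l}. f i (A (unit_multiple i \<lfloor>g i (real (Suc n))\<rfloor>) x))" for n x
  \<comment> \<open>The centred factor belongs to the fastest of the remaining functions; the
    constant \<open>c\<close> leaves \<open>c\<close> times the average over
    \<open>{Suc k..l}\<close>.\<close>
  define f' where "f' = f(k := \<lambda>x. f k x - c)"
  define w where "w n x = (\<Prod>i\<in>{k..l}. f' i (A (unit_multiple i \<lfloor>g i (real (Suc n))\<rfloor>) x))" for n x
  have fk: "bounded_measurable M (f k)" using k by (intro f) auto
  have f': "bounded_measurable M (f' i)" if "i \<in> {k..l}" for i
    using that k f by (auto simp: f'_def intro!: bounded_measurable_diff)
  have bu: "bounded_measurable M (u n)" for n
    unfolding u_def using k f by (intro bounded_measurable_prod_A) auto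
  have bw: "bounded_measurable M (w n)" for n unfolding w_def by (intro bounded_measurable_prod_A f')
  have null: "mean_null (\<lambda>_. 1) w"
    unfolding w_def
  proof (rule mean_null_tempered[where k = k])
    show "k \<in> {k..l}" "{k..l} \<subseteq> I" "g k \<in> tempered" using k I g[of k] by auto
    show "g j \<in> class_R \<and> g j \<prec>\<^sub>g g k" if "j \<in> {k..l}" "j \<noteq> k" for j
      using that k g[of j] slower[of k j] by (auto simp: tempered_def tempered_of_order_def)
    show "(\<integral>x. f' k x \<partial>M) = 0"
      using integrable_bounded_measurable[OF fk] by (simp add: f'_def c_def prob_space)
  qed (rule f')
  have lim_w: "(\<lambda>N. \<integral>x. (cmod (wmean (\<lambda>_. 1) (\<lambda>n. w n x) N))\<^sup>2 \<partial>M) \<longlonglongrightarrow> 0"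
  proof (rule tendstoI)
    fix \<epsilon> :: real assume "0 < \<epsilon>"
    then have "\<forall>\<^sub>F N in sequentially. \<forall>c. (\<forall>n. cmod (c n) \<le> 1) \<longrightarrow>
        (\<integral>x. (cmod (wmean (\<lambda>_. 1) (\<lambda>n. c n * w n x) N))\<^sup>2 \<partial>M) \<le> \<epsilon> / 2"
      using null half_gt_zero unfolding mean_null_def by blast
    then show "\<forall>\<^sub>F N in sequentially. dist (\<integral>x. (cmod (wmean (\<lambda>_. 1) (\<lambda>n. w n x) N))\<^sup>2 \<partial>M) 0 < \<epsilon>"
    proof eventually_elim
      case (elim N)
      from elim[rule_format, of "\<lambda>_. 1"] show ?case using \<open>0 < \<epsilon>\<close> by (simp add: dist_real_def)
    qed
  qed
  have lim_u: "(\<lambda>N. \<integral>x. (cmod (wmean (\<lambda>_. 1) (\<lambda>n. u n x) N - P))\<^sup>2 \<partial>M) \<longlonglongrightarrow> 0"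
    using step.IH unfolding u_def P_def by simp
  have split: "wmean (\<lambda>_. 1) (\<lambda>n. \<Prod>i\<in>{k..l}. f i (A (unit_multiple i \<lfloor>g i (real (Suc n))\<rfloor>) x)) N - (\<Prod>i\<in>{k..l}. \<integral>y. f i y \<partial>M)
      = wmean (\<lambda>_. 1) (\<lambda>n. w n x) N + c * (wmean (\<lambda>_. 1) (\<lambda>n. u n x) N - P)" for x N
  proof -
    have "(\<Prod>i\<in>{k..l}. f i (A (unit_multiple i \<lfloor>g i (real (Suc n))\<rfloor>) x)) = w n x + c * u n x" for n
    proof -
      have "w n x = (f k (A (unit_multiple k \<lfloor>g k (real (Suc n))\<rfloor>) x) - c) * u n x"
        unfolding w_def u_def set(1) by (subst prod.insert) (auto simp: f'_def intro!: prod.cong)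
      moreover have "(\<Prod>i\<in>{k..l}. f i (A (unit_multiple i \<lfloor>g i (real (Suc n))\<rfloor>) x)) = f k (A (unit_multiple k \<lfloor>g k (real (Suc n))\<rfloor>) x) * u n x"
        unfolding u_def set(1) by (subst prod.insert) auto
      ultimately show ?thesis by (simp add: algebra_simps)
    qed
    moreover have "(\<Prod>i\<in>{k..l}. \<integral>y. f i y \<partial>M) = c * P"
      unfolding c_def P_def set(1) by (subst prod.insert) auto
    ultimately show ?thesis by (simp only: wmean_add wmean_cmult right_diff_distrib add_diff_eq)
  qed
  have bound: "(\<integral>x. (cmod (wmean (\<lambda>_. 1) (\<lambda>n. w n x) N + c * (wmean (\<lambda>_. 1) (\<lambda>n. u n x) N - P)))\<^sup>2 \<partial>M)
      \<le> 2 * (\<integral>x. (cmod (wmean (\<lambda>_. 1) (\<lambda>n. w n x) N))\<^sup>2 \<partial>M)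
        + 2 * (cmod c)\<^sup>2 * (\<integral>x. (cmod (wmean (\<lambda>_. 1) (\<lambda>n. u n x) N - P))\<^sup>2 \<partial>M)" for N
  proof -
    have bW: "bounded_measurable M (\<lambda>x. wmean (\<lambda>_. 1) (\<lambda>n. w n x) N)"
      by (intro bounded_measurable_wmean bw)
    have bU: "bounded_measurable M (\<lambda>x. wmean (\<lambda>_. 1) (\<lambda>n. u n x) N - P)"
      by (intro bounded_measurable_diff bounded_measurable_wmean bu bounded_measurable_const)
    have iW: "integrable M (\<lambda>x. 2 * (cmod (wmean (\<lambda>_. 1) (\<lambda>n. w n x) N))\<^sup>2)"
      by (intro integrable_mult_right integrable_cmod_power2 bW)
    have iU: "integrable M (\<lambda>x. 2 * (cmod c)\<^sup>2 * (cmod (wmean (\<lambda>_. 1) (\<lambda>n. u n x) N - P))\<^sup>2)"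
      by (intro integrable_mult_right integrable_cmod_power2 bU)
    have "(\<integral>x. (cmod (wmean (\<lambda>_. 1) (\<lambda>n. w n x) N + c * (wmean (\<lambda>_. 1) (\<lambda>n. u n x) N - P)))\<^sup>2 \<partial>M)
      \<le> (\<integral>x. 2 * (cmod (wmean (\<lambda>_. 1) (\<lambda>n. w n x) N))\<^sup>2 + 2 * (cmod c)\<^sup>2 * (cmod (wmean (\<lambda>_. 1) (\<lambda>n. u n x) N - P))\<^sup>2 \<partial>M)"
    proof (rule integral_mono)
      show "integrable M (\<lambda>x. (cmod (wmean (\<lambda>_. 1) (\<lambda>n. w n x) N + c * (wmean (\<lambda>_. 1) (\<lambda>n. u n x) N - P)))\<^sup>2)"
        by (intro integrable_cmod_power2 bounded_measurable_add bounded_measurable_mult bounded_measurable_const bW bU)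
      show "integrable M (\<lambda>x. 2 * (cmod (wmean (\<lambda>_. 1) (\<lambda>n. w n x) N))\<^sup>2 + 2 * (cmod c)\<^sup>2 * (cmod (wmean (\<lambda>_. 1) (\<lambda>n. u n x) N - P))\<^sup>2)"
        by (rule Bochner_Integration.integrable_add[OF iW iU])
      fix x
      define p where "p = cmod (wmean (\<lambda>_. 1) (\<lambda>n. w n x) N)"
      define q where "q = cmod (c * (wmean (\<lambda>_. 1) (\<lambda>n. u n x) N - P))"
      have "(cmod (wmean (\<lambda>_. 1) (\<lambda>n. w n x) N + c * (wmean (\<lambda>_. 1) (\<lambda>n. u n x) N - P)))\<^sup>2 \<le> (p + q)\<^sup>2"
        unfolding p_def q_def by (intro power_mono norm_triangle_ineq) auto
      also have "\<dots> \<le> 2 * p\<^sup>2 + 2 * q\<^sup>2" using sum_squares_bound[of p q] by (simp add: power2_sum)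
      finally show "(cmod (wmean (\<lambda>_. 1) (\<lambda>n. w n x) N + c * (wmean (\<lambda>_. 1) (\<lambda>n. u n x) N - P)))\<^sup>2
        \<le> 2 * (cmod (wmean (\<lambda>_. 1) (\<lambda>n. w n x) N))\<^sup>2 + 2 * (cmod c)\<^sup>2 * (cmod (wmean (\<lambda>_. 1) (\<lambda>n. u n x) N - P))\<^sup>2"
        by (simp add: p_def q_def norm_mult power_mult_distrib)
    qed
    also have "\<dots> = 2 * (\<integral>x. (cmod (wmean (\<lambda>_. 1) (\<lambda>n. w n x) N))\<^sup>2 \<partial>M)
        + 2 * (cmod c)\<^sup>2 * (\<integral>x. (cmod (wmean (\<lambda>_. 1) (\<lambda>n. u n x) N - P))\<^sup>2 \<partial>M)"
      unfolding Bochner_Integration.integral_add[OF iW iU] by simp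
    finally show ?thesis .
  qed
  have lim_bound: "(\<lambda>N. 2 * (\<integral>x. (cmod (wmean (\<lambda>_. 1) (\<lambda>n. w n x) N))\<^sup>2 \<partial>M)
        + 2 * (cmod c)\<^sup>2 * (\<integral>x. (cmod (wmean (\<lambda>_. 1) (\<lambda>n. u n x) N - P))\<^sup>2 \<partial>M)) \<longlonglongrightarrow> 0"
    using tendsto_add[OF tendsto_mult_right_zero[OF lim_w, of 2] tendsto_mult_right_zero[OF lim_u, of "2 * (cmod c)\<^sup>2"]] by simp
  show ?case
    unfolding split
  proof (rule Lim_null_comparison[OF always_eventually lim_bound], rule allI)
    fix N
    have "0 \<le> (\<integral>x. (cmod (wmean (\<lambda>_. 1) (\<lambda>n. w n x) N + c * (wmean (\<lambda>_. 1) (\<lambda>n. u n x) N - P)))\<^sup>2 \<partial>M)"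
      by (rule integral_nonneg_AE) simp
    then show "norm (\<integral>x. (cmod (wmean (\<lambda>_. 1) (\<lambda>n. w n x) N + c * (wmean (\<lambda>_. 1) (\<lambda>n. u n x) N - P)))\<^sup>2 \<partial>M)
      \<le> 2 * (\<integral>x. (cmod (wmean (\<lambda>_. 1) (\<lambda>n. w n x) N))\<^sup>2 \<partial>M)
        + 2 * (cmod c)\<^sup>2 * (\<integral>x. (cmod (wmean (\<lambda>_. 1) (\<lambda>n. u n x) N - P))\<^sup>2 \<partial>M)"
      using bound[of N] by (simp only: real_norm_def abs_of_nonneg)
  qed
qed

theorem corollary2p6:
  fixes M :: "'a measure" and l :: nat and T :: "nat \<Rightarrow> 'a \<Rightarrow> 'a"
    and f :: "nat \<Rightarrow> 'a \<Rightarrow> complex" and g :: "nat \<Rightarrow> real \<Rightarrow> real"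
  assumes "l \<ge> 1"
    and "weakly_mixing_system M l T"
    and "\<And>i. i \<in> {1..l} \<Longrightarrow> f i \<in> L_infinity M"
    and "\<And>i. i \<in> {1..l} \<Longrightarrow> g i \<in> tempered"
    and "\<And>i. i \<in> {1..<l} \<Longrightarrow> g (i + 1) \<prec>\<^sub>g g i"
  shows "(\<lambda>N. L2_norm M (\<lambda>x.
      (\<Sum>n=1..N. \<Prod>i=1..l. koopman M (T i) \<lfloor>g i (real n)\<rfloor> (f i) x) / of_nat N
      - (\<Prod>i=1..l. \<integral>y. f i y \<partial>M))) \<longlonglongrightarrow> 0"
proof -
  define A where "A = iterate_list M T [1..<Suc l]"
  interpret weakly_mixing_action M "{1..l}" A
    unfolding A_def by (rule weakly_mixing_action_iterate_list[OF assms(2)])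
  have slower: "g j \<prec>\<^sub>g g i" if "1 \<le> i" "i < j" "j \<le> l" for i j
    using that(2,3)
  proof (induction j)
    case (Suc j)
    have last: "g (Suc j) \<prec>\<^sub>g g j" if "1 \<le> j" using assms(5)[of j] Suc.prems that by simp
    show ?case
    proof (cases "i = j")
      case True
      then show ?thesis using last \<open>1 \<le> i\<close> by simp
    next
      case False
      then have ij: "i < j" using Suc.prems by simp
      have "g j \<in> class_R"
        using assms(4)[of j] ij Suc.prems by (auto simp: tempered_def tempered_of_order_def)
      then show ?thesis
        using grows_slower_trans[of "g j" "g (Suc j)" "g i"] class_R_nonzero[of "g j" 0] last Suc.IH ij Suc.prems \<open>1 \<le> i\<close>
        by simp
    qed
  qed simp
  have "\<forall>i\<in>{1..l}. \<exists>C. AE x in M. cmod (f i x) \<le> C" using assms(3) by (auto simp: L_infinity_def)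
  from bchoice[OF this] obtain C where C: "\<forall>i\<in>{1..l}. AE x in M. cmod (f i x) \<le> C i" by blast
  \<comment> \<open>Truncation at an essential bound changes \<open>f i\<close> on a null set
    only.\<close>
  define f' where "f' i x = (if cmod (f i x) \<le> C i then f i x else 0)" for i x
  have f_meas: "f i \<in> borel_measurable M" if "i \<in> {1..l}" for i using assms(3)[OF that] by (simp add: L_infinity_def)
  have f': "bounded_measurable M (f' i)" if "i \<in> {1..l}" for i
  proof (rule bounded_measurableI[where B = "\<bar>C i\<bar>"])
    note [measurable] = f_meas[OF that]
    show "f' i \<in> borel_measurable M" unfolding f'_def by measurable
    show "cmod (f' i x) \<le> \<bar>C i\<bar>" for x by (auto simp: f'_def)
  qed
  have AE_f': "AE x in M. f i x = f' i x" if "i \<in> {1..l}" for i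
    using C[rule_format, OF that] by eventually_elim (simp add: f'_def)
  have int_f': "(\<integral>x. f' i x \<partial>M) = (\<integral>x. f i x \<partial>M)" if "i \<in> {1..l}" for i
  proof (rule integral_cong_AE)
    show "AE x in M. f' i x = f i x" using AE_f'[OF that] by eventually_elim simp
  qed (use f_meas[OF that] bounded_measurable_measurable[OF f'[OF that]] in auto)
  \<comment> \<open>Each null set is pulled back along a measure-preserving map; there are only
    countably many exponents, so a single null set serves all \<open>n\<close>.\<close>
  have AE_all: "AE x in M. \<forall>i\<in>{1..l}. \<forall>k. f i (A (unit_multiple i k) x) = f' i (A (unit_multiple i k) x)"
  proof (intro AE_finite_allI)
    fix i assume i: "i \<in> {1..l}"
    have "AE x in M. f i (A (unit_multiple i k) x) = f' i (A (unit_multiple i k) x)" for k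
      by (rule AE_distrD[OF A_measurable, of _ "unit_multiple i k"]) (unfold A_distr, rule AE_f'[OF i])
    then show "AE x in M. \<forall>k. f i (A (unit_multiple i k) x) = f' i (A (unit_multiple i k) x)"
      by (subst AE_all_countable) blast
  qed simp
  have kp: "koopman M (T i) k (f i) x = f i (A (unit_multiple i k) x)" if "i \<in> {1..l}" for i k x
  proof -
    have "A (unit_multiple i k) x = int_iterate M (T i) k x"
      unfolding A_def using that by (intro iterate_list_unit_multiple[OF assms(2)]) auto
    then show ?thesis by (simp add: koopman_def)
  qed
  have AE_eq: "AE x in M. (\<Sum>n=1..N. \<Prod>i=1..l. koopman M (T i) \<lfloor>g i (real n)\<rfloor> (f i) x) / of_nat N
      - (\<Prod>i=1..l. \<integral>y. f i y \<partial>M)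
    = wmean (\<lambda>_. 1) (\<lambda>n. \<Prod>i\<in>{1..l}. f' i (A (unit_multiple i \<lfloor>g i (real (Suc n))\<rfloor>) x)) N
      - (\<Prod>i\<in>{1..l}. \<integral>y. f' i y \<partial>M)" for N
    using AE_all
  proof eventually_elim
    case (elim x)
    have "(\<Sum>n=1..N. \<Prod>i=1..l. koopman M (T i) \<lfloor>g i (real n)\<rfloor> (f i) x)
        = (\<Sum>n<N. \<Prod>i=1..l. koopman M (T i) \<lfloor>g i (real (Suc n))\<rfloor> (f i) x)"
      by (rule sum.reindex_bij_witness[of _ Suc "\<lambda>n. n - 1"]) auto
    also have "\<dots> = (\<Sum>n<N. \<Prod>i\<in>{1..l}. f' i (A (unit_multiple i \<lfloor>g i (real (Suc n))\<rfloor>) x))"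
      using elim kp by (intro sum.cong prod.cong refl) metis
    finally show ?case
      using int_f' by (simp add: wmean_def divide_inverse_commute scaleR_conv_of_real)
  qed
  have L2: "L2_norm M (\<lambda>x. (\<Sum>n=1..N. \<Prod>i=1..l. koopman M (T i) \<lfloor>g i (real n)\<rfloor> (f i) x) / of_nat N
      - (\<Prod>i=1..l. \<integral>y. f i y \<partial>M))
    = sqrt (\<integral>x. (cmod (wmean (\<lambda>_. 1) (\<lambda>n. \<Prod>i\<in>{1..l}. f' i (A (unit_multiple i \<lfloor>g i (real (Suc n))\<rfloor>) x)) N
      - (\<Prod>i\<in>{1..l}. \<integral>y. f' i y \<partial>M)))\<^sup>2 \<partial>M)" for N
    unfolding L2_norm_def
  proof (intro arg_cong[where f = sqrt] integral_cong_AE)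
    show "AE x in M. (cmod ((\<Sum>n=1..N. \<Prod>i=1..l. koopman M (T i) \<lfloor>g i (real n)\<rfloor> (f i) x) / of_nat N
      - (\<Prod>i=1..l. \<integral>y. f i y \<partial>M)))\<^sup>2
      = (cmod (wmean (\<lambda>_. 1) (\<lambda>n. \<Prod>i\<in>{1..l}. f' i (A (unit_multiple i \<lfloor>g i (real (Suc n))\<rfloor>) x)) N
      - (\<Prod>i\<in>{1..l}. \<integral>y. f' i y \<partial>M)))\<^sup>2"
      using AE_eq[of N] by eventually_elim simp
    have "bounded_measurable M (\<lambda>x. wmean (\<lambda>_. 1) (\<lambda>n. \<Prod>i\<in>{1..l}. f' i (A (unit_multiple i \<lfloor>g i (real (Suc n))\<rfloor>) x)) N
      - (\<Prod>i\<in>{1..l}. \<integral>y. f' i y \<partial>M))"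
      by (intro bounded_measurable_diff bounded_measurable_wmean bounded_measurable_prod_A f' bounded_measurable_const)
    from bounded_measurable_measurable[OF this]
    show "(\<lambda>x. (cmod (wmean (\<lambda>_. 1) (\<lambda>n. \<Prod>i\<in>{1..l}. f' i (A (unit_multiple i \<lfloor>g i (real (Suc n))\<rfloor>) x)) N
      - (\<Prod>i\<in>{1..l}. \<integral>y. f' i y \<partial>M)))\<^sup>2) \<in> borel_measurable M"
      by (intro borel_measurable_power measurable_compose[OF _ borel_measurable_norm])
    have "(\<lambda>x. koopman M (T i) k (f i) x) \<in> borel_measurable M" if "i \<in> {1..l}" for i k
      unfolding kp[OF that] by (rule measurable_compose[OF A_measurable f_meas[OF that]])
    then show "(\<lambda>x. (cmod ((\<Sum>n=1..N. \<Prod>i=1..l. koopman M (T i) \<lfloor>g i (real n)\<rfloor> (f i) x) / of_nat N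
      - (\<Prod>i=1..l. \<integral>y. f i y \<partial>M)))\<^sup>2) \<in> borel_measurable M"
      by (intro borel_measurable_power measurable_compose[OF _ borel_measurable_norm] borel_measurable_diff borel_measurable_divide
          borel_measurable_sum borel_measurable_prod borel_measurable_const) auto
  qed
  show ?thesis
    unfolding L2
    using tendsto_real_sqrt[OF tempered_averages_tendsto[of l 1 g f', OF subset_refl _ _ assms(4) slower f']] by simp
qed

end
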